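(* Let $G$ be an swm-graph and let $G^*$ be its barycentric graph with the Hasse orientation $o^*$. Then $G^*$ is an orientable modular graph and $o^*$ is an admissible orientation of $G^*$. Moreover, if edges of $G$ have length $1$ and edges of $G^*$ have length $1/2$, the map $p\mapsto\{p\}$ is an isometric embedding of $G$ into $G^*$, i.e. $\tfrac12 d_{G^*}(\{p\},\{q\})=d_G(p,q)$ for all vertices $p,q$, where $d_{G^*}$ is the usual graph distance of $G^*$.
   Context: Graphs are simple, undirected, connected, possibly infinite; $I(u,v)=\{x:d(u,x)+d(x,v)=d(u,v)\}$. Weakly modular: for every vertex $u$, (TC) for $v,w$ with $1=d(v,w)<d(u,v)=d(u,w)$ there is a common neighbor $x$ of $v,w$ with $d(u,x)=d(u,v)-1$, and (QC) for $v,w,z$ with $d(v,z)=d(w,z)=1$, $2=d(v,w)\le d(u,v)=d(u,w)=d(u,z)-1$ there is a common neighbor $x$ of $v,w$ with $d(u,x)=d(u,v)-1$. An swm-graph is a weakly modular graph with no induced $K_4^-$ and no isometric $K_{3,3}^-$. A vertex set $X$ is gated if every vertex $x$ has $x'\in X$ with $x'\in I(x,y)$ for all $y\in X$. A graph is thick if for every $u,v$ at distance $2$, $I(u,v)$ contains an induced $4$--cycle. A set $X$ is Boolean-gated if it is gated and induces a thick subgraph. $\mathcal B(G)$ is the set of Boolean-gated sets of finite diameter, partially ordered by reverse inclusion; the barycentric graph $G^*$ is the covering graph of this poset, and the Hasse orientation $o^*$ orients each edge from the covering element to the covered one. A graph is modular if every triple $u,v,w$ has $I(u,v)\cap I(v,w)\cap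 I(w,u)\ne\emptyset$. An orientation of a modular graph is admissible if for every induced $4$--cycle $x_1x_2x_3x_4$ (indices mod $4$) one has $x_i\to x_{i+1}$ iff $x_{i+3}\to x_{i+2}$; a modular graph is orientable if it has an admissible orientation. *)

theory Defs
  imports Complex_Main
begin

definition simple_graph :: "'a set \<Rightarrow> ('a \<Rightarrow> 'a \<Rightarrow> bool) \<Rightarrow> bool" where
  "simple_graph V E \<longleftrightarrow>
     (\<forall>x y. E x y \<longrightarrow> x \<in> V \<and> y \<in> V) \<and>
     (\<forall>x y. E x y \<longrightarrow> E y x) \<and>
     (\<forall>x. \<not> E x x)"

definition walk_of_len :: "'a set \<Rightarrow> ('a \<Rightarrow> 'a \<Rightarrow> bool) \<Rightarrow> nat \<Rightarrow> 'a \<Rightarrow> 'a \<Rightarrow> bool" where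
  "walk_of_len V E n u v \<longleftrightarrow>
     (\<exists>p :: nat \<Rightarrow> 'a. p 0 = u \<and> p n = v \<and> (\<forall>i\<le>n. p i \<in> V) \<and>
        (\<forall>i<n. E (p i) (p (Suc i))))"

definition connected_graph :: "'a set \<Rightarrow> ('a \<Rightarrow> 'a \<Rightarrow> bool) \<Rightarrow> bool" where
  "connected_graph V E \<longleftrightarrow> simple_graph V E \<and>
     (\<forall>u\<in>V. \<forall>v\<in>V. \<exists>n. walk_of_len V E n u v)"

text \<open>Usual graph distance (edges of length 1); meaningful for connected graphs.\<close>
definition gdist :: "'a set \<Rightarrow> ('a \<Rightarrow> 'a \<Rightarrow> bool) \<Rightarrow> 'a \<Rightarrow> 'a \<Rightarrow> nat" where
  "gdist V E u v = (LEAST n. walk_of_len V E n u v)"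

definition interval :: "'a set \<Rightarrow> ('a \<Rightarrow> 'a \<Rightarrow> bool) \<Rightarrow> 'a \<Rightarrow> 'a \<Rightarrow> 'a set" where
  "interval V E u v = {x \<in> V. gdist V E u x + gdist V E x v = gdist V E u v}"

definition induced_adj :: "('a \<Rightarrow> 'a \<Rightarrow> bool) \<Rightarrow> 'a set \<Rightarrow> 'a \<Rightarrow> 'a \<Rightarrow> bool" where
  "induced_adj E X x y \<longleftrightarrow> x \<in> X \<and> y \<in> X \<and> E x y"

definition triangle_condition :: "'a set \<Rightarrow> ('a \<Rightarrow> 'a \<Rightarrow> bool) \<Rightarrow> bool" where
  "triangle_condition V E \<longleftrightarrow>
     (\<forall>u\<in>V. \<forall>v\<in>V. \<forall>w\<in>V.
        gdist V E v w = 1 \<and> 1 < gdist V E u v \<and> gdist V E u v = gdist V E u w \<longrightarrow>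
        (\<exists>x\<in>V. E x v \<and> E x w \<and> gdist V E u x = gdist V E u v - 1))"

definition quadrangle_condition :: "'a set \<Rightarrow> ('a \<Rightarrow> 'a \<Rightarrow> bool) \<Rightarrow> bool" where
  "quadrangle_condition V E \<longleftrightarrow>
     (\<forall>u\<in>V. \<forall>v\<in>V. \<forall>w\<in>V. \<forall>z\<in>V.
        gdist V E v z = 1 \<and> gdist V E w z = 1 \<and> gdist V E v w = 2 \<and>
        2 \<le> gdist V E u v \<and> gdist V E u v = gdist V E u w \<and>
        gdist V E u z = gdist V E u v + 1 \<longrightarrow>
        (\<exists>x\<in>V. E x v \<and> E x w \<and> gdist V E u x = gdist V E u v - 1))"

definition weakly_modular :: "'a set \<Rightarrow> ('a \<Rightarrow> 'a \<Rightarrow> bool) \<Rightarrow> bool" where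
  "weakly_modular V E \<longleftrightarrow> connected_graph V E \<and>
     triangle_condition V E \<and> quadrangle_condition V E"

definition has_induced_K4_minus :: "'a set \<Rightarrow> ('a \<Rightarrow> 'a \<Rightarrow> bool) \<Rightarrow> bool" where
  "has_induced_K4_minus V E \<longleftrightarrow>
     (\<exists>a\<in>V. \<exists>b\<in>V. \<exists>c\<in>V. \<exists>d\<in>V. distinct [a, b, c, d] \<and>
        E a b \<and> E a c \<and> E a d \<and> E b c \<and> E b d \<and> \<not> E c d)"

definition has_isometric_K33_minus :: "'a set \<Rightarrow> ('a \<Rightarrow> 'a \<Rightarrow> bool) \<Rightarrow> bool" where
  "has_isometric_K33_minus V E \<longleftrightarrow>
     (\<exists>a1\<in>V. \<exists>a2\<in>V. \<exists>a3\<in>V. \<exists>b1\<in>V. \<exists>b2\<in>V. \<exists>b3\<in>V.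
        distinct [a1, a2, a3, b1, b2, b3] \<and>
        gdist V E a1 a2 = 2 \<and> gdist V E a1 a3 = 2 \<and> gdist V E a2 a3 = 2 \<and>
        gdist V E b1 b2 = 2 \<and> gdist V E b1 b3 = 2 \<and> gdist V E b2 b3 = 2 \<and>
        gdist V E a1 b1 = 1 \<and> gdist V E a1 b2 = 1 \<and> gdist V E a1 b3 = 1 \<and>
        gdist V E a2 b1 = 1 \<and> gdist V E a2 b2 = 1 \<and> gdist V E a2 b3 = 1 \<and>
        gdist V E a3 b1 = 1 \<and> gdist V E a3 b2 = 1 \<and> gdist V E a3 b3 = 3)"

definition swm_graph :: "'a set \<Rightarrow> ('a \<Rightarrow> 'a \<Rightarrow> bool) \<Rightarrow> bool" where
  "swm_graph V E \<longleftrightarrow> weakly_modular V E \<and>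
     \<not> has_induced_K4_minus V E \<and> \<not> has_isometric_K33_minus V E"

definition gated :: "'a set \<Rightarrow> ('a \<Rightarrow> 'a \<Rightarrow> bool) \<Rightarrow> 'a set \<Rightarrow> bool" where
  "gated V E X \<longleftrightarrow> X \<subseteq> V \<and>
     (\<forall>x\<in>V. \<exists>x'\<in>X. \<forall>y\<in>X. x' \<in> interval V E x y)"

definition induced_4cycle :: "('a \<Rightarrow> 'a \<Rightarrow> bool) \<Rightarrow> 'a \<Rightarrow> 'a \<Rightarrow> 'a \<Rightarrow> 'a \<Rightarrow> bool" where
  "induced_4cycle E x1 x2 x3 x4 \<longleftrightarrow> distinct [x1, x2, x3, x4] \<and>
     E x1 x2 \<and> E x2 x3 \<and> E x3 x4 \<and> E x4 x1 \<and> \<not> E x1 x3 \<and> \<not> E x2 x4"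

definition thick :: "'a set \<Rightarrow> ('a \<Rightarrow> 'a \<Rightarrow> bool) \<Rightarrow> bool" where
  "thick V E \<longleftrightarrow>
     (\<forall>u\<in>V. \<forall>v\<in>V. gdist V E u v = 2 \<longrightarrow>
        (\<exists>x1\<in>interval V E u v. \<exists>x2\<in>interval V E u v.
         \<exists>x3\<in>interval V E u v. \<exists>x4\<in>interval V E u v. induced_4cycle E x1 x2 x3 x4))"

definition boolean_gated :: "'a set \<Rightarrow> ('a \<Rightarrow> 'a \<Rightarrow> bool) \<Rightarrow> 'a set \<Rightarrow> bool" where
  "boolean_gated V E X \<longleftrightarrow> gated V E X \<and> thick X (induced_adj E X)"

definition finite_diameter :: "'a set \<Rightarrow> ('a \<Rightarrow> 'a \<Rightarrow> bool) \<Rightarrow> 'a set \<Rightarrow> bool" where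
  "finite_diameter V E X \<longleftrightarrow> (\<exists>D. \<forall>x\<in>X. \<forall>y\<in>X. gdist V E x y \<le> D)"

definition BG :: "'a set \<Rightarrow> ('a \<Rightarrow> 'a \<Rightarrow> bool) \<Rightarrow> 'a set set" where
  "BG V E = {X. boolean_gated V E X \<and> finite_diameter V E X}"

text \<open>In B(G) ordered by reverse inclusion, X covers Y iff X is a proper subset of Y with
  no member of B(G) strictly in between. Hasse orientation: from the covering element X to Y.\<close>
definition hasse_orient :: "'a set \<Rightarrow> ('a \<Rightarrow> 'a \<Rightarrow> bool) \<Rightarrow> 'a set \<Rightarrow> 'a set \<Rightarrow> bool" where
  "hasse_orient V E X Y \<longleftrightarrow> X \<in> BG V E \<and> Y \<in> BG V E \<and> X \<subset> Y \<and>
     \<not> (\<exists>Z\<in>BG V E. X \<subset> Z \<and> Z \<subset> Y)"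

definition bary_adj :: "'a set \<Rightarrow> ('a \<Rightarrow> 'a \<Rightarrow> bool) \<Rightarrow> 'a set \<Rightarrow> 'a set \<Rightarrow> bool" where
  "bary_adj V E X Y \<longleftrightarrow> hasse_orient V E X Y \<or> hasse_orient V E Y X"

definition modular_graph :: "'b set \<Rightarrow> ('b \<Rightarrow> 'b \<Rightarrow> bool) \<Rightarrow> bool" where
  "modular_graph V E \<longleftrightarrow> connected_graph V E \<and>
     (\<forall>u\<in>V. \<forall>v\<in>V. \<forall>w\<in>V.
        interval V E u v \<inter> interval V E v w \<inter> interval V E w u \<noteq> {})"

definition orientation :: "'b set \<Rightarrow> ('b \<Rightarrow> 'b \<Rightarrow> bool) \<Rightarrow> ('b \<Rightarrow> 'b \<Rightarrow> bool) \<Rightarrow> bool" where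
  "orientation V E ori \<longleftrightarrow>
     (\<forall>x y. ori x y \<longrightarrow> E x y) \<and>
     (\<forall>x y. E x y \<longrightarrow> (ori x y \<or> ori y x) \<and> \<not> (ori x y \<and> ori y x))"

definition admissible_orientation :: "'b set \<Rightarrow> ('b \<Rightarrow> 'b \<Rightarrow> bool) \<Rightarrow> ('b \<Rightarrow> 'b \<Rightarrow> bool) \<Rightarrow> bool" where
  "admissible_orientation V E ori \<longleftrightarrow> orientation V E ori \<and>
     (\<forall>x1\<in>V. \<forall>x2\<in>V. \<forall>x3\<in>V. \<forall>x4\<in>V. induced_4cycle E x1 x2 x3 x4 \<longrightarrow>
        (ori x1 x2 \<longleftrightarrow> ori x4 x3) \<and> (ori x2 x3 \<longleftrightarrow> ori x1 x4) \<and>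
        (ori x3 x4 \<longleftrightarrow> ori x2 x1) \<and> (ori x4 x1 \<longleftrightarrow> ori x3 x2))"

definition orientable :: "'b set \<Rightarrow> ('b \<Rightarrow> 'b \<Rightarrow> bool) \<Rightarrow> bool" where
  "orientable V E \<longleftrightarrow> modular_graph V E \<and> (\<exists>ori. admissible_orientation V E ori)"

end

theory Submission
  imports Defs
begin

text \<open>
  Write \<open>dirs p x\<close> for the neighbours of \<open>p\<close> on geodesics to \<open>x\<close>. A pair \<open>(p, x)\<close> is Boolean if
  \<open>dirs p\<close> strictly grows along a geodesic from \<open>p\<close> to \<open>x\<close>; forbidding \<open>K\<^sub>3\<^sub>,\<^sub>3\<^sup>-\<close> makes this
  independent of the geodesic. For a set \<open>S\<close> of neighbours of \<open>p\<close> that is closed like a subspace of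
  the local geometry at \<open>p\<close>, the Boolean pairs \<open>(p, x)\<close> with \<open>dirs p x \<subseteq> S\<close> form a gated set, and all
  thick gated sets through \<open>p\<close> arise this way. This produces, for a Boolean pair \<open>(p, q)\<close>, a smallest
  thick gated set containing \<open>p\<close> and \<open>q\<close>, and its diameter is \<open>d p q\<close>. Hence the poset of
  Boolean-gated sets is graded by the diameter.

  The distance in the barycentric graph is the sum of the two directed Hausdorff distances.
  Expressed through mutual projections it satisfies the quadrangle condition, and a bipartite
  graph with the quadrangle condition is modular.
\<close>


section \<open>Graph distance and swm-graphs\<close>

text \<open>Thick swm-graphs of finite diameter are dual polar graphs, and this dictates the notion
  of a Boolean pair: there \<open>dirs p x\<close> has one vertex on each line of the subspace of
  the residue of \<open>p\<close> that belongs to \<open>x\<close>, so it grows strictly along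
  geodesics. Along a geodesic of length 2 whose ends have no second common neighbour it stays the
  same single vertex, so growth detects squares. The obstacle is that the hull of a Boolean pair
  \<open>(p, q)\<close> is controlled only at \<open>p\<close>: no neighbour of \<open>p\<close> in
  it is farther from \<open>q\<close>. That this local maximum is the diameter takes an induction in
  which antipodes move along with the vertices. The two directed Hausdorff distances are added
  because along a covering pair one of them is 0 and the other at most 1. Between singletons both
  equal \<open>d p q\<close>, whence the factor 1/2.\<close>

lemma walk_0: "u \<in> V \<Longrightarrow> walk_of_len V E 0 u u"
  unfolding walk_of_len_def by (rule exI[of _ "\<lambda>_. u"]) auto

lemma walk_0_eq: "walk_of_len V E 0 u v \<Longrightarrow> u = v"
  unfolding walk_of_len_def by auto

lemma walk_Suc:
  "walk_of_len V E (Suc n) u v \<longleftrightarrow> u \<in> V \<and> (\<exists>w. E u w \<and> walk_of_len V E n w v)"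
proof
  assume "walk_of_len V E (Suc n) u v"
  then obtain p where p: "p 0 = u" "p (Suc n) = v" "\<forall>i\<le>Suc n. p i \<in> V" "\<forall>i<Suc n. E (p i) (p (Suc i))"
    unfolding walk_of_len_def by auto
  have "walk_of_len V E n (p 1) v"
    unfolding walk_of_len_def by (rule exI[of _ "\<lambda>i. p (Suc i)"]) (use p in auto)
  then show "u \<in> V \<and> (\<exists>w. E u w \<and> walk_of_len V E n w v)"
    using p by (metis One_nat_def zero_less_Suc le0)
next
  assume "u \<in> V \<and> (\<exists>w. E u w \<and> walk_of_len V E n w v)"
  then obtain w p where "u \<in> V" "E u w" "p 0 = w" "p n = v" "\<forall>i\<le>n. p i \<in> V" "\<forall>i<n. E (p i) (p (Suc i))"
    unfolding walk_of_len_def by auto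
  then show "walk_of_len V E (Suc n) u v"
    unfolding walk_of_len_def
    by (intro exI[of _ "\<lambda>i. case i of 0 \<Rightarrow> u | Suc j \<Rightarrow> p j"]) (auto split: nat.splits simp: less_Suc_eq_0_disj)
qed

lemma walk_trans:
  "walk_of_len V E m u v \<Longrightarrow> walk_of_len V E n v w \<Longrightarrow> walk_of_len V E (m + n) u w"
  by (induction m arbitrary: u) (auto simp: walk_Suc dest: walk_0_eq)

lemma walk_1: "simple_graph V E \<Longrightarrow> E u v \<Longrightarrow> walk_of_len V E (Suc 0) u v"
  unfolding walk_Suc simple_graph_def by (metis walk_0)

lemma walk_sym: "simple_graph V E \<Longrightarrow> walk_of_len V E n u v \<Longrightarrow> walk_of_len V E n v u"
proof (induction n arbitrary: u)
  case (Suc n)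
  then obtain w where "E u w" "walk_of_len V E n w v" "u \<in> V" by (auto simp: walk_Suc)
  then show ?case
    using Suc walk_trans[of V E n v w "Suc 0" u] walk_1[of V E w u] by (simp add: simple_graph_def)
qed (auto dest: walk_0_eq)

lemma gdist_commute: "simple_graph V E \<Longrightarrow> gdist V E u v = gdist V E v u"
  unfolding gdist_def by (metis walk_sym)

lemma gdist_le: "walk_of_len V E n u v \<Longrightarrow> gdist V E u v \<le> n"
  unfolding gdist_def by (rule Least_le)

text \<open>Descent gives a walk of length \<open>D x y\<close>, the Lipschitz bound shows that no
  walk is shorter. Descent is allowed at either end because \<open>hdist_descent\<close> moves
  whichever of the two sets is easier to move.\<close>

lemma gdist_characterization:
  fixes D :: "'b \<Rightarrow> 'b \<Rightarrow> nat"
  assumes sg: "simple_graph V E"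
    and refl: "\<And>x. x \<in> V \<Longrightarrow> D x x = 0"
    and lip: "\<And>x y z. x \<in> V \<Longrightarrow> E y z \<Longrightarrow> D x z \<le> Suc (D x y)"
    and sym: "\<And>x y. x \<in> V \<Longrightarrow> y \<in> V \<Longrightarrow> D x y = D y x"
    and desc: "\<And>x y. x \<in> V \<Longrightarrow> y \<in> V \<Longrightarrow> x \<noteq> y \<Longrightarrow>
      (\<exists>z. E y z \<and> Suc (D x z) = D x y) \<or> (\<exists>z. E x z \<and> Suc (D z y) = D x y)"
    and xy: "x \<in> V" "y \<in> V"
  shows "walk_of_len V E (D x y) x y" and "gdist V E x y = D x y"
proof -
  have adj_V: "\<And>x y. E x y \<Longrightarrow> x \<in> V \<and> y \<in> V \<and> E y x" using sg by (auto simp: simple_graph_def)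
  show w: "walk_of_len V E (D x y) x y" using xy
  proof (induction "D x y" arbitrary: x y)
    case 0
    then have "x = y" using desc by (metis nat.distinct(1))
    then show ?case using 0 refl by (simp add: walk_0)
  next
    case (Suc n)
    show ?case
    proof (cases "x = y")
      case False
      from desc[OF Suc(3,4) False] show ?thesis
      proof
        assume "\<exists>z. E y z \<and> Suc (D x z) = D x y"
        then obtain z where z: "E y z" "Suc (D x z) = D x y" by auto
        then have "walk_of_len V E n x z" using Suc adj_V by (metis nat.inject)
        then show ?thesis using walk_trans[of V E n x z "Suc 0" y] walk_1[OF sg] adj_V[OF z(1)] Suc(2)
          by simp
      next
        assume "\<exists>z. E x z \<and> Suc (D z y) = D x y"
        then obtain z where z: "E x z" "Suc (D z y) = D x y" by auto
        then have "walk_of_len V E n z y" using Suc adj_V by (metis nat.inject)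
        then show ?thesis using z Suc(2,3) walk_Suc by metis
      qed
    qed (use Suc refl in auto)
  qed
  have "D x v \<le> D x u + n" if "walk_of_len V E n u v" for u v n
    using that
  proof (induction n arbitrary: u)
    case (Suc n)
    then obtain w where "E u w" "walk_of_len V E n w v" by (auto simp: walk_Suc)
    then show ?case using Suc.IH[of w] lip[OF xy(1), of u w] by simp
  qed (auto dest: walk_0_eq)
  then have "D x y \<le> n" if "walk_of_len V E n x y" for n
    using that refl xy by (metis add_0)
  then show "gdist V E x y = D x y"
    unfolding gdist_def using w by (intro Least_equality) auto
qed

locale conn_graph =
  fixes V :: "'a set" and E :: "'a \<Rightarrow> 'a \<Rightarrow> bool"
  assumes connected: "connected_graph V E"
begin

abbreviation d :: "'a \<Rightarrow> 'a \<Rightarrow> nat" where "d \<equiv> gdist V E"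

lemma simple: "simple_graph V E"
  using connected by (simp add: connected_graph_def)

lemma adj_V: "E x y \<Longrightarrow> x \<in> V" "E x y \<Longrightarrow> y \<in> V"
  using simple by (auto simp: simple_graph_def)

lemma adj_sym: "E x y \<Longrightarrow> E y x"
  using simple by (auto simp: simple_graph_def)

lemma adj_irrefl: "\<not> E x x"
  using simple by (auto simp: simple_graph_def)

lemma dist_comm: "d x y = d y x"
  by (rule gdist_commute[OF simple])

lemma dist_walk: "u \<in> V \<Longrightarrow> v \<in> V \<Longrightarrow> walk_of_len V E (d u v) u v"
  unfolding gdist_def using connected by (auto simp: connected_graph_def intro: LeastI_ex)

lemma dist_self [simp]: "x \<in> V \<Longrightarrow> d x x = 0"
  using gdist_le[OF walk_0[of x V E]] by simp

lemma dist_eq_0: "x \<in> V \<Longrightarrow> y \<in> V \<Longrightarrow> d x y = 0 \<longleftrightarrow> x = y"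
  using dist_walk[of x y] walk_0_eq[of V E x y] by auto

lemma dist_triangle: "x \<in> V \<Longrightarrow> y \<in> V \<Longrightarrow> z \<in> V \<Longrightarrow> d x z \<le> d x y + d y z"
  using gdist_le[OF walk_trans[OF dist_walk[of x y] dist_walk[of y z]]] by blast

lemma dist_pred: "x \<in> V \<Longrightarrow> y \<in> V \<Longrightarrow> d x y = Suc n \<Longrightarrow> \<exists>w. E y w \<and> d x w = n"
proof -
  assume a: "x \<in> V" "y \<in> V" "d x y = Suc n"
  then have "walk_of_len V E (Suc n) y x" using dist_walk dist_comm by metis
  then obtain w where w: "E y w" "walk_of_len V E n w x" by (auto simp: walk_Suc)
  then have "d x w \<le> n" using gdist_le dist_comm by metis
  moreover have "Suc n \<le> d x w + 1"
    using a dist_triangle[of x w y] adj_V w gdist_le[OF walk_1[OF simple adj_sym[OF w(1)]]] by fastforce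
  ultimately show ?thesis using w by auto
qed

lemma dist_eq_1: "x \<in> V \<Longrightarrow> y \<in> V \<Longrightarrow> d x y = Suc 0 \<longleftrightarrow> E x y"
proof
  assume a: "x \<in> V" "y \<in> V"
  show "E x y" if "d x y = Suc 0"
    using dist_pred[OF a that] dist_eq_0[OF a(1)] adj_V adj_sym by metis
  show "d x y = Suc 0" if "E x y"
    using gdist_le[OF walk_1[OF simple that]] dist_eq_0[OF a] adj_irrefl[of x] that
    by (cases "x = y") auto
qed

lemma dist_adj: "E x y \<Longrightarrow> d x y = Suc 0"
  using dist_eq_1 adj_V by blast

lemma adj_dist_le: "E x y \<Longrightarrow> p \<in> V \<Longrightarrow> d p x \<le> Suc (d p y) \<and> d p y \<le> Suc (d p x)"
  using dist_triangle[of p x y] dist_triangle[of p y x] adj_V[of x y] dist_adj[of x y] dist_comm[of y x] by simp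

lemma dist_2I: "E x y \<Longrightarrow> E y z \<Longrightarrow> x \<noteq> z \<Longrightarrow> \<not> E x z \<Longrightarrow> d x z = 2"
proof -
  assume a: "E x y" "E y z" "x \<noteq> z" "\<not> E x z"
  have "d x z \<le> 2" using adj_dist_le[OF a(2) adj_V(1)[OF a(1)]] dist_adj[OF a(1)] by simp
  moreover have "d x z \<noteq> 0" "d x z \<noteq> 1" using a dist_eq_0 dist_eq_1 adj_V by auto
  ultimately show ?thesis by linarith
qed

end

section \<open>Triangles and quadrangles in swm-graphs\<close>

locale swm = conn_graph V E for V :: "'a set" and E +
  assumes swm: "swm_graph V E"
begin

text \<open>At distance 1 the vertex \<open>p\<close> itself is the common neighbour, so the lower
  bound on the distance in the definition disappears.\<close>

lemma triangle_cond:
  assumes "E x y" "p \<in> V" "d p x = d p y"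
  shows "\<exists>z. E z x \<and> E z y \<and> Suc (d p z) = d p x"
proof -
  have V: "x \<in> V" "y \<in> V" using assms adj_V by auto
  have "d p x \<noteq> 0" using assms V dist_eq_0 adj_irrefl by metis
  moreover have ?thesis if "d p x = 1"
    using that assms V dist_eq_1[of p] dist_self by (intro exI[of _ p]) (metis One_nat_def)
  moreover have ?thesis if "d p x > 1"
  proof -
    have dxy: "d x y = 1" using assms dist_adj by auto
    have "triangle_condition V E" using swm by (auto simp: swm_graph_def weakly_modular_def)
    then have "\<exists>z\<in>V. E z x \<and> E z y \<and> d p z = d p x - 1"
      unfolding triangle_condition_def using assms V dxy that by simp
    then obtain z where "E z x" "E z y" "d p z = d p x - 1" by blast
    then show ?thesis using that by (intro exI[of _ z]) auto
  qed
  ultimately show ?thesis by (meson less_one nat_neq_iff)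
qed

lemma no_K4_minus: "E a b \<Longrightarrow> E a x \<Longrightarrow> E b x \<Longrightarrow> E a y \<Longrightarrow> E b y \<Longrightarrow> x \<noteq> y \<Longrightarrow> E x y"
proof (rule ccontr)
  assume a: "E a b" "E a x" "E b x" "E a y" "E b y" "x \<noteq> y" "\<not> E x y"
  then have "has_induced_K4_minus V E"
    unfolding has_induced_K4_minus_def using adj_V adj_irrefl adj_sym
    by (intro bexI[of _ a] bexI[of _ b] bexI[of _ x] bexI[of _ y]) auto
  then show False using swm by (auto simp: swm_graph_def)
qed

text \<open>Two equidistant vertices of a clique have a common neighbour closer to \<open>p\<close>,
  and \<open>no_K4_minus\<close> puts it into the same maximal clique. So every line has a unique
  vertex nearest to \<open>p\<close>, the others being one step farther.\<close>

lemma triangle_third: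
  assumes "E a b" "E b c" "E a c" "p \<in> V" "d p a = d p b"
  shows "d p c \<le> d p a"
proof -
  obtain z where z: "E z a" "E z b" "Suc (d p z) = d p a" using triangle_cond assms by blast
  show ?thesis
  proof (cases "z = c")
    case False
    then have "E z c" using no_K4_minus[of a b z c] assms z adj_sym by blast
    then show ?thesis using adj_dist_le[of z c p] assms z by simp
  qed (use z in auto)
qed

lemma quadrangle_nonadj:
  assumes "E t a" "E t b" "p \<in> V" "d p a = d p b" "d p t = Suc (d p a)"
  shows "\<not> E a b"
  using triangle_third[of a b t p] assms adj_sym by auto

text \<open>\<open>quadrangle_nonadj\<close> supplies the distance 2 between \<open>a\<close> and
  \<open>b\<close> that the definition asks for; if \<open>a\<close> and \<open>b\<close> are
  adjacent to \<open>p\<close>, then \<open>p\<close> serves.\<close>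

lemma quadrangle_cond:
  assumes "E t a" "E t b" "a \<noteq> b" "p \<in> V" "d p a = d p b" "d p t = Suc (d p a)"
  shows "\<exists>c. E c a \<and> E c b \<and> Suc (d p c) = d p a"
proof -
  have V: "t \<in> V" "a \<in> V" "b \<in> V" using assms adj_V by auto
  have n0: "d p a \<noteq> 0" using assms V dist_eq_0 by metis
  show ?thesis
  proof (cases "d p a = 1")
    case True
    then show ?thesis using assms V dist_eq_1[of p] by (intro exI[of _ p]) (metis One_nat_def dist_self)
  next
    case False
    have dab: "d a b = 2" using dist_2I[of a t b] quadrangle_nonadj[of t a b p] assms adj_sym by blast
    have dt: "d a t = 1" "d b t = 1" using assms adj_sym dist_adj by auto
    have q: "quadrangle_condition V E" using swm by (auto simp: swm_graph_def weakly_modular_def)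
    have "\<exists>x\<in>V. E x a \<and> E x b \<and> d p x = d p a - 1"
      using q[unfolded quadrangle_condition_def, rule_format, of p a b t] assms V dab dt False n0
      by simp
    then obtain z where "E z a" "E z b" "d p z = d p a - 1" by blast
    then show ?thesis using n0 by (intro exI[of _ z]) auto
  qed
qed

text \<open>Two different such vertices \<open>c\<close>, \<open>c'\<close> and a common neighbour \<open>e\<close> of them one step closer to \<open>p\<close>
  would give an isometric \<open>K\<^sub>3\<^sub>,\<^sub>3\<^sup>-\<close> with parts \<open>a\<close>, \<open>b\<close>, \<open>e\<close> and \<open>c\<close>, \<open>c'\<close>, \<open>t\<close>.\<close>

lemma quadrangle_unique:
  assumes "E t a" "E t b" "a \<noteq> b" "p \<in> V" "d p a = d p b" "d p t = Suc (d p a)"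
    and "E c a" "E c b" "Suc (d p c) = d p a" and "E c' a" "E c' b" "Suc (d p c') = d p a"
  shows "c = c'"
proof (rule ccontr)
  assume n: "c \<noteq> c'"
  have V: "t \<in> V" "a \<in> V" "b \<in> V" "c \<in> V" "c' \<in> V" using assms adj_V by auto
  have nab: "\<not> E a b" using quadrangle_nonadj assms by blast
  obtain e where e: "E e c" "E e c'" "Suc (d p e) = d p c"
    using quadrangle_cond[of a c c' p] n assms adj_sym by (metis nat.inject)
  have eV: "e \<in> V" using e adj_V by blast
  have ncc: "\<not> E c c'" using quadrangle_nonadj[of a c c' p] assms adj_sym by (metis nat.inject)
  have le: "d p y \<le> d p x + d x y" if "x \<in> V" "y \<in> V" for x y using dist_triangle assms that by blast
  have A: "d t c \<ge> 2" "d t c' \<ge> 2" "d t e \<ge> 3" "d a e \<ge> 2" "d b e \<ge> 2"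
    using le[of c t] le[of c' t] le[of e t] le[of e a] le[of e b] V eV assms e dist_comm by auto
  have ne: "a \<noteq> e" "b \<noteq> e" "c \<noteq> t" "c' \<noteq> t" "\<not> E a e" "\<not> E b e" "\<not> E c t" "\<not> E c' t"
    using A dist_adj dist_comm V eV by fastforce+
  have B: "d a b = 2" "d a e = 2" "d b e = 2" "d c c' = 2" "d c t = 2" "d c' t = 2"
    using dist_2I[of a c b] dist_2I[of a c e] dist_2I[of b c e] dist_2I[of c a c'] dist_2I[of c a t] dist_2I[of c' a t]
      nab ncc n assms e ne adj_sym by blast+
  have C: "d e t = 3"
    using A adj_dist_le[of t a e] assms(1) eV B(2) dist_comm[of e] by simp
  have dis: "distinct [a, b, e, c, c', t]"
    using assms(3) n e(1,2) ne nab assms adj_irrefl C V eV by auto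
  have ones: "d a c = 1" "d a c' = 1" "d a t = 1" "d b c = 1" "d b c' = 1" "d b t = 1" "d e c = 1" "d e c' = 1"
    using dist_adj assms e adj_sym by simp_all
  have "has_isometric_K33_minus V E"
    unfolding has_isometric_K33_minus_def
    by (rule bexI[of _ a], rule bexI[of _ b], rule bexI[of _ e], rule bexI[of _ c], rule bexI[of _ c'],
        rule bexI[of _ t], (intro conjI; fact)) (fact V eV)+
  then show False using swm by (auto simp: swm_graph_def)
qed

end

section \<open>Boolean pairs\<close>

context swm begin

definition dirs :: "'a \<Rightarrow> 'a \<Rightarrow> 'a set" where
  "dirs p x = {s. E p s \<and> Suc (d s x) = d p x}"

lemma dirsE: "s \<in> dirs p x \<Longrightarrow> E p s \<and> Suc (d s x) = d p x"
  by (simp add: dirs_def)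

lemma dirs_mono: "E y x \<Longrightarrow> p \<in> V \<Longrightarrow> d p x = Suc (d p y) \<Longrightarrow> dirs p y \<subseteq> dirs p x"
proof
  fix s assume a: "E y x" "p \<in> V" "d p x = Suc (d p y)" "s \<in> dirs p y"
  then have s: "E p s" "Suc (d s y) = d p y" by (auto simp: dirs_def)
  then have "Suc (d s x) = d p x"
    using adj_dist_le[of y x s] adj_dist_le[of p s x] a adj_V by (auto simp: dist_comm)
  then show "s \<in> dirs p x" using s by (auto simp: dirs_def)
qed

lemma dirs_nonadj: "s \<in> dirs p x \<Longrightarrow> s' \<in> dirs p x \<Longrightarrow> x \<in> V \<Longrightarrow> \<not> E s s'"
  using quadrangle_nonadj[of p s s' x] dirsE[of s p x] dirsE[of s' p x] by (metis dist_comm nat.inject)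

text \<open>If \<open>d s y = d p y\<close>, the line of \<open>p\<close> and \<open>s\<close> has a
  vertex \<open>z\<close> closer to \<open>y\<close>; then \<open>z\<close> and \<open>s\<close> are
  equidistant from \<open>u\<close>, and \<open>triangle_third\<close> makes \<open>p\<close> no
  farther from \<open>u\<close> than they are.\<close>

lemma dirs_new:
  assumes "E y u" "p \<in> V" "d p u = Suc (d p y)" "s \<in> dirs p u" "s \<notin> dirs p y"
  shows "d s y = Suc (d p y)"
proof -
  have s: "E p s" "d s u = d p y" using assms by (auto simp: dirs_def)
  have V: "y \<in> V" "u \<in> V" "s \<in> V" using assms s adj_V by auto
  have ne: "Suc (d s y) \<noteq> d p y" using assms s by (auto simp: dirs_def)
  have "d s y \<noteq> d p y"
  proof
    assume eq: "d s y = d p y"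
    then obtain z where z: "E z p" "E z s" "Suc (d y z) = d y p"
      using triangle_cond[of p s y] s V by (auto simp: dist_comm)
    have "d u z = d u s"
      using adj_dist_le[of y u z] adj_dist_le[of z p u] z s assms V adj_V by (auto simp: dist_comm)
    then have "d u p \<le> d u z" using triangle_third[of z s p u] z s V adj_sym by blast
    then show False using \<open>d u z = d u s\<close> s assms by (simp add: dist_comm)
  qed
  then show ?thesis
    using adj_dist_le[of y u s] adj_dist_le[of p s y] ne s V assms by (auto simp: dist_comm)
qed

text \<open>Opposite sides \<open>c a\<close> and \<open>b t\<close> of a square gain the same
  directions. If \<open>s\<close> pointed to \<open>b\<close> as well, the quadrangle condition seen
  from \<open>s\<close> would give a second common neighbour of \<open>a\<close> and
  \<open>b\<close> at the level of \<open>c\<close>, against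
  \<open>quadrangle_unique\<close>.\<close>

lemma transfer_dir:
  assumes E: "E c a" "E c b" "E a t" "E b t" and ab: "a \<noteq> b" and p: "p \<in> V"
    and h: "d p a = Suc (d p c)" "d p b = Suc (d p c)" "d p t = Suc (Suc (d p c))"
    and s: "s \<in> dirs p a" "s \<notin> dirs p c"
  shows "s \<in> dirs p t" "s \<notin> dirs p b"
proof -
  show "s \<in> dirs p t" using dirs_mono[of a t p] assms by auto
  have sc: "d s c = Suc (d p c)" using dirs_new[of c a p s] assms by simp
  have sa: "E p s" "d s a = d p c" using s h by (auto simp: dirs_def)
  have sV: "s \<in> V" using sa adj_V by auto
  show "s \<notin> dirs p b"
  proof
    assume "s \<in> dirs p b"
    then have sb: "d s b = d p c" using h by (auto simp: dirs_def)
    then obtain g where g: "E g a" "E g b" "Suc (d s g) = d s a"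
      using quadrangle_cond[of c a b s] E ab sa sc sV by auto
    have gV: "g \<in> V" using g adj_V by auto
    have "d p g \<le> d p c" using adj_dist_le[OF sa(1) gV] g sa by (simp add: dist_comm)
    then have "Suc (d p g) = d p a" using adj_dist_le[OF g(1) p] h by simp
    then have "g = c"
      using quadrangle_unique[OF adj_sym[OF E(3)] adj_sym[OF E(4)] ab p _ _ g(1,2) _ E(1,2)] h by metis
    then show False using g sa sc by simp
  qed
qed

text \<open>A converse of \<open>transfer_dir\<close>: seen from \<open>s\<close>, both
  \<open>y\<close> and \<open>t\<close> are closer than \<open>u\<close>, so the quadrangle
  condition completes a square in which the gain of the second step \<open>u t\<close> moves to the
  first step \<open>y g\<close>.\<close>

lemma lift_dir:
  assumes E: "E y u" "E u t" and p: "p \<in> V"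
    and h: "d p u = Suc (d p y)" "d p t = Suc (d p u)"
    and s: "s \<in> dirs p t" "s \<notin> dirs p u"
  shows "\<exists>g. E y g \<and> E g t \<and> g \<noteq> u \<and> d p g = Suc (d p y) \<and> s \<in> dirs p g \<and> s \<notin> dirs p y"
proof -
  have su: "d s u = Suc (d p u)" using dirs_new[of u t p s] assms by simp
  have st: "E p s" "d s t = d p u" using s h by (auto simp: dirs_def)
  have V: "s \<in> V" "y \<in> V" "t \<in> V" using st E adj_V by auto
  have sy: "d s y = d p u"
    using adj_dist_le[OF E(1) V(1)] adj_dist_le[OF st(1) V(2)] su h by (simp add: dist_comm)
  have "y \<noteq> t" using h by auto
  then obtain g where g: "E g y" "E g t" "Suc (d s g) = d s y"
    using quadrangle_cond[of u y t s] E adj_sym V sy st su by metis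
  have gV: "g \<in> V" using g adj_V by auto
  have hg: "d p g = Suc (d p y)"
    using adj_dist_le[OF st(1) gV] adj_dist_le[OF g(2) p] g sy h by (simp add: dist_comm)
  have "s \<in> dirs p g" using g sy hg h st by (auto simp: dirs_def)
  moreover have "s \<notin> dirs p y" using sy h by (auto simp: dirs_def)
  moreover have "g \<noteq> u" using g sy su h by auto
  ultimately show ?thesis using g hg adj_sym by blast
qed

text \<open>The square \<open>y\<close>, \<open>u\<close>, \<open>t\<close>, \<open>v\<close> is parallel to the square \<open>p\<close>, \<open>su\<close>, \<open>c\<close>, \<open>sv\<close>. The cases
  \<open>d y c = d y p\<close> and \<open>d y c = d y p + 1\<close> contradict the uniqueness in the quadrangle condition.\<close>

lemma parallel_dirs:
  assumes E: "E y u" "E y v" "E u t" "E v t" and uv: "u \<noteq> v" and p: "p \<in> V"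
    and h: "d p u = Suc (d p y)" "d p v = Suc (d p y)" "d p t = Suc (Suc (d p y))"
    and su: "su \<in> dirs p u" "su \<notin> dirs p y" and sv: "sv \<in> dirs p v" "sv \<notin> dirs p y"
  shows "\<exists>c. E c su \<and> E c sv \<and> su \<noteq> sv \<and> \<not> E su sv \<and> d p c = 2 \<and>
    (\<forall>g. E y g \<longrightarrow> E g t \<longrightarrow> d p g = Suc (d p y) \<longrightarrow> (\<exists>s'. E p s' \<and> E c s' \<and> s' \<in> dirs p g \<and> s' \<notin> dirs p y))"
proof -
  let ?k = "d p y"
  have V: "y \<in> V" "u \<in> V" "v \<in> V" "t \<in> V" using E adj_V by auto
  have A: "su \<in> dirs p t" "su \<notin> dirs p v" "sv \<in> dirs p t" "sv \<notin> dirs p u"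
    using transfer_dir[of y u v t p su] transfer_dir[of y v u t p sv] assms by auto
  have ps: "E p su" "E p sv" using su sv by (auto simp: dirs_def)
  have sV: "su \<in> V" "sv \<in> V" using ps adj_V by auto
  have ne: "su \<noteq> sv" using A sv by auto
  have nadj: "\<not> E su sv" using dirs_nonadj A V by blast
  have d1: "d u su = ?k" "d v sv = ?k" "d t su = Suc ?k" "d t sv = Suc ?k"
    "d u p = Suc ?k" "d v p = Suc ?k" "d t p = Suc (Suc ?k)"
    using su sv A h by (auto simp: dirs_def dist_comm)
  have d2: "d y su = Suc ?k" "d y sv = Suc ?k"
    using dirs_new[of y u p su] dirs_new[of y v p sv] assms by (simp_all add: dist_comm)
  have d3: "d u sv = Suc (Suc ?k)" "d v su = Suc (Suc ?k)"
    using dirs_new[of u t p sv] dirs_new[of v t p su] assms A by (simp_all add: dist_comm)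
  obtain c where c: "E c su" "E c sv" "d t c = ?k"
    using quadrangle_cond[of p su sv t] ps ne V d1 by auto
  have cV: "c \<in> V" using c adj_V by auto
  have cu: "d u c = Suc ?k"
    using adj_dist_le[OF c(2) V(2)] adj_dist_le[OF c(1) V(2)] d1 d3 by simp
  have npc: "p \<noteq> c" using c d1 by auto
  have pc: "d p c = 2"
    using dist_2I[of p su c] ps c adj_sym adj_dist_le[of p c t] V d1 npc by auto
  have 1: "d y c \<noteq> ?k"
  proof
    assume yc: "d y c = ?k"
    obtain e where e: "E e p" "E e c" "Suc (d y e) = ?k"
      using quadrangle_cond[of su p c y] ps c adj_sym npc V d2 yc by (auto simp: dist_comm)
    have eV: "e \<in> V" using e adj_V by auto
    have ue: "d u e = ?k" using adj_dist_le[OF E(1) eV] adj_dist_le[OF e(1) V(2)] e d1 by (simp add: dist_comm)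
    have "e \<noteq> su" using e d2 by auto
    then obtain c2 where c2: "E c2 e" "E c2 su" "Suc (d u c2) = ?k"
      using quadrangle_cond[of p e su u] e(1) ps adj_sym V ue d1 by auto
    have c2V: "c2 \<in> V" using c2 adj_V by auto
    have te: "d t e = Suc ?k"
      using adj_dist_le[OF e(1) V(4)] adj_dist_le[OF e(2) V(4)] c d1 by simp
    have "d t c2 = ?k"
      using adj_dist_le[OF E(3) c2V] adj_dist_le[OF c2(1) V(4)] c2 te by (simp add: dist_comm)
    then have "c = c2"
      using quadrangle_unique[of p e su t c c2] e ps adj_sym V te d1 c c2 \<open>e \<noteq> su\<close> by simp
    then show False using c2 cu by simp
  qed
  have 2: "d y c \<noteq> Suc ?k"
  proof
    assume yc: "d y c = Suc ?k"
    \<comment> \<open>The first case is repeated with \<open>f\<close> and \<open>sf\<close> in the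
      roles of \<open>y\<close> and \<open>p\<close>: \<open>f\<close> is the third vertex of a
      triangle on \<open>y u\<close>, and \<open>sf\<close> lies on the line of \<open>p\<close> and
      \<open>su\<close>.\<close>
    obtain f where f: "E f u" "E f y" "d c f = ?k"
      using triangle_cond[of u y c] E(1) adj_sym cV cu yc by (auto simp: dist_comm)
    have fV: "f \<in> V" using f adj_V by auto
    have hf: "d f p = Suc ?k"
    proof -
      have "d p f \<noteq> ?k" using triangle_third[of y f u p] f E(1) adj_sym p h by auto
      then show ?thesis using adj_dist_le[OF f(1) p] adj_dist_le[OF f(2) p] h by (simp add: dist_comm)
    qed
    have sf0: "d f su = Suc ?k"
    proof -
      have "d su f \<noteq> ?k" using triangle_third[of u f y su] f E(1) adj_sym sV d1 d2 by (auto simp: dist_comm)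
      then show ?thesis using adj_dist_le[OF f(1) sV(1)] adj_dist_le[OF ps(1) fV] hf d1 by (simp add: dist_comm)
    qed
    obtain sf where sf: "E sf p" "E sf su" "d f sf = ?k"
      using triangle_cond[of p su f] ps fV sf0 hf by auto
    have sfV: "sf \<in> V" using sf adj_V by auto
    have tsf: "d t sf = Suc (Suc ?k)"
    proof -
      have "d t sf \<noteq> Suc ?k" using triangle_third[of su sf p t] sf ps adj_sym V d1 by auto
      moreover have "d t sf \<le> Suc (Suc ?k)" using adj_dist_le[OF sf(2) V(4)] d1 by simp
      ultimately show ?thesis using adj_dist_le[OF sf(1) V(4)] d1 by simp
    qed
    have usf: "d u sf = Suc ?k"
    proof -
      have "d u sf \<noteq> ?k" using triangle_third[of su sf p u] sf ps adj_sym V d1 by auto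
      then show ?thesis using adj_dist_le[OF sf(1) V(2)] adj_dist_le[OF sf(2) V(2)] d1 by simp
    qed
    have "sf \<noteq> c" using tsf c by auto
    moreover have fc: "d f c = ?k" using f(3) by (simp add: dist_comm)
    ultimately obtain e where e: "E e sf" "E e c" "Suc (d f e) = ?k"
      using quadrangle_cond[OF adj_sym[OF sf(2)] adj_sym[OF c(1)] _ fV] sf(3) sf0 by auto
    have eV: "e \<in> V" using e adj_V by auto
    have te: "d t e = Suc ?k" using adj_dist_le[OF e(1) V(4)] adj_dist_le[OF e(2) V(4)] tsf c by simp
    have ue: "d u e = ?k"
      using adj_dist_le[OF f(1) eV] adj_dist_le[OF E(3) eV] e te by (simp add: dist_comm)
    have "su \<noteq> e" using e sf0 by auto
    then obtain e2 where e2: "E e2 su" "E e2 e" "Suc (d u e2) = ?k"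
      using quadrangle_cond[of sf su e u] sf(2) e(1) adj_sym V usf ue d1 by auto
    have e2V: "e2 \<in> V" using e2 adj_V by auto
    have "d t e2 = ?k"
      using adj_dist_le[OF E(3) e2V] adj_dist_le[OF e2(1) V(4)] e2 d1 by (simp add: dist_comm)
    then have "c = e2"
      using quadrangle_unique[of sf su e t c e2] sf e e2 c adj_sym V \<open>su \<noteq> e\<close> tsf te d1 by simp
    then show False using e2 cu by simp
  qed
  have yc: "d y c = Suc (Suc ?k)"
    using 1 2 adj_dist_le[OF c(1) V(1)] d2 by simp
  \<comment> \<open>Any other side \<open>y g\<close> has a parallel side at \<open>p\<close> too:
    seen from \<open>g\<close>, the vertex \<open>su\<close> lies one step beyond both
    \<open>p\<close> and \<open>c\<close>.\<close>
  have "\<exists>s'. E p s' \<and> E c s' \<and> s' \<in> dirs p g \<and> s' \<notin> dirs p y"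
    if g: "E y g" "E g t" "d p g = Suc ?k" for g
  proof (cases "g = u")
    case True
    then show ?thesis using ps c su by blast
  next
    case False
    have gV: "g \<in> V" using g adj_V by auto
    have "su \<notin> dirs p g" using transfer_dir[of y u g t p su] assms g False by auto
    then have gs: "d g su = Suc (Suc ?k)"
      using dirs_new[of g t p su] g h A p by (simp add: dist_comm)
    have gc: "d g c = Suc ?k"
      using adj_dist_le[OF c(1) gV] adj_dist_le[OF g(2) cV] gs c by (simp add: dist_comm)
    have gp: "d g p = Suc ?k" using g by (simp add: dist_comm)
    obtain s' where s': "E s' p" "E s' c" "d g s' = ?k"
      using quadrangle_cond[of su p c g] ps(1) c(1) adj_sym npc gV gs gc gp by auto
    have "d y s' \<noteq> ?k - 1" if "?k > 0" using adj_dist_le[OF s'(2) V(1)] yc that by auto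
    then have "s' \<notin> dirs p y"
      using adj_dist_le[OF s'(2) V(1)] yc by (auto simp: dirs_def dist_comm)
    moreover have "s' \<in> dirs p g" using s' gp adj_sym by (auto simp: dirs_def dist_comm)
    ultimately show ?thesis using s' adj_sym by blast
  qed
  then show ?thesis using c ne nadj pc by blast
qed

inductive boolean :: "'a \<Rightarrow> 'a \<Rightarrow> bool" for p where
  refl: "p \<in> V \<Longrightarrow> boolean p p"
| step: "boolean p y \<Longrightarrow> E y x \<Longrightarrow> d p x = Suc (d p y) \<Longrightarrow> \<not> dirs p x \<subseteq> dirs p y \<Longrightarrow> boolean p x"

lemma boolean_V: "boolean p x \<Longrightarrow> p \<in> V \<and> x \<in> V"
  by (induction rule: boolean.induct) (auto dest: adj_V)

text \<open>Let \<open>y\<close> precede \<open>g\<close> on the given geodesic and let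
  \<open>c\<close> lie below \<open>y\<close> and \<open>b\<close>. The gain along
  \<open>y g\<close> lifts to a side \<open>c b1\<close>; now the square on \<open>c\<close>,
  \<open>y\<close>, \<open>g\<close>, \<open>b1\<close> has gains along two sides at
  \<open>c\<close>, so \<open>parallel_dirs\<close> yields a gain along \<open>c b\<close>. The gain
  along \<open>c y\<close> is transferred to \<open>b g\<close>.\<close>

lemma boolean_lower:
  assumes "boolean p g" "E b g" "d p g = Suc (d p b)"
  shows "boolean p b \<and> \<not> dirs p g \<subseteq> dirs p b"
  using assms
proof (induction "d p g" arbitrary: g b rule: less_induct)
  case less
  have p: "p \<in> V" using boolean_V less by blast
  from less(2) show ?case
  proof cases
    case refl
    then show ?thesis using less by simp
  next
    case (step y)
    show ?thesis
    proof (cases "y = b")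
      case True
      then show ?thesis using step by simp
    next
      case False
      have hb: "d p b = d p y" using step less by simp
      obtain c where c: "E c y" "E c b" "Suc (d p c) = d p y"
        using quadrangle_cond[of g y b p] step less False p adj_sym hb by auto
      have hy: "d p y = Suc (d p c)" using c by simp
      have lt: "d p y < d p g" "d p b < d p g" using step hb by simp_all
      have IHy: "boolean p c" "\<not> dirs p y \<subseteq> dirs p c"
        using less(1)[OF lt(1) step(1) c(1) hy] by blast+
      then obtain sy where sy: "sy \<in> dirs p y" "sy \<notin> dirs p c" by auto
      obtain s where s: "s \<in> dirs p g" "s \<notin> dirs p y" using step by auto
      obtain b1 where b1: "E c b1" "E b1 g" "b1 \<noteq> y" "d p b1 = Suc (d p c)" "s \<in> dirs p b1" "s \<notin> dirs p c"
        using lift_dir[OF c(1) step(2) p hy step(3) s] by blast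
      have h: "d p b1 = Suc (d p c)" "d p b = Suc (d p c)" "d p g = Suc (Suc (d p c))"
        using b1 hb hy step(3) by simp_all
      have "\<not> dirs p b \<subseteq> dirs p c"
        using parallel_dirs[OF c(1) b1(1) step(2) b1(2) b1(3)[symmetric] p hy h(1,3) sy b1(5,6)] c(2) h(2) less(3)
        by (elim exE conjE) blast
      then have "boolean p b" using boolean.step[OF IHy(1) c(2) h(2)] by simp
      moreover have "\<not> dirs p g \<subseteq> dirs p b"
        using transfer_dir[OF c(1,2) step(2) less(3) False p hy h(2,3) sy] by blast
      ultimately show ?thesis by simp
    qed
  qed
qed

end

section \<open>Gated sets and cones\<close>

context conn_graph begin

text \<open>For adjacent \<open>u\<close> and \<open>v\<close> this is closure under triangles, for
  \<open>u\<close> and \<open>v\<close> at distance 2 it is local convexity. For nonempty connected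
  sets in an swm-graph the two together amount to gatedness.\<close>

definition nbr_closed :: "'a set \<Rightarrow> bool" where
  "nbr_closed X \<longleftrightarrow> (\<forall>u\<in>X. \<forall>v\<in>X. \<forall>t. E u t \<longrightarrow> E t v \<longrightarrow> u \<noteq> v \<longrightarrow> t \<in> X)"

lemma nbr_closedD: "nbr_closed X \<Longrightarrow> u \<in> X \<Longrightarrow> v \<in> X \<Longrightarrow> E u t \<Longrightarrow> E t v \<Longrightarrow> u \<noteq> v \<Longrightarrow> t \<in> X"
  unfolding nbr_closed_def by blast

definition is_gate :: "'a set \<Rightarrow> 'a \<Rightarrow> 'a \<Rightarrow> bool" where
  "is_gate X x g \<longleftrightarrow> g \<in> X \<and> (\<forall>y\<in>X. d x y = d x g + d g y)"

lemma is_gate_in: "is_gate X x g \<Longrightarrow> g \<in> X"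
  by (simp add: is_gate_def)

lemma is_gate_d: "is_gate X x g \<Longrightarrow> y \<in> X \<Longrightarrow> d x y = d x g + d g y"
  unfolding is_gate_def by blast

lemma gated_sub: "gated V E X \<Longrightarrow> X \<subseteq> V"
  unfolding gated_def by blast

lemma gated_iff: "gated V E X \<longleftrightarrow> X \<subseteq> V \<and> (\<forall>x\<in>V. \<exists>g. is_gate X x g)"
proof -
  have "X \<subseteq> V \<Longrightarrow> g \<in> X \<and> (\<forall>y\<in>X. g \<in> interval V E x y) \<longleftrightarrow> is_gate X x g" for x g
    unfolding interval_def is_gate_def mem_Collect_eq by (metis subsetD)
  then show ?thesis unfolding gated_def by blast
qed

lemma gate_ex: "gated V E X \<Longrightarrow> x \<in> V \<Longrightarrow> \<exists>g. is_gate X x g"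
  unfolding gated_iff by blast

lemma gated_nbr_closed:
  assumes "gated V E X"
  shows "nbr_closed X"
  unfolding nbr_closed_def
proof (intro ballI allI impI)
  fix u v t assume a: "u \<in> X" "v \<in> X" "E u t" "E t v" "u \<noteq> v"
  obtain g where g: "is_gate X t g"
    using gate_ex[OF assms] a adj_V by blast
  have V: "g \<in> V" "u \<in> V" "v \<in> V" "t \<in> V" using gated_sub[OF assms] is_gate_in[OF g] a adj_V by auto
  have "d t g + d g u = 1" "d t g + d g v = 1"
    using is_gate_d[OF g a(1)] is_gate_d[OF g a(2)] dist_adj[OF a(4)] dist_adj[OF adj_sym[OF a(3)]] by auto
  moreover have "d g u \<noteq> 0 \<or> d g v \<noteq> 0" using dist_eq_0 V a by metis
  ultimately have "d t g = 0" by linarith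
  then show "t \<in> X" using dist_eq_0 V is_gate_in[OF g] by metis
qed

lemma gated_convex:
  assumes "gated V E X" "u \<in> X" "v \<in> X" "x \<in> V" "d u x + d x v = d u v"
  shows "x \<in> X"
proof -
  obtain g where g: "is_gate X x g"
    using gate_ex[OF assms(1,4)] by blast
  have V: "g \<in> V" "u \<in> V" "v \<in> V" using gated_sub[OF assms(1)] is_gate_in[OF g] assms by auto
  have "d x g = 0"
    using is_gate_d[OF g assms(2)] is_gate_d[OF g assms(3)] dist_triangle[of u g v] V assms(5)
    by (simp add: dist_comm)
  then show ?thesis using dist_eq_0 V is_gate_in[OF g] assms by metis
qed

text \<open>The gate is the gate in \<open>Y\<close> of the gate in \<open>X\<close>: it lies on a
  geodesic from a vertex of \<open>X\<close> to one of \<open>X \<inter> Y\<close>, hence in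
  \<open>X\<close>.\<close>

lemma gated_Int:
  assumes "gated V E X" "gated V E Y" "X \<inter> Y \<noteq> {}"
  shows "gated V E (X \<inter> Y)"
  unfolding gated_iff
proof (intro conjI ballI)
  show "X \<inter> Y \<subseteq> V" using gated_sub assms by auto
  fix x assume x: "x \<in> V"
  obtain g where g: "is_gate X x g" using gate_ex[OF assms(1) x] by blast
  have gV: "g \<in> V" using is_gate_in[OF g] gated_sub assms by auto
  obtain h where h: "is_gate Y g h" using gate_ex[OF assms(2) gV] by blast
  have hV: "h \<in> V" using is_gate_in[OF h] gated_sub assms by auto
  obtain z where z: "z \<in> X" "z \<in> Y" using assms by auto
  have hX: "h \<in> X"
    using gated_convex[OF assms(1) is_gate_in[OF g] z(1) hV] is_gate_d[OF h z(2)] by simp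
  have "d x y = d x h + d h y" if "y \<in> X \<inter> Y" for y
    using is_gate_d[OF g, of y] is_gate_d[OF g hX] is_gate_d[OF h, of y] that by simp
  then have "is_gate (X \<inter> Y) x h" unfolding is_gate_def using hX is_gate_in[OF h] by blast
  then show "\<exists>g. is_gate (X \<inter> Y) x g" by blast
qed

definition conn_in :: "'a set \<Rightarrow> bool" where
  "conn_in X \<longleftrightarrow> (\<forall>u\<in>X. \<forall>v\<in>X. (\<lambda>a b. E a b \<and> b \<in> X)\<^sup>*\<^sup>* u v)"

lemma gated_conn_in:
  assumes "gated V E X"
  shows "conn_in X"
  unfolding conn_in_def
proof (intro ballI)
  fix u v assume "u \<in> X" "v \<in> X"
  then show "(\<lambda>a b. E a b \<and> b \<in> X)\<^sup>*\<^sup>* u v"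
  proof (induction "d u v" arbitrary: v)
    case 0
    then show ?case using dist_eq_0 gated_sub[OF assms] by (metis rtranclp.rtrancl_refl subsetD)
  next
    case (Suc n)
    have V: "u \<in> V" "v \<in> V" using Suc gated_sub[OF assms] by auto
    obtain w where w: "E v w" "d u w = n" using dist_pred[of u v n] V Suc by metis
    have "w \<in> X" using gated_convex[OF assms Suc(3,4), of w] w Suc(2) adj_V adj_sym dist_adj[OF adj_sym[OF w(1)]] by auto
    then have "(\<lambda>a b. E a b \<and> b \<in> X)\<^sup>*\<^sup>* u w" using Suc(1)[of w] w(2) Suc(3) by simp
    then show ?case using Suc(4) adj_sym[OF w(1)] by (simp add: rtranclp.rtrancl_into_rtrancl)
  qed
qed

lemma conn_in_induct:
  assumes "conn_in X" "u \<in> X" "v \<in> X" "P u" "\<And>a b. a \<in> X \<Longrightarrow> b \<in> X \<Longrightarrow> E a b \<Longrightarrow> P a \<Longrightarrow> P b"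
  shows "P v"
proof -
  have "(\<lambda>a b. E a b \<and> b \<in> X)\<^sup>*\<^sup>* u v" using assms by (auto simp: conn_in_def)
  then have "v \<in> X \<and> P v" by (induction rule: rtranclp_induct) (use assms in auto)
  then show ?thesis by simp
qed

end

context swm begin

text \<open>Descending towards \<open>v\<close> inside \<open>X\<close> is locally confluent by the quadrangle condition, and by the
  triangle condition adjacent vertices share their normal form, which is the gate of \<open>v\<close>.\<close>

lemma gated_if_nbr_closed:
  assumes X: "X \<subseteq> V" "X \<noteq> {}" and cl: "nbr_closed X" and con: "conn_in X"
  shows "gated V E X"
  unfolding gated_iff
proof (intro conjI ballI)
  show "X \<subseteq> V" by (rule X(1))
  fix v assume v: "v \<in> V"
  define R where "R = (\<lambda>a b. E a b \<and> b \<in> X \<and> Suc (d v b) = d v a)"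
  define nf where "nf = (\<lambda>y x. R\<^sup>*\<^sup>* y x \<and> (\<nexists>z. R x z))"
  have ex: "\<exists>x. nf y x" for y
  proof (induction "d v y" arbitrary: y rule: less_induct)
    case less
    show ?case
    proof (cases "\<exists>z. R y z")
      case True
      then obtain z where z: "R y z" by blast
      then have "d v z < d v y" by (auto simp: R_def)
      then obtain x where "nf z x" using less by blast
      then show ?thesis using z by (metis nf_def converse_rtranclp_into_rtranclp)
    qed (auto simp: nf_def)
  qed
  have uniq: "x = x'" if "nf y x" "nf y x'" "y \<in> X" for y x x'
    using that
  proof (induction "d v y" arbitrary: y x x' rule: less_induct)
    case less
    show ?case
    proof (cases "\<exists>z. R y z")
      case True
      then have "y \<noteq> x" "y \<noteq> x'" using less by (auto simp: nf_def)
      then obtain a b where ab: "R y a" "R\<^sup>*\<^sup>* a x" "R y b" "R\<^sup>*\<^sup>* b x'"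
        using less by (metis nf_def converse_rtranclpE)
      then have nab: "nf a x" "nf b x'" using less by (auto simp: nf_def)
      have lt: "d v a < d v y" "d v b < d v y" "a \<in> X" "b \<in> X" using ab by (auto simp: R_def)
      show ?thesis
      proof (cases "a = b")
        case True
        then show ?thesis using less lt nab by blast
      next
        case False
        have "d v a = d v b" "d v y = Suc (d v a)" "E y a" "E y b" using ab by (auto simp: R_def)
        then obtain c where c: "E c a" "E c b" "Suc (d v c) = d v a"
          using quadrangle_cond False v by blast
        have "c \<in> X" using nbr_closedD[OF cl lt(3,4) adj_sym[OF c(1)] c(2)] False by simp
        then have "R a c" "R b c" using c \<open>d v a = d v b\<close> adj_sym by (auto simp: R_def)
        moreover obtain z where "nf c z" using ex by blast
        ultimately have "nf a z" "nf b z" by (auto simp: nf_def intro: converse_rtranclp_into_rtranclp)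
        then show ?thesis using less lt nab by blast
      qed
    next
      case False
      then show ?thesis using less by (metis nf_def converse_rtranclpE)
    qed
  qed
  have step: "nf b x" if st: "a \<in> X" "b \<in> X" "E a b" "nf a x" for a b x
  proof -
    have down: "nf y x" if "R y z" "nf z x" for y z x
      using that by (auto simp: nf_def intro: converse_rtranclp_into_rtranclp)
    obtain x' where x': "nf b x'" using ex by blast
    consider "d v a = d v b" | "Suc (d v a) = d v b" | "Suc (d v b) = d v a"
      using adj_dist_le[OF st(3) v] by linarith
    then show ?thesis
    proof cases
      case 1
      then obtain z where z: "E z a" "E z b" "Suc (d v z) = d v a" using triangle_cond st v by blast
      have "z \<in> X" using nbr_closedD[OF cl st(1,2) adj_sym[OF z(1)] z(2)] st adj_irrefl by blast
      then have "R a z" "R b z" using z 1 adj_sym by (auto simp: R_def)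
      moreover obtain w where "nf z w" using ex by blast
      ultimately show ?thesis using down uniq st by metis
    next
      case 2
      then have "R b a" using st adj_sym by (auto simp: R_def)
      then show ?thesis using down st by blast
    next
      case 3
      then have "R a b" using st by (auto simp: R_def)
      then show ?thesis using down st uniq x' by metis
    qed
  qed
  obtain y0 where y0: "y0 \<in> X" using X by blast
  obtain g where g: "nf y0 g" using ex by blast
  have all: "nf y g" if "y \<in> X" for y
    using conn_in_induct[OF con y0 that, of "\<lambda>y. nf y g"] step g by blast
  have "y \<in> X \<longrightarrow> g \<in> X \<and> d v y = d v g + d g y" if "R\<^sup>*\<^sup>* y g" for y
    using that
  proof (induction rule: converse_rtranclp_induct)
    case base
    then show ?case using X by auto
  next
    case (step y z)
    show ?case
    proof
      assume y: "y \<in> X"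
      have zz: "E y z" "z \<in> X" "Suc (d v z) = d v y" using step by (auto simp: R_def)
      then have g: "g \<in> X" "d v z = d v g + d g z" using step by auto
      have "d g y \<le> Suc (d g z)" using adj_dist_le[OF zz(1)] g X by auto
      moreover have "d v y \<le> d v g + d g y" using dist_triangle[of v g y] v y g X by auto
      ultimately show "g \<in> X \<and> d v y = d v g + d g y" using g zz by linarith
    qed
  qed
  then have "is_gate X v g"
    using all y0 unfolding is_gate_def nf_def by blast
  then show "\<exists>g. is_gate X v g" by blast
qed

text \<open>A union of lines (maximal cliques) through \<open>p\<close> that contains every line at \<open>p\<close> of a quadrangle
  in which it has two lines.\<close>

definition flat :: "'a \<Rightarrow> 'a set \<Rightarrow> bool" where
  "flat p S \<longleftrightarrow> p \<in> V \<and> (\<forall>s\<in>S. E p s) \<and>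
     (\<forall>s\<in>S. \<forall>s'. E p s' \<longrightarrow> E s s' \<longrightarrow> s' \<in> S) \<and>
     (\<forall>s\<in>S. \<forall>s'\<in>S. \<forall>t r. s \<noteq> s' \<longrightarrow> \<not> E s s' \<longrightarrow> E t s \<longrightarrow> E t s' \<longrightarrow> d p t = 2 \<longrightarrow>
        E p r \<longrightarrow> E t r \<longrightarrow> r \<in> S)"

lemma flat_line: "flat p S \<Longrightarrow> s \<in> S \<Longrightarrow> E p s' \<Longrightarrow> E s s' \<Longrightarrow> s' \<in> S"
  unfolding flat_def by blast

lemma flat_quad:
  "flat p S \<Longrightarrow> s \<in> S \<Longrightarrow> s' \<in> S \<Longrightarrow> s \<noteq> s' \<Longrightarrow> \<not> E s s' \<Longrightarrow> E t s \<Longrightarrow> E t s' \<Longrightarrow>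
    d p t = 2 \<Longrightarrow> E p r \<Longrightarrow> E t r \<Longrightarrow> r \<in> S"
  unfolding flat_def by blast

section \<open>Cones over flat sets of directions\<close>

definition cone :: "'a \<Rightarrow> 'a set \<Rightarrow> 'a set" where
  "cone p S = {x. boolean p x \<and> dirs p x \<subseteq> S}"

lemma cone_mono: "S \<subseteq> T \<Longrightarrow> cone p S \<subseteq> cone p T"
  by (auto simp: cone_def)

lemma cone_V: "cone p S \<subseteq> V"
  by (auto simp: cone_def dest: boolean_V)

lemma dirs_self: "p \<in> V \<Longrightarrow> dirs p p = {}"
  by (auto simp: dirs_def)

lemma dirs_adj: "E p x \<Longrightarrow> dirs p x = {x}"
proof -
  assume a: "E p x"
  have "s \<in> dirs p x \<longleftrightarrow> s = x" for s
    using a dist_adj[OF a] adj_V[of p s] adj_V(2)[OF a] dist_eq_0[of s x] by (auto simp: dirs_def)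
  then show ?thesis by blast
qed

lemma boolean_adj: "E p x \<Longrightarrow> boolean p x"
proof -
  assume a: "E p x"
  have "\<not> dirs p x \<subseteq> dirs p p" using dirs_adj[OF a] dirs_self[OF adj_V(1)[OF a]] by simp
  then show ?thesis using boolean.step[OF boolean.refl a] dist_adj[OF a] adj_V(1)[OF a] by simp
qed

lemma cone_base: "p \<in> V \<Longrightarrow> p \<in> cone p S"
  by (simp add: cone_def dirs_self boolean.refl)

lemma cone_nbrs: "E p s \<Longrightarrow> s \<in> cone p S \<longleftrightarrow> s \<in> S"
  unfolding cone_def using boolean_adj[of p s] dirs_adj[of p s] by simp

lemma cone_lower: "x \<in> cone p S \<Longrightarrow> E y x \<Longrightarrow> d p x = Suc (d p y) \<Longrightarrow> y \<in> cone p S"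
proof -
  assume a: "x \<in> cone p S" "E y x" "d p x = Suc (d p y)"
  then have x: "boolean p x" "dirs p x \<subseteq> S" by (auto simp: cone_def)
  then show ?thesis
    using boolean_lower[OF x(1) a(2,3)] dirs_mono[OF a(2) _ a(3)] boolean_V[OF x(1)] by (simp add: cone_def subset_trans)
qed

text \<open>Directions gained along two edges \<open>y u\<close> and \<open>y t\<close> of one line
  at \<open>y\<close> lie on common lines at \<open>p\<close>: by \<open>triangle_third\<close> the
  direction gained along one edge is as far from the end of the other edge as \<open>p\<close> is,
  and the triangle condition finds on its line a direction towards that end.\<close>

lemma cone_line:
  assumes S: "flat p S" and u: "u \<in> cone p S" and E: "E y u" "E y t" "E u t"
    and h: "d p u = Suc (d p y)" "d p t = Suc (d p y)"
  shows "t \<in> cone p S"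
proof -
  have p: "p \<in> V" using S by (simp add: flat_def)
  have V: "y \<in> V" "u \<in> V" "t \<in> V" using E adj_V by auto
  have bu: "boolean p u" "dirs p u \<subseteq> S" using u by (auto simp: cone_def)
  have "dirs p t \<subseteq> S"
  proof
    fix s assume s: "s \<in> dirs p t"
    show "s \<in> S"
    proof (cases "s \<in> dirs p y")
      case True
      then show ?thesis using dirs_mono[OF E(1) p h(1)] bu by blast
    next
      case False
      have ps: "E p s" "d s t = d p y" using s h by (auto simp: dirs_def)
      have sV: "s \<in> V" using ps adj_V by auto
      have sy: "d s y = Suc (d p y)" using dirs_new[OF E(2) p h(2) s False] .
      have "d s u \<noteq> d s t" using triangle_third[of u t y s] E adj_sym sV sy ps by auto
      then have su: "d s u = Suc (d p y)"
        using adj_dist_le[OF ps(1) V(2)] adj_dist_le[OF E(3) sV] ps h by (simp add: dist_comm)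
      then obtain z where z: "E z p" "E z s" "Suc (d u z) = d u p"
        using triangle_cond[OF ps(1) V(2)] h by (auto simp: dist_comm)
      then have "z \<in> dirs p u" using adj_sym by (auto simp: dirs_def dist_comm)
      then show ?thesis using flat_line[OF S _ ps(1) z(2)] bu by blast
    qed
  qed
  moreover have "boolean p t"
  proof -
    have y: "boolean p y" "\<not> dirs p u \<subseteq> dirs p y" using boolean_lower[OF bu(1) E(1) h(1)] by auto
    then obtain s where s: "s \<in> dirs p u" "s \<notin> dirs p y" by blast
    have ps: "E p s" "d s u = d p y" using s h by (auto simp: dirs_def)
    have sV: "s \<in> V" using ps adj_V by auto
    have sy: "d s y = Suc (d p y)" using dirs_new[OF E(1) p h(1) s] .
    have "d s t \<noteq> d s u" using triangle_third[of t u y s] E adj_sym sV sy ps by auto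
    then have st: "d s t = Suc (d p y)"
      using adj_dist_le[OF ps(1) V(3)] adj_dist_le[OF E(3) sV] ps h by (simp add: dist_comm)
    then obtain z where z: "E z p" "E z s" "Suc (d t z) = d t p"
      using triangle_cond[OF ps(1) V(3)] h by (auto simp: dist_comm)
    then have zt: "z \<in> dirs p t" using adj_sym by (auto simp: dirs_def dist_comm)
    have "z \<notin> dirs p y"
    proof
      assume "z \<in> dirs p y"
      then have "Suc (d y z) = d p y" by (auto simp: dirs_def dist_comm)
      then show False using adj_dist_le[OF z(2) V(1)] sy by (simp add: dist_comm)
    qed
    then show ?thesis using boolean.step[OF y(1) E(2) h(2)] zt by blast
  qed
  ultimately show ?thesis by (simp add: cone_def)
qed

lemma cone_square:
  assumes S: "flat p S" and uv: "u \<in> cone p S" "v \<in> cone p S" "u \<noteq> v" and E: "E u t" "E v t"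
    and h: "d p t = Suc (d p u)" "d p v = d p u"
  shows "t \<in> cone p S"
proof -
  have p: "p \<in> V" using S by (simp add: flat_def)
  obtain y where y: "E y u" "E y v" "Suc (d p y) = d p u"
    using quadrangle_cond[OF adj_sym[OF E(1)] adj_sym[OF E(2)] uv(3) p] h by auto
  have h': "d p u = Suc (d p y)" "d p v = Suc (d p y)" "d p t = Suc (Suc (d p y))" "d p t = Suc (d p v)"
    using y h by simp_all
  have V: "y \<in> V" "u \<in> V" "v \<in> V" "t \<in> V" using E y adj_V by auto
  have b: "boolean p u" "boolean p v" "dirs p u \<subseteq> S" "dirs p v \<subseteq> S" using uv by (auto simp: cone_def)
  obtain su where su: "su \<in> dirs p u" "su \<notin> dirs p y" using boolean_lower[OF b(1) y(1) h'(1)] by blast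
  obtain sv where sv: "sv \<in> dirs p v" "sv \<notin> dirs p y" using boolean_lower[OF b(2) y(2) h'(2)] by blast
  have "sv \<in> dirs p t" "sv \<notin> dirs p u"
    using transfer_dir[OF y(2,1) E(2,1) uv(3)[symmetric] p h'(2,1,3) sv] by auto
  then have bt: "boolean p t" using boolean.step[OF b(1) E(1) h(1)] by blast
  have "dirs p t \<subseteq> S"
  proof
    fix s assume s: "s \<in> dirs p t"
    show "s \<in> S"
    proof (cases "s \<in> dirs p u")
      case True
      then show ?thesis using b by blast
    next
      case False
      obtain g where g: "E y g" "E g t" "d p g = Suc (d p y)" "s \<in> dirs p g" "s \<notin> dirs p y"
        using lift_dir[OF y(1) E(1) p h'(1) h(1) s False] by blast
      have gV: "g \<in> V" using g adj_V by auto
      obtain c where c: "E c su" "E c sv" "su \<noteq> sv" "\<not> E su sv" "d p c = 2"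
        and cc: "\<forall>g. E y g \<longrightarrow> E g t \<longrightarrow> d p g = Suc (d p y) \<longrightarrow>
           (\<exists>s'. E p s' \<and> E c s' \<and> s' \<in> dirs p g \<and> s' \<notin> dirs p y)"
        using parallel_dirs[OF y(1,2) E uv(3) p h'(1,2,3) su sv] by (elim exE conjE) metis
      \<comment> \<open>\<open>s'\<close> is the direction parallel to \<open>y g\<close>; it
        belongs to the quadrangle of \<open>p\<close> and \<open>c\<close> that already has
        \<open>su\<close> and \<open>sv\<close> in \<open>S\<close>.\<close>
      obtain s' where s': "E p s'" "E c s'" "s' \<in> dirs p g" "s' \<notin> dirs p y" using cc g by blast
      have s'S: "s' \<in> S" using flat_quad[OF S _ _ c(3,4,1,2,5) s'(1,2)] su sv b by blast
      show ?thesis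
      proof (cases "s' = s")
        case True
        then show ?thesis using s'S by simp
      next
        case False
        have ps: "E p s" "Suc (d g s) = d g p" "Suc (d g s') = d g p"
          using g(4) s'(3) by (auto simp: dirs_def dist_comm)
        have sV: "s \<in> V" using ps adj_V by auto
        obtain e where e: "E e s" "E e s'" "Suc (d g e) = d g s"
          using quadrangle_cond[OF ps(1) s'(1) False[symmetric] gV] ps by auto
        have eV: "e \<in> V" using e adj_V by auto
        have ge: "Suc (Suc (d g e)) = Suc (d p y)" using e ps g(3) by (simp add: dist_comm)
        have sy: "d y s = Suc (d p y)" "d y s' = Suc (d p y)"
          using dirs_new[OF g(1) p g(3) g(4,5)] dirs_new[OF g(1) p g(3) s'(3,4)] by (simp_all add: dist_comm)
        have ye: "d y e = d p y" using adj_dist_le[OF g(1) eV] adj_dist_le[OF e(1) V(1)] ge sy by (simp add: dist_comm)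
        have pe: "d p e = 2"
        proof (rule dist_2I[OF ps(1) adj_sym[OF e(1)]])
          show "p \<noteq> e" using e ps by (metis n_not_Suc_n Suc_n_not_le_n nat_le_linear le_SucI)
          show "\<not> E p e" using adj_dist_le[of p e g] gV e ps by auto
        qed
        then have npe: "p \<noteq> e" using p by auto
        \<comment> \<open>If \<open>s\<close> and \<open>s'\<close> differ, both are gained along
          \<open>y g\<close>. Their common neighbour \<open>e\<close> is joined to \<open>p\<close>
          also through a direction \<open>f\<close> towards \<open>y\<close>, so \<open>s\<close>
          lies in a quadrangle with \<open>f\<close> and \<open>s'\<close> in
          \<open>S\<close>.\<close>
        obtain f where f: "E f p" "E f e" "Suc (d y f) = d y p"
          using quadrangle_cond[OF adj_sym[OF ps(1)] adj_sym[OF e(1)] npe V(1)] ye sy by (auto simp: dist_comm)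
        have "f \<in> dirs p y" using f adj_sym by (auto simp: dirs_def dist_comm)
        then have fS: "f \<in> S" using dirs_mono[OF y(1) p h'(1)] b by blast
        have fs': "f \<noteq> s'" "\<not> E f s'"
          using adj_dist_le[of f s' y] f sy V by (auto simp: dist_comm)
        show ?thesis
          using flat_quad[OF S fS s'S fs' adj_sym[OF f(2)] e(2) pe ps(1) e(1)] .
      qed
    qed
  qed
  then show ?thesis using bt by (simp add: cone_def)
qed

lemma cone_nbr_closed:
  assumes S: "flat p S"
  shows "nbr_closed (cone p S)"
  unfolding nbr_closed_def
proof (intro ballI allI impI)
  fix u v t assume a: "u \<in> cone p S" "v \<in> cone p S" "E u t" "E t v" "u \<noteq> v"
  have p: "p \<in> V" using S by (simp add: flat_def)
  have lower: "t \<in> cone p S" if lw: "w \<in> cone p S" "E t w" "d p t \<le> d p w" for w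
  proof (cases "d p t = d p w")
    case True
    obtain z where z: "E z t" "E z w" "Suc (d p z) = d p t" using triangle_cond[OF lw(2) p True] by blast
    then show ?thesis using cone_line[OF S lw(1) z(2,1) adj_sym[OF lw(2)]] True by simp
  next
    case False
    then have "d p w = Suc (d p t)" using adj_dist_le[OF lw(2) p] lw by simp
    then show ?thesis using cone_lower lw by blast
  qed
  consider "d p t \<le> d p u" | "d p t \<le> d p v" | "d p t = Suc (d p u)" "d p v = d p u"
    using adj_dist_le[OF a(3) p] adj_dist_le[OF a(4) p] by linarith
  then show "t \<in> cone p S"
    using lower a adj_sym cone_square[OF S a(1,2,5,3) adj_sym[OF a(4)]] by cases blast+
qed

lemma cone_conn:
  assumes "p \<in> V" "x \<in> cone p S"
  shows "(\<lambda>a b. E a b \<and> b \<in> cone p S)\<^sup>*\<^sup>* p x \<and> (\<lambda>a b. E a b \<and> b \<in> cone p S)\<^sup>*\<^sup>* x p"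
  using assms(2)
proof (induction "d p x" arbitrary: x)
  case 0
  then have "p = x" using dist_eq_0 assms cone_V by (metis subsetD)
  then show ?case by simp
next
  case (Suc n)
  have xV: "x \<in> V" using Suc(3) cone_V by blast
  obtain y where y: "E x y" "d p y = n" using dist_pred[OF assms(1) xV] Suc(2) by metis
  have yX: "y \<in> cone p S" using cone_lower[OF Suc(3) adj_sym[OF y(1)]] y Suc(2) by simp
  then have IH: "(\<lambda>a b. E a b \<and> b \<in> cone p S)\<^sup>*\<^sup>* p y" "(\<lambda>a b. E a b \<and> b \<in> cone p S)\<^sup>*\<^sup>* y p"
    using Suc(1)[of y] y by auto
  show ?case
    using rtranclp.rtrancl_into_rtrancl[OF IH(1)] converse_rtranclp_into_rtranclp[OF _ IH(2)]
      Suc(3) y(1) yX adj_sym by auto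
qed

lemma cone_gated:
  assumes "flat p S"
  shows "gated V E (cone p S)"
proof (rule gated_if_nbr_closed)
  have p: "p \<in> V" using assms by (simp add: flat_def)
  show "cone p S \<noteq> {}" using cone_base p by blast
  show "conn_in (cone p S)" unfolding conn_in_def
    by (intro ballI rtranclp_trans[OF conjunct2[OF cone_conn[OF p]] conjunct1[OF cone_conn[OF p]]])
qed (use assms cone_V cone_nbr_closed in auto)

end

section \<open>Thickness and Boolean hulls\<close>

context swm begin

text \<open>For nonadjacent neighbours \<open>a\<close>, \<open>b\<close> of \<open>q\<close> the
  vertex \<open>r\<close> is not adjacent to \<open>q\<close> by \<open>no_K4_minus\<close>, so the
  path \<open>a\<close>, \<open>q\<close>, \<open>b\<close> is completed to an induced
  4-cycle.\<close>

definition square :: "'a \<Rightarrow> 'a \<Rightarrow> 'a \<Rightarrow> bool" where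
  "square q a b \<longleftrightarrow> (\<exists>r. r \<noteq> q \<and> E r a \<and> E r b)"

lemma square_commute: "square q a b \<Longrightarrow> square q b a"
  by (auto simp: square_def)

text \<open>Unless \<open>x\<close> is adjacent to \<open>r\<close>, the ends of the edge
  \<open>r b\<close> are equidistant from \<open>x\<close>, and the triangle condition yields the
  new fourth vertex. Lying in a square thus depends only on the two lines through
  \<open>q\<close>.\<close>

lemma square_line:
  assumes E: "E q a" "E q b" "a \<noteq> b" "\<not> E a b" and sq: "square q a b"
    and x: "E q x" "E x a" "x \<noteq> b" "\<not> E x b"
  shows "square q x b"
proof -
  obtain r where r: "r \<noteq> q" "E r a" "E r b" using sq by (auto simp: square_def)
  have nqr: "\<not> E q r" using no_K4_minus[of q r a b] E r by blast
  have V: "x \<in> V" using x adj_V by auto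
  show ?thesis
  proof (cases "E x r")
    case True
    then show ?thesis using r adj_sym unfolding square_def by blast
  next
    case False
    have "x \<noteq> r" using r x by auto
    then have "d x r = 2" "d x b = 2"
      using dist_2I[OF x(2) adj_sym[OF r(2)]] dist_2I[OF adj_sym[OF x(1)] E(2)] x False by auto
    then obtain z where z: "E z r" "E z b" "Suc (d x z) = 2"
      using triangle_cond[OF r(3) V] by auto
    have zV: "z \<in> V" using z adj_V by auto
    have "E x z" using z dist_eq_1[OF V zV] by auto
    moreover have "z \<noteq> q" using nqr z by auto
    ultimately show ?thesis using z adj_sym unfolding square_def by blast
  qed
qed

definition thick_at :: "'a set \<Rightarrow> 'a \<Rightarrow> bool" where
  "thick_at X q \<longleftrightarrow>
     (\<forall>a\<in>X. \<forall>b\<in>X. E q a \<longrightarrow> E q b \<longrightarrow> a \<noteq> b \<longrightarrow> \<not> E a b \<longrightarrow> square q a b)"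

lemma thick_atD:
  "thick_at X q \<Longrightarrow> a \<in> X \<Longrightarrow> b \<in> X \<Longrightarrow> E q a \<Longrightarrow> E q b \<Longrightarrow> a \<noteq> b \<Longrightarrow> \<not> E a b \<Longrightarrow> square q a b"
  unfolding thick_at_def by blast

text \<open>If the two given squares do not already meet, \<open>p1\<close>, \<open>x\<close>, \<open>x'\<close> together with \<open>p\<close>, \<open>s\<close>, \<open>s'\<close>, \<open>c\<close> are
  seven vertices of a cube, and the eighth one gives the missing square.\<close>

lemma thick_at_step_far:
  assumes cl: "nbr_closed X" and X: "p \<in> X" "x \<in> X" "x' \<in> X" and th: "thick_at X p"
    and E: "E p p1" "E p1 x" "E p1 x'" "x \<noteq> x'" "\<not> E x x'"
    and px: "p \<noteq> x" "\<not> E p x" "p \<noteq> x'" "\<not> E p x'"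
    and sq: "square p1 p x" "square p1 p x'"
  shows "square p1 x x'"
proof -
  obtain s where s: "s \<noteq> p1" "E s p" "E s x" using sq by (auto simp: square_def)
  obtain s' where s': "s' \<noteq> p1" "E s' p" "E s' x'" using sq by (auto simp: square_def)
  have sX: "s \<in> X" "s' \<in> X"
    using nbr_closedD[OF cl X(1,2) adj_sym[OF s(2)] s(3)] nbr_closedD[OF cl X(1,3) adj_sym[OF s'(2)] s'(3)] px
    by auto
  have V: "p \<in> V" "p1 \<in> V" "x \<in> V" "x' \<in> V" "s \<in> V" "s' \<in> V" using E s s' adj_V by auto
  have ns: "\<not> E s p1" "\<not> E s' p1"
    using no_K4_minus[of s p1 p x] no_K4_minus[of s' p1 p x'] s s' E px adj_sym by blast+
  have near: "square p1 a b" if ab: "E p1 a" "E p1 b" "a \<noteq> b" "\<not> E a b"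
    "E r b" "\<not> E r p1" "r \<noteq> p1" "d a r \<le> 2" for a b r
  proof (cases "E a r \<or> a = r")
    case True
    then show ?thesis using ab adj_sym unfolding square_def by blast
  next
    case False
    have rV: "r \<in> V" "a \<in> V" using ab adj_V by auto
    have "d a r \<noteq> 0" "d a r \<noteq> Suc 0" using False rV dist_eq_0 dist_eq_1 by auto
    then have "d a r = 2" using ab by linarith
    moreover have "d a b = 2" using dist_2I[OF adj_sym[OF ab(1)] ab(2)] ab by simp
    ultimately obtain z where z: "E z r" "E z b" "Suc (d a z) = 2"
      using triangle_cond[OF ab(5) rV(2)] by auto
    have zV: "z \<in> V" using z adj_V by auto
    have "E a z" using z dist_eq_1[OF rV(2) zV] by auto
    moreover have "z \<noteq> p1" using z ab adj_sym by blast
    ultimately show ?thesis using z adj_sym unfolding square_def by blast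
  qed
  show ?thesis
  proof (cases "d x s' \<le> 2 \<or> d x' s \<le> 2")
    case True
    then show ?thesis
      using near[OF E(2,3,4,5) s'(3) ns(2) s'(1)] near[of x' x s] E s ns adj_sym square_commute by metis
  next
    case False
    have d3: "d x s' \<ge> 3" "d x' s \<ge> 3" using False by auto
    have le: "d x p1 = 1" "d s' p1 \<le> 2" "d s p1 \<le> 2" "d s' p = 1" "d s p = 1" "d s x = 1" "d s' x' = 1"
      "d x' p1 = 1"
      using dist_adj E s s' adj_sym adj_dist_le[OF E(1) V(5)] adj_dist_le[OF E(1) V(6)] dist_adj[OF s(2)] dist_adj[OF s'(2)] by auto
    have sne: "s \<noteq> s'" using le d3 by (auto simp: dist_comm)
    have nss: "\<not> E s s'" using adj_dist_le[of s s' x] V d3 le by (auto simp: dist_comm)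
    obtain c where c: "c \<noteq> p" "E c s" "E c s'"
      using thick_atD[OF th sX adj_sym[OF s(2)] adj_sym[OF s'(2)] sne nss] by (auto simp: square_def)
    have cV: "c \<in> V" using c adj_V by auto
    have xc: "d x c = 2" "d x' c = 2"
      using adj_dist_le[OF c(2) V(3)] adj_dist_le[OF c(3) V(3)] adj_dist_le[OF c(2) V(4)] adj_dist_le[OF c(3) V(4)] d3 le
      by (auto simp: dist_comm)
    have s'p1: "d s' p1 = 2" "d s' x = 3"
      using adj_dist_le[OF E(2) V(6)] d3 le by (auto simp: dist_comm)
    have s's: "d s' s = 2"
      using adj_dist_le[OF s(3) V(6)] adj_dist_le[OF s(2) V(6)] d3 le by (auto simp: dist_comm)
    have n1: "\<not> E p1 c"
    proof
      assume "E p1 c"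
      then have "p = c"
        using quadrangle_unique[OF adj_sym[OF E(2)] adj_sym[OF s(3)] s(1)[symmetric] V(6) _ _ E(1) adj_sym[OF s(2)] _ adj_sym c(2)]
          s'p1 s's le dist_adj[OF adj_sym[OF c(3)]] by auto
      then show False using c by simp
    qed
    have n2: "d c p1 \<noteq> 2"
    proof
      assume cp: "d c p1 = 2"
      then obtain z where z: "E z x" "E z p1" "Suc (d c z) = 2"
        using triangle_cond[OF adj_sym[OF E(2)] cV] xc by (auto simp: dist_comm)
      have zV: "z \<in> V" using z adj_V by auto
      have "d s' z \<le> 2" using adj_dist_le[OF c(3) zV] z by (auto simp: dist_comm)
      moreover have "d s' z \<ge> 2" using adj_dist_le[OF z(1) V(6)] s'p1 by simp
      ultimately have "d s' x \<le> d s' p1"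
        using triangle_third[OF z(2) E(2) z(1) V(6)] s'p1 by simp
      then show False using s'p1 by simp
    qed
    have "d c p1 \<noteq> 0" using dist_eq_0[OF cV V(2)] adj_sym[OF c(2)] adj_sym ns by auto
    moreover have "d c p1 \<noteq> Suc 0" using dist_eq_1[OF cV V(2)] n1 adj_sym by blast
    moreover have "d c p1 \<le> 3" using adj_dist_le[OF E(2) cV] xc by (simp add: dist_comm)
    ultimately have "d c p1 = 3" using n2 by linarith
    then obtain t where t: "E t x" "E t x'" "Suc (d c t) = 2"
      using quadrangle_cond[OF E(2,3,4) cV] xc by (auto simp: dist_comm)
    have "t \<noteq> p1" using t \<open>d c p1 = 3\<close> by auto
    then show ?thesis using t unfolding square_def by blast
  qed
qed

text \<open>A path with an end on the line of \<open>p\<close> and \<open>p1\<close> reduces to a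
  path from \<open>p\<close> by sliding that end, the others need the cube. This leaves only squares
  along the edge \<open>p p1\<close> to be produced in \<open>cone_thick\<close>.\<close>

lemma thick_at_step:
  assumes cl: "nbr_closed X" and X: "p \<in> X" "p1 \<in> X" and E: "E p p1" and th: "thick_at X p"
    and star: "\<And>x. x \<in> X \<Longrightarrow> E p1 x \<Longrightarrow> p \<noteq> x \<Longrightarrow> \<not> E p x \<Longrightarrow> square p1 p x"
  shows "thick_at X p1"
  unfolding thick_at_def
proof (intro ballI impI)
  fix x x' assume a: "x \<in> X" "x' \<in> X" "E p1 x" "E p1 x'" "x \<noteq> x'" "\<not> E x x'"
  have on_line: "square p1 x x'" if b: "x \<in> X" "x' \<in> X" "E p1 x" "E p1 x'" "x \<noteq> x'" "\<not> E x x'" "E p x"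
    for x x'
  proof -
    have n: "p \<noteq> x'" "\<not> E p x'" using b no_K4_minus[of p p1 x x'] E adj_sym by blast+
    then show ?thesis
      using square_line[of p1 p x' x] star[OF b(2) b(4) n] b E adj_sym by blast
  qed
  consider "p = x" | "p = x'" | "E p x" | "E p x'" | "p \<noteq> x" "\<not> E p x" "p \<noteq> x'" "\<not> E p x'"
    by blast
  then show "square p1 x x'"
  proof cases
    case 1
    then show ?thesis using star[of x'] a by blast
  next
    case 2
    then have "square p1 x' x" using star[of x] a adj_sym by blast
    then show ?thesis by (rule square_commute)
  next
    case 3
    then show ?thesis using on_line[of x x'] a by blast
  next
    case 4
    then have "square p1 x' x" using on_line[of x' x] a adj_sym by blast
    then show ?thesis by (rule square_commute)
  next
    case 5
    show ?thesis
      by (rule thick_at_step_far[OF cl X(1) a(1,2) th E a(3,4,5,6) 5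
            star[OF a(1,3) 5(1,2)] star[OF a(2,4) 5(3,4)]])
  qed
qed

text \<open>By \<open>thick_at_step\<close> only squares along the edge from \<open>q\<close> to its
  predecessor \<open>w\<close> are missing. For \<open>x\<close> above \<open>q\<close> the square
  comes from \<open>lift_dir\<close>, for \<open>x\<close> below from the quadrangle condition; on
  the same level it is slid along the line of \<open>q\<close> and \<open>x\<close> from a vertex
  below \<open>q\<close>.\<close>

lemma cone_thick:
  assumes S: "flat p S" and sq: "\<And>a b. a \<in> S \<Longrightarrow> b \<in> S \<Longrightarrow> a \<noteq> b \<Longrightarrow> \<not> E a b \<Longrightarrow> square p a b"
    and q: "q \<in> cone p S"
  shows "thick_at (cone p S) q"
  using q
proof (induction "d p q" arbitrary: q)
  case 0
  have "p \<in> V" "q \<in> V" using 0 S cone_V[of p S] by (auto simp: flat_def)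
  then have "p = q" using 0 dist_eq_0[of p q] by simp
  moreover have "thick_at (cone p S) p" unfolding thick_at_def using sq cone_nbrs by blast
  ultimately show ?case by simp
next
  case (Suc n)
  let ?X = "cone p S"
  have p: "p \<in> V" using S by (simp add: flat_def)
  have qV: "q \<in> V" using Suc cone_V by blast
  obtain w where w: "E q w" "d p w = n" using dist_pred[OF p qV] Suc(2) by metis
  have h: "d p q = Suc (d p w)" using w Suc(2) by simp
  have wX: "w \<in> ?X" using cone_lower[OF Suc(3) adj_sym[OF w(1)] h] .
  have wV: "w \<in> V" using w adj_V by auto
  have th: "thick_at ?X w" using Suc(1)[OF _ wX] w by simp
  show ?case
  proof (rule thick_at_step[OF cone_nbr_closed[OF S] wX Suc(3) adj_sym[OF w(1)] th])
    fix x assume x: "x \<in> ?X" "E q x" "w \<noteq> x" "\<not> E w x"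
    have xV: "x \<in> V" using adj_V(2)[OF x(2)] .
    consider "d p x = Suc (d p q)" | "d p q = d p x" | "Suc (d p x) = d p q"
      using adj_dist_le[OF x(2) p] by linarith
    then show "square q w x"
    proof cases
      case 1
      obtain s where s: "s \<in> dirs p x" "s \<notin> dirs p q"
        using boolean_lower[of p x q] x 1 by (auto simp: cone_def)
      obtain g where "E w g" "E g x" "g \<noteq> q" using lift_dir[OF adj_sym[OF w(1)] x(2) p h 1 s] by blast
      then show ?thesis using adj_sym unfolding square_def by blast
    next
      case 2
      then obtain e where e: "E e q" "E e x" "Suc (d p e) = d p q" using triangle_cond[OF x(2) p] by blast
      have ne: "w \<noteq> e" "\<not> E w e"
        using e x(4) quadrangle_nonadj[OF w(1) adj_sym[OF e(1)] p] h by auto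
      obtain c where c: "E c w" "E c e" "Suc (d p c) = d p w"
        using quadrangle_cond[OF w(1) adj_sym[OF e(1)] ne(1) p] h e by auto
      have "square q e w" using c h adj_sym unfolding square_def by (intro exI[of _ c]) auto
      then have "square q x w"
        using square_line[OF adj_sym[OF e(1)] w(1) _ _ _ x(2) adj_sym[OF e(2)]] ne x adj_sym by blast
      then show ?thesis by (rule square_commute)
    next
      case 3
      then obtain c where "E c w" "E c x" "Suc (d p c) = d p w"
        using quadrangle_cond[OF w(1) x(2,3) p] h by auto
      then show ?thesis using h unfolding square_def by (intro exI[of _ c]) auto
    qed
  qed
qed

section \<open>Thick gated sets\<close>

definition thick_gated :: "'a set \<Rightarrow> bool" where
  "thick_gated X \<longleftrightarrow> gated V E X \<and> X \<noteq> {} \<and> (\<forall>q\<in>X. thick_at X q)"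

lemma thick_gatedD:
  assumes "thick_gated X"
  shows "gated V E X" "X \<noteq> {}" "X \<subseteq> V" "nbr_closed X" "conn_in X"
  using assms gated_sub gated_nbr_closed gated_conn_in by (auto simp: thick_gated_def)

lemma thick_gated_square:
  "thick_gated X \<Longrightarrow> q \<in> X \<Longrightarrow> a \<in> X \<Longrightarrow> b \<in> X \<Longrightarrow> E q a \<Longrightarrow> E q b \<Longrightarrow> a \<noteq> b \<Longrightarrow> \<not> E a b \<Longrightarrow>
    \<exists>r\<in>X. r \<noteq> q \<and> E r a \<and> E r b"
proof -
  assume a: "thick_gated X" "q \<in> X" "a \<in> X" "b \<in> X" "E q a" "E q b" "a \<noteq> b" "\<not> E a b"
  then have "thick_at X q" by (auto simp: thick_gated_def)
  then obtain r where r: "r \<noteq> q" "E r a" "E r b"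
    using thick_atD[OF _ a(3-8)] unfolding square_def by blast
  have "r \<in> X" using nbr_closedD[OF thick_gatedD(4)[OF a(1)] a(3,4) adj_sym[OF r(2)] r(3) a(7)] .
  then show ?thesis using r(1,2,3) by blast
qed

lemma cone_thick_gated:
  assumes "flat p S" "\<And>a b. a \<in> S \<Longrightarrow> b \<in> S \<Longrightarrow> a \<noteq> b \<Longrightarrow> \<not> E a b \<Longrightarrow> square p a b"
  shows "thick_gated (cone p S)"
  using cone_gated[OF assms(1)] cone_thick[OF assms] cone_base[of p S] assms(1)
  unfolding thick_gated_def flat_def by blast

lemma thick_gated_subset:
  assumes "thick_gated Y" "gated V E X" "X \<noteq> {}" "X \<subseteq> Y"
  shows "thick_gated X"
  using assms unfolding thick_gated_def thick_at_def by blast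

lemma gated_dirs:
  assumes X: "gated V E X" "p \<in> X" "x \<in> X"
  shows "dirs p x \<subseteq> {s \<in> X. E p s}"
proof
  fix s assume "s \<in> dirs p x"
  then have s: "E p s" "Suc (d s x) = d p x" by (auto simp: dirs_def)
  then show "s \<in> {s \<in> X. E p s}"
    using gated_convex[OF X, of s] adj_V(2)[OF s(1)] dist_adj[OF s(1)] by simp
qed

text \<open>The last two steps \<open>c\<close>, \<open>y\<close>, \<open>x\<close> of a geodesic
  lie in a square of \<open>X\<close>; the gain along its side \<open>c r\<close> reappears along
  \<open>y x\<close> by \<open>transfer_dir\<close>.\<close>

lemma thick_gated_boolean:
  assumes X: "thick_gated X" "p \<in> X" "x \<in> X"
  shows "boolean p x"
  using X(3)
proof (induction "d p x" arbitrary: x rule: less_induct)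
  case less
  note G = thick_gatedD[OF X(1)]
  have p: "p \<in> V" and x: "x \<in> V" using X less G by auto
  show ?case
  proof (cases "d p x")
    case 0
    then have "p = x" using dist_eq_0 p x by simp
    then show ?thesis using boolean.refl p by simp
  next
    case (Suc n)
    obtain y where y: "E x y" "d p y = n" using dist_pred[OF p x Suc] by blast
    have h: "d p x = Suc (d p y)" using y Suc by simp
    have yV: "y \<in> V" using y adj_V by auto
    have yX: "y \<in> X"
      using gated_convex[OF G(1) X(2) less(2) yV] h dist_adj[OF adj_sym[OF y(1)]] by simp
    have yb: "boolean p y" using less(1)[OF _ yX] h by simp
    show ?thesis
    proof (cases n)
      case 0
      then have "p = y" using dist_eq_0 p yV y by simp
      then show ?thesis using boolean_adj y adj_sym by blast
    next
      case (Suc m)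
      obtain c where c: "E y c" "d p c = m" using dist_pred[OF p yV, of m] y Suc by blast
      have hc: "d p y = Suc (d p c)" using c y Suc by simp
      have cV: "c \<in> V" using c adj_V by auto
      have cX: "c \<in> X"
        using gated_convex[OF G(1) X(2) yX cV] hc dist_adj[OF adj_sym[OF c(1)]] by simp
      have "c \<noteq> x" "\<not> E c x" using adj_dist_le[of c x p] p h hc by auto
      then obtain r where r: "r \<in> X" "r \<noteq> y" "E r c" "E r x"
        using thick_gated_square[OF X(1) yX cX less(2) c(1) adj_sym[OF y(1)]] by blast
      have hr: "d p r = Suc (d p c)" using adj_dist_le[OF r(3) p] adj_dist_le[OF r(4) p] h hc by simp
      have br: "boolean p r" using less(1)[OF _ r(1)] hr h hc by simp
      obtain s where s: "s \<in> dirs p r" "s \<notin> dirs p c" using boolean_lower[OF br adj_sym[OF r(3)] hr] by blast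
      have "d p x = Suc (Suc (d p c))" using h hc by simp
      then have "s \<in> dirs p x" "s \<notin> dirs p y"
        using transfer_dir[OF adj_sym[OF r(3)] adj_sym[OF c(1)] r(4) adj_sym[OF y(1)] r(2) p hr hc _ s] by auto
      then show ?thesis using boolean.step[OF yb adj_sym[OF y(1)] h] by blast
    qed
  qed
qed

text \<open>A vertex of the cone at distance at least 2 from \<open>p\<close> has two predecessors
  by \<open>lift_dir\<close>, so \<open>X\<close> contains it if it contains these. As a
  consequence, inclusion of thick gated sets through \<open>p\<close> can be tested on the
  neighbours of \<open>p\<close>.\<close>

lemma thick_gated_eq_cone:
  assumes X: "thick_gated X" "p \<in> X"
  shows "X = cone p {s \<in> X. E p s}"
proof
  note G = thick_gatedD[OF X(1)]
  show "X \<subseteq> cone p {s \<in> X. E p s}"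
    using thick_gated_boolean[OF X] gated_dirs[OF G(1) X(2)] by (auto simp: cone_def)
  have p: "p \<in> V" using X G by auto
  show "cone p {s \<in> X. E p s} \<subseteq> X" (is "?C \<subseteq> X")
  proof
    fix x assume "x \<in> ?C"
    then show "x \<in> X"
    proof (induction "d p x" arbitrary: x rule: less_induct)
      case less
      have x: "boolean p x" "dirs p x \<subseteq> {s \<in> X. E p s}" using less(2) by (auto simp: cone_def)
      from x(1) show ?case
      proof cases
        case refl
        then show ?thesis using X by simp
      next
        case (step y)
        have yX: "y \<in> X" using less(1)[of y] cone_lower[OF less(2) step(2,3)] step(3) by simp
        have yV: "y \<in> V" using step adj_V by auto
        obtain s where s: "s \<in> dirs p x" "s \<notin> dirs p y" using step by blast
        show ?thesis
        proof (cases "d p y")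
          case 0
          then have "E p x" using dist_eq_0 p yV step by simp
          then show ?thesis using dirs_adj x(2) by auto
        next
          case (Suc m)
          obtain c where c: "E y c" "d p c = m" using dist_pred[OF p yV Suc] by blast
          have hc: "d p y = Suc (d p c)" using c Suc by simp
          obtain g where g: "E c g" "E g x" "g \<noteq> y" "d p g = Suc (d p c)"
            using lift_dir[OF adj_sym[OF c(1)] step(2) p hc step(3) s] by blast
          have "g \<in> X"
            using less(1)[of g] cone_lower[OF less(2) g(2)] g hc step(3) by simp
          then show ?thesis
            using nbr_closedD[OF G(4) yX _ step(2) adj_sym[OF g(2)]] g by blast
        qed
      qed
    qed
  qed
qed

text \<open>\<open>bhull p q\<close> is the smallest thick gated set containing a Boolean pair \<open>p\<close>, \<open>q\<close>; for other pairs
  it need not contain \<open>q\<close>.\<close>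

definition bhull :: "'a \<Rightarrow> 'a \<Rightarrow> 'a set" where
  "bhull p q = cone p {s. E p s \<and> d s q \<le> d p q}"

lemma toward_lower:
  assumes V: "p \<in> V" "q \<in> V" and s: "E p s" "d s q \<le> d p q"
  shows "\<exists>s0. E p s0 \<and> (s0 = s \<or> E s0 s) \<and> Suc (d q s0) = d q p"
proof (cases "d q s = d q p")
  case True
  then obtain z where "E z p" "E z s" "Suc (d q z) = d q p" using triangle_cond[of p s q] s V by auto
  then show ?thesis using adj_sym by blast
next
  case False
  then have "Suc (d q s) = d q p" using adj_dist_le[of p s q] s V by (auto simp: dist_comm)
  then show ?thesis using s by blast
qed

text \<open>In the quadrangle clause suppose \<open>r\<close> is farther from \<open>q\<close> than
  \<open>p\<close>. Sliding along lines replaces \<open>s\<close>, \<open>s'\<close> by vertices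
  \<open>s0\<close>, \<open>s0'\<close> closer to \<open>q\<close>, and \<open>t\<close> by vertices
  \<open>t1\<close>, \<open>t2\<close> on the line of \<open>t\<close> and \<open>r\<close> that are
  as far from \<open>q\<close> as \<open>p\<close>. If \<open>t1 = t2\<close>, this violates
  \<open>quadrangle_unique\<close> at \<open>r\<close>, otherwise
  \<open>triangle_third\<close>.\<close>

lemma toward_flat:
  assumes V: "p \<in> V" "q \<in> V"
  shows "flat p {s. E p s \<and> d s q \<le> d p q}"
  unfolding flat_def
proof (intro conjI ballI allI impI)
  show "p \<in> V" by fact
  let ?S = "{s. E p s \<and> d s q \<le> d p q}"
  have lower: "\<exists>s0. E p s0 \<and> (s0 = s \<or> E s0 s) \<and> Suc (d q s0) = d q p" if "s \<in> ?S" for s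
    using toward_lower[OF V] that by blast
  show "E p s" if "s \<in> ?S" for s using that by simp
  show "s' \<in> ?S" if a: "s \<in> ?S" "E p s'" "E s s'" for s s'
  proof -
    obtain s0 where s0: "E p s0" "s0 = s \<or> E s0 s" "Suc (d q s0) = d q p" using lower a by blast
    have "s' = s0 \<or> E s0 s'"
      using no_K4_minus[of p s s0 s'] s0 a adj_sym by blast
    then have "d q s' \<le> d q p" using adj_dist_le[of s0 s' q] s0 V by auto
    then show ?thesis using a by (simp add: dist_comm)
  qed
  fix s s' t r
  assume a: "s \<in> ?S" "s' \<in> ?S" "s \<noteq> s'" "\<not> E s s'" "E t s" "E t s'" "d p t = 2" "E p r" "E t r"
  have ntp: "t \<noteq> p" "\<not> E p t" using a(7) V dist_adj[of p t] by auto
  have meet: "\<exists>t1 s0. E t1 r \<and> (t1 = t \<or> E t1 t) \<and> E t1 s0 \<and> E p s0 \<and> (s0 = s \<or> E s0 s) \<and> Suc (d q s0) = d q p"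
    if s: "s \<in> ?S" "E t s" and r: "d q r = Suc (d q p)" for s
  proof -
    obtain s0 where s0: "E p s0" "s0 = s \<or> E s0 s" "Suc (d q s0) = d q p" using lower s by blast
    show ?thesis
    proof (cases "s0 = s")
      case True
      then show ?thesis using s0 s a by blast
    next
      case False
      have s0V: "s0 \<in> V" using s0 adj_V by auto
      have nt: "\<not> E s0 t" using no_K4_minus[of s0 s p t] s0 s ntp False adj_sym by blast
      have nr: "\<not> E s0 r" "s0 \<noteq> r" using adj_dist_le[of s0 r q] s0 r V by auto
      have "d s0 t = 2" "d s0 r = 2"
        using dist_2I[of s0 s t] dist_2I[of s0 p r] s0 s a(8) ntp nt nr False adj_sym by blast+
      then obtain z where z: "E z r" "E z t" "Suc (d s0 z) = 2"
        using triangle_cond[OF adj_sym[OF a(9)] s0V] by auto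
      have "z \<in> V" using z adj_V by auto
      then have "E s0 z" using z dist_eq_1[OF s0V] by auto
      then show ?thesis using z s0 adj_sym by blast
    qed
  qed
  show "r \<in> ?S"
  proof (rule ccontr)
    assume "r \<notin> ?S"
    then have r: "d q r = Suc (d q p)" using adj_dist_le[OF a(8) V(2)] a(8) by (auto simp: dist_comm)
    obtain t1 s0 where 1: "E t1 r" "t1 = t \<or> E t1 t" "E t1 s0" "E p s0" "s0 = s \<or> E s0 s" "Suc (d q s0) = d q p"
      using meet[OF a(1,5) r] by blast
    obtain t2 s0' where 2: "E t2 r" "t2 = t \<or> E t2 t" "E t2 s0'" "E p s0'" "s0' = s' \<or> E s0' s'" "Suc (d q s0') = d q p"
      using meet[OF a(2,6) r] by blast
    have h: "d q t1 = d q p" "d q t2 = d q p"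
      using adj_dist_le[OF 1(1) V(2)] adj_dist_le[OF 1(3) V(2)] adj_dist_le[OF 2(1) V(2)] adj_dist_le[OF 2(3) V(2)] r 1 2 by auto
    show False
    proof (cases "t1 = t2")
      case True
      have "p \<noteq> t1" using 1(2) ntp adj_sym by blast
      moreover have "E t1 s0'" using 2 True by simp
      moreover have "s0 \<noteq> s0'"
      proof
        assume "s0 = s0'"
        then have "E s s0 \<and> E s' s0 \<or> s = s0 \<or> s' = s0" "E p s" "E p s'" using 1 2 a adj_sym by auto
        then show False
          using no_K4_minus[of p s0 s s'] 1 2 a \<open>s0 = s0'\<close> adj_sym by blast
      qed
      ultimately show False
        using quadrangle_unique[OF adj_sym[OF a(8)] adj_sym[OF 1(1)] _ V(2) _ _ adj_sym[OF 1(4)] adj_sym[OF 1(3)] _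
            adj_sym[OF 2(4)]  adj_sym[of t1 s0']] h r 1 2 by metis
    next
      case False
      have "E t1 t2"
        using no_K4_minus[of t r t1 t2] 1 2 False a(9) adj_sym by blast
      then show False using triangle_third[OF _ 2(1) 1(1) V(2)] h r by simp
    qed
  qed
qed

text \<open>The vertices nearest to \<open>q\<close> on the lines of \<open>s\<close> and
  \<open>s'\<close> lie in a square by the quadrangle condition, and \<open>square_line\<close>
  slides its corners to \<open>s\<close> and \<open>s'\<close>.\<close>

lemma toward_square:
  assumes V: "p \<in> V" "q \<in> V" and s: "E p s" "d s q \<le> d p q" "E p s'" "d s' q \<le> d p q"
    and ne: "s \<noteq> s'" "\<not> E s s'"
  shows "square p s s'"
proof -
  obtain a where a: "E p a" "a = s \<or> E a s" "Suc (d q a) = d q p" using toward_lower[OF V s(1,2)] by blast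
  obtain b where b: "E p b" "b = s' \<or> E b s'" "Suc (d q b) = d q p" using toward_lower[OF V s(3,4)] by blast
  have ab: "a \<noteq> b" using a b ne no_K4_minus[of p a s s'] s adj_sym by blast
  have nab: "\<not> E a b" using quadrangle_nonadj[OF a(1) b(1) V(2)] a b by auto
  obtain c where c: "E c a" "E c b" "Suc (d q c) = d q a"
    using quadrangle_cond[OF a(1) b(1) ab V(2)] a b by auto
  have "square p a b" unfolding square_def using a c by (intro exI[of _ c]) auto
  moreover have "square p s b" if "square p a b"
  proof (cases "a = s")
    case False
    then have "s \<noteq> b" using nab a by auto
    moreover have "\<not> E s b"
    proof
      assume "E s b"
      then have "E a b" using no_K4_minus[of p s a b] s a b False ab adj_sym by blast
      then show False using nab by simp
    qed
    ultimately show ?thesis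
      using square_line[OF a(1) b(1) ab nab that s(1)] a False adj_sym by blast
  qed (use that in simp)
  ultimately have sb: "square p s b" by simp
  show ?thesis
  proof (cases "b = s'")
    case False
    then have bs: "E b s'" using b by blast
    have "b \<noteq> s" using bs ne adj_sym by blast
    moreover have "\<not> E b s"
    proof
      assume "E b s"
      then have "E s s'" using no_K4_minus[of p b s s'] s b bs ne adj_sym by blast
      then show False using ne by simp
    qed
    ultimately have "square p s' s"
      using square_line[OF b(1) s(1) _ _ square_commute[OF sb] s(3)] bs ne adj_sym by blast
    then show ?thesis by (rule square_commute)
  qed (use sb in simp)
qed

lemma bhull_thick_gated: "p \<in> V \<Longrightarrow> q \<in> V \<Longrightarrow> thick_gated (bhull p q)"
  unfolding bhull_def using toward_flat toward_square by (intro cone_thick_gated) auto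

lemma bhull_base: "p \<in> V \<Longrightarrow> p \<in> bhull p q"
  unfolding bhull_def by (rule cone_base)

lemma bhull_end: "boolean p q \<Longrightarrow> q \<in> bhull p q"
  by (auto simp: bhull_def cone_def dirs_def)

lemma bhull_nbr: "E p s \<Longrightarrow> s \<in> bhull p q \<longleftrightarrow> d s q \<le> d p q"
  by (simp add: bhull_def cone_nbrs)

text \<open>Convexity puts \<open>dirs p q\<close> into \<open>Y\<close>, closure under triangles
  adds the rest of these lines, and \<open>thick_gated_eq_cone\<close> extends the inclusion from
  the neighbours of \<open>p\<close> to the whole hull.\<close>

lemma bhull_least:
  assumes Y: "thick_gated Y" "p \<in> Y" "q \<in> Y"
  shows "bhull p q \<subseteq> Y"
proof -
  note G = thick_gatedD[OF Y(1)]
  have V: "p \<in> V" "q \<in> V" using G Y by auto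
  have "s \<in> Y" if s: "E p s" "d s q \<le> d p q" for s
  proof (cases "d s q = d p q")
    case True
    then obtain z where z: "E z p" "E z s" "Suc (d q z) = d q p"
      using triangle_cond[of p s q] s V by (auto simp: dist_comm)
    have zY: "z \<in> Y"
      using gated_convex[OF G(1) Y(2,3), of z] z adj_V dist_adj[OF adj_sym[OF z(1)]] by (auto simp: dist_comm)
    have "p \<noteq> z" using z adj_irrefl by blast
    then show ?thesis using nbr_closedD[OF G(4) Y(2) zY s(1) adj_sym[OF z(2)]] by blast
  next
    case False
    then have "Suc (d s q) = d p q" using s adj_dist_le[OF s(1) V(2)] by (auto simp: dist_comm)
    then show ?thesis using gated_dirs[OF G(1) Y(2,3)] s by (auto simp: dirs_def)
  qed
  then have "{s. E p s \<and> d s q \<le> d p q} \<subseteq> {s \<in> Y. E p s}" by blast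
  then show ?thesis
    unfolding bhull_def using thick_gated_eq_cone[OF Y(1,2)] cone_mono by metis
qed

end

section \<open>Opposite vertices\<close>

context swm begin

text \<open>Equivalently, \<open>p\<close> and \<open>q\<close> lie in the thick gated set \<open>X\<close> and \<open>d q\<close> has a local maximum on
  \<open>X\<close> at \<open>p\<close>.\<close>

definition opposite :: "'a set \<Rightarrow> 'a \<Rightarrow> 'a \<Rightarrow> bool" where
  "opposite X p q \<longleftrightarrow> boolean p q \<and> X = bhull p q"

lemma boolean_commute: "boolean p q \<Longrightarrow> boolean q p"
  using thick_gated_boolean[of "bhull p q" q p] bhull_thick_gated bhull_base bhull_end boolean_V by blast

lemma bhull_commute:
  assumes "boolean p q"
  shows "bhull p q = bhull q p"
proof
  have V: "p \<in> V" "q \<in> V" using boolean_V assms by auto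
  note T = bhull_thick_gated[OF V] bhull_thick_gated[OF V(2,1)]
  show "bhull p q \<subseteq> bhull q p"
    by (rule bhull_least[OF T(2) bhull_end[OF boolean_commute[OF assms]] bhull_base[OF V(2)]])
  show "bhull q p \<subseteq> bhull p q"
    by (rule bhull_least[OF T(1) bhull_end[OF assms] bhull_base[OF V(1)]])
qed

lemma opposite_commute: "opposite X p q \<Longrightarrow> opposite X q p"
  unfolding opposite_def using boolean_commute bhull_commute by blast

lemma oppositeD:
  assumes "opposite X p q"
  shows "thick_gated X" "p \<in> X" "q \<in> X" "p \<in> V" "q \<in> V" "gated V E X" "nbr_closed X"
  using assms bhull_thick_gated bhull_base bhull_end boolean_V thick_gatedD(1,4)[of X]
  unfolding opposite_def by blast+

lemma opposite_max: "opposite X p q \<Longrightarrow> s \<in> X \<Longrightarrow> E p s \<Longrightarrow> d s q \<le> d p q"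
  unfolding opposite_def using bhull_nbr by blast

lemma oppositeI:
  assumes X: "thick_gated X" "p \<in> X" "q \<in> X" and m: "\<And>s. s \<in> X \<Longrightarrow> E p s \<Longrightarrow> d s q \<le> d p q"
  shows "opposite X p q"
proof -
  have "{s \<in> X. E p s} \<subseteq> {s. E p s \<and> d s q \<le> d p q}" using m by blast
  then have "X \<subseteq> bhull p q"
    using thick_gated_eq_cone[OF X(1,2)] cone_mono unfolding bhull_def by metis
  then show ?thesis
    using bhull_least[OF X] thick_gated_boolean[OF X] unfolding opposite_def by blast
qed

lemma opposite_least: "opposite X p q \<Longrightarrow> thick_gated Y \<Longrightarrow> p \<in> Y \<Longrightarrow> q \<in> Y \<Longrightarrow> X \<subseteq> Y"
  unfolding opposite_def using bhull_least by blast

text \<open>Each of \<open>X\<close> and \<open>bhull p1 q1\<close> contains the pair that generates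
  the other, so minimality gives both inclusions.\<close>

lemma opposite_move:
  assumes X: "opposite X p q" and r: "p1 \<in> X" "q1 \<in> X" "p \<in> bhull p1 q1" "q \<in> bhull p1 q1"
  shows "opposite X p1 q1"
proof -
  have V: "p1 \<in> V" "q1 \<in> V" using r thick_gatedD(3)[OF oppositeD(1)[OF X]] by auto
  have "boolean p1 q1" using thick_gated_boolean[OF oppositeD(1)[OF X] r(1,2)] .
  moreover have "bhull p1 q1 \<subseteq> X" using bhull_least[OF oppositeD(1)[OF X] r(1,2)] .
  moreover have "X \<subseteq> bhull p1 q1" using opposite_least[OF X bhull_thick_gated[OF V] r(3,4)] .
  ultimately show ?thesis unfolding opposite_def by blast
qed

lemma opposite_slide:
  assumes X: "opposite X p q" and p1: "p1 \<in> X" "E p p1" "d p q \<le> d p1 q"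
  shows "opposite X p1 q"
proof (rule opposite_move[OF X p1(1) oppositeD(3)[OF X]])
  show "p \<in> bhull p1 q" using bhull_nbr[OF adj_sym[OF p1(2)]] p1(3) by simp
  show "q \<in> bhull p1 q" using bhull_end thick_gated_boolean[OF oppositeD(1)[OF X] p1(1) oppositeD(3)[OF X]] by simp
qed

lemma opposite_slide2:
  assumes X: "opposite X p q" and p1: "p1 \<in> X" "E p p1" and q1: "q1 \<in> X" "E q q1"
    and h: "d p1 q1 = d p q" "d p1 q \<le> d p q"
  shows "opposite X p1 q1"
proof (rule opposite_move[OF X p1(1) q1(1)])
  have b: "boolean p1 q1" "boolean q1 p1"
    using thick_gated_boolean[OF oppositeD(1)[OF X]] p1 q1 by auto
  have "d p q1 \<le> d p q"
    using opposite_max[OF opposite_commute[OF X] q1] by (simp add: dist_comm)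
  then show "p \<in> bhull p1 q1" using bhull_nbr[OF adj_sym[OF p1(2)]] h by simp
  have "q \<in> bhull q1 p1" using bhull_nbr[OF adj_sym[OF q1(2)]] h by (simp add: dist_comm)
  then show "q \<in> bhull p1 q1" using bhull_commute[OF b(1)] by simp
qed

text \<open>Otherwise \<open>q\<close> is a local maximum of the distance from \<open>p1\<close>,
  hence opposite to \<open>p1\<close>; by symmetry no neighbour of \<open>p1\<close> in
  \<open>X\<close> is farther from \<open>q\<close>, but \<open>p\<close> is.\<close>

lemma opposite_step:
  assumes X: "opposite X p q" and p1: "p1 \<in> X" "E p p1" "d p1 q < d p q"
  shows "\<exists>q1\<in>X. E q q1 \<and> d p1 q1 = d p q"
proof (rule ccontr)
  assume no: "\<not> ?thesis"
  note G = thick_gatedD[OF oppositeD(1)[OF X]]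
  have V: "p1 \<in> V" using p1 G by auto
  have "Suc (d p1 q) = d p q" using adj_dist_le[OF p1(2) oppositeD(5)[OF X]] p1(3) by (simp add: dist_comm)
  then have "d s p1 \<le> d q p1" if "s \<in> X" "E q s" for s
    using no that adj_dist_le[OF that(2) V] by (auto simp: dist_comm)
  then have "opposite X p1 q"
    using opposite_commute[OF oppositeI[OF oppositeD(1)[OF X] oppositeD(3)[OF X] p1(1)]] by blast
  then show False using opposite_max[OF _ oppositeD(2)[OF X] adj_sym[OF p1(2)]] p1(3) by fastforce
qed

lemma opposite_transport:
  assumes X: "opposite X p q" and p1: "p1 \<in> X" "E p p1"
  shows "\<exists>q1. opposite X p1 q1 \<and> d p1 q1 = d p q"
proof (cases "d p1 q < d p q")
  case True
  then obtain q1 where "q1 \<in> X" "E q q1" "d p1 q1 = d p q" using opposite_step[OF X p1] by blast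
  then show ?thesis using opposite_slide2[OF X p1] True by (metis less_imp_le)
next
  case False
  moreover have "d p1 q \<le> d p q" using opposite_max[OF X p1] .
  ultimately show ?thesis using opposite_slide[OF X p1] by (metis le_antisym not_less)
qed

lemma opposite_everywhere:
  assumes X: "opposite X p q" and p1: "p1 \<in> X"
  shows "\<exists>q1. opposite X p1 q1 \<and> d p1 q1 = d p q"
  using conn_in_induct[OF thick_gatedD(5)[OF oppositeD(1)[OF X]] oppositeD(2)[OF X] p1,
      of "\<lambda>a. \<exists>q1. opposite X a q1 \<and> d a q1 = d p q"] X opposite_transport
  by metis

text \<open>Let \<open>t\<close> complete the square on \<open>w\<close>, \<open>p\<close>,
  \<open>s\<close>. If \<open>t\<close> is as far from \<open>b\<close> as \<open>w\<close>, slide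
  \<open>w\<close> to \<open>t\<close> and on to \<open>s\<close>. Otherwise \<open>p\<close> and
  \<open>t\<close> have a common neighbour \<open>m\<close> closer to \<open>b\<close>, and a
  direction at \<open>b\<close> towards \<open>w\<close> but away from \<open>s\<close> would see
  both \<open>w\<close> and \<open>m\<close> below \<open>p\<close> and \<open>t\<close>, against
  \<open>quadrangle_unique\<close>; so \<open>w\<close> lies in the hull of \<open>s\<close> and
  \<open>b\<close>.\<close>

lemma opposite_siblings:
  assumes X: "opposite X w b" and p: "E p w" "d b w = Suc (d b p)" and s: "s \<in> X" "E p s" "d b s = Suc (d b p)"
  shows "opposite X s b"
proof (cases "E w s \<or> w = s")
  case True
  then show ?thesis using X opposite_slide[OF X s(1)] s(3) p(2) by (auto simp: dist_comm)
next
  case False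
  note G = thick_gatedD[OF oppositeD(1)[OF X]]
  have bV: "b \<in> V" using oppositeD(5)[OF X] .
  have V: "p \<in> V" "w \<in> V" "s \<in> V" using p s adj_V by auto
  have pX: "p \<in> X"
    using gated_convex[OF G(1) oppositeD(3)[OF X] oppositeD(2)[OF X] V(1)] p dist_adj[OF p(1)] by simp
  obtain t where t: "t \<in> X" "t \<noteq> p" "E t w" "E t s"
    using thick_gated_square[OF oppositeD(1)[OF X] pX oppositeD(2)[OF X] s(1) p(1) s(2)] False by blast
  have tm: "d b t \<le> Suc (d b p)"
    using opposite_max[OF X t(1) adj_sym[OF t(3)]] p by (simp add: dist_comm)
  show ?thesis
  proof (cases "d b t = Suc (d b p)")
    case True
    then have "opposite X t b" using opposite_slide[OF X t(1) adj_sym[OF t(3)]] p by (simp add: dist_comm)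
    then show ?thesis using opposite_slide[OF _ s(1) t(4)] True s by (simp add: dist_comm)
  next
    case False
    then have ht: "d b t = d b p" using tm adj_dist_le[OF t(3) bV] p by simp
    obtain m where m: "E m p" "E m t" "Suc (d b m) = d b p"
      using quadrangle_cond[OF adj_sym[OF p(1)] adj_sym[OF t(3)] t(2)[symmetric] bV] ht p by auto
    have mV: "m \<in> V" using m adj_V by auto
    have bs: "boolean s b" using thick_gated_boolean[OF oppositeD(1)[OF X] s(1) oppositeD(3)[OF X]] .
    have bw: "boolean b w" using thick_gated_boolean[OF oppositeD(1)[OF X] oppositeD(3)[OF X] oppositeD(2)[OF X]] .
    have "dirs b w \<subseteq> {r. E b r \<and> d r s \<le> d b s}"
    proof
      fix r assume "r \<in> dirs b w"
      then have r: "E b r" "d r w = d b p" using p by (auto simp: dirs_def)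
      have rV: "r \<in> V" using r adj_V by auto
      show "r \<in> {r. E b r \<and> d r s \<le> d b s}"
      proof (rule ccontr)
        assume "r \<notin> {r. E b r \<and> d r s \<le> d b s}"
        then have rs: "d r s = Suc (Suc (d b p))"
          using r(1) adj_dist_le[OF r(1) V(3)] s(3) by (auto simp: dist_comm)
        have rp: "d r p = Suc (d b p)" "d r t = Suc (d b p)"
          using adj_dist_le[OF s(2) rV] adj_dist_le[OF t(4) rV] adj_dist_le[OF p(1) rV] adj_dist_le[OF t(3) rV] rs r by auto
        have rm: "d r m = d b p" using adj_dist_le[OF m(1) rV] adj_dist_le[OF r(1) mV] rp m by (simp add: dist_comm)
        have "w = m"
          using quadrangle_unique[OF adj_sym[OF s(2)] adj_sym[OF t(4)] t(2)[symmetric] rV _ _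
              adj_sym[OF p(1)] adj_sym[OF t(3)] _ m(1,2)] rp rs r rm by simp
        then show False using m p by simp
      qed
    qed
    then have "w \<in> bhull b s" unfolding bhull_def cone_def using bw by (simp add: dist_comm)
    then have "w \<in> bhull s b" using bhull_commute[OF bs] by simp
    moreover have "b \<in> bhull s b" using bhull_end[OF bs] .
    ultimately show ?thesis using opposite_move[OF X s(1) oppositeD(3)[OF X]] by blast
  qed
qed

text \<open>\<open>bhull p z\<close> contains \<open>p'\<close> by convexity, hence the hull
  \<open>Y\<close> of \<open>p'\<close> and \<open>z\<close>, hence \<open>q\<close>; so it is all
  of \<open>X\<close>.\<close>

lemma opposite_cone_top:
  assumes X: "opposite X p q" and Y: "opposite Y p' q" "opposite Y p' z" and p: "E p p'" "d p q = Suc (d p' q)"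
    "d p z = Suc (d p' z)" and zX: "z \<in> X"
  shows "opposite X p z"
proof -
  note G = thick_gatedD[OF oppositeD(1)[OF X]]
  have p'V: "p' \<in> V" using p adj_V by auto
  have b: "boolean p z" using thick_gated_boolean[OF oppositeD(1)[OF X] oppositeD(2)[OF X] zX] .
  have V: "p \<in> V" "z \<in> V" using b boolean_V by auto
  note T = bhull_thick_gated[OF V]
  have pz: "p \<in> bhull p z" "z \<in> bhull p z" using bhull_base V bhull_end b by auto
  have "p' \<in> bhull p z"
    using gated_convex[OF thick_gatedD(1)[OF T] pz p'V] dist_adj[OF p(1)] p by simp
  then have "Y \<subseteq> bhull p z" using opposite_least[OF Y(2) T _ pz(2)] by blast
  then have "q \<in> bhull p z" using oppositeD(3)[OF Y(1)] by blast
  then show ?thesis using opposite_move[OF X oppositeD(2)[OF X] zX] pz by blast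
qed

text \<open>By induction on \<open>d p q\<close>: if \<open>p'\<close> is a neighbour of \<open>p\<close> closer to \<open>q\<close>, every vertex of \<open>X\<close> is at
  distance at most 1 from the smaller set \<open>Y = bhull p' q\<close>. The invariant \<open>P a\<close>, propagated along
  \<open>Y\<close>, says that some vertex just outside \<open>Y\<close> above \<open>a\<close> is opposite to an antipode of \<open>a\<close> in \<open>Y\<close>.\<close>

theorem opposite_diameter:
  assumes "opposite X p q" "x \<in> X" "y \<in> X"
  shows "d x y \<le> d p q"
  using assms
proof (induction "d p q" arbitrary: X p q x y)
  case 0
  note X = \<open>opposite X p q\<close>
  have "p = q" using 0 dist_eq_0 oppositeD[OF X] by auto
  have no: "\<not> E p s" if "s \<in> X" for s
    using opposite_max[OF X that] \<open>p = q\<close> dist_adj[of p s] oppositeD(4)[OF X] by (auto simp: dist_comm)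
  have "z = p" if "z \<in> X" for z
    using conn_in_induct[OF thick_gatedD(5)[OF oppositeD(1)[OF X]] oppositeD(2)[OF X] that, of "\<lambda>z. z = p"] no by blast
  then have "x = p" "y = p" using \<open>x \<in> X\<close> \<open>y \<in> X\<close> by auto
  then show ?case using oppositeD(4)[OF X] by simp
next
  case (Suc k)
  note X = \<open>opposite X p q\<close>
  note G = thick_gatedD[OF oppositeD(1)[OF X]]
  have V: "p \<in> V" "q \<in> V" using oppositeD[OF X] by auto
  obtain p' where p': "E p p'" "d q p' = k" using dist_pred[OF V(2,1)] Suc(2) by (metis dist_comm)
  have h': "d p' q = k" "d p q = Suc (d p' q)" using p' Suc(2) by (simp_all add: dist_comm)
  have p'V: "p' \<in> V" using p' adj_V by auto
  have p'X: "p' \<in> X"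
    using gated_convex[OF G(1) oppositeD(2)[OF X] oppositeD(3)[OF X] p'V] dist_adj[OF p'(1)] h' by simp
  define Y where "Y = bhull p' q"
  have Y: "opposite Y p' q"
    using thick_gated_boolean[OF oppositeD(1)[OF X] p'X oppositeD(3)[OF X]] by (simp add: opposite_def Y_def)
  note GY = thick_gatedD[OF oppositeD(1)[OF Y]]
  have YX: "Y \<subseteq> X" using opposite_least[OF Y oppositeD(1)[OF X] p'X oppositeD(3)[OF X]] .
  have diamY: "d a b \<le> k" if "a \<in> Y" "b \<in> Y" for a b using Suc(1)[OF h'(1)[symmetric] Y that] h' by simp
  have oppY: "opposite Y a b" if "a \<in> Y" "b \<in> Y" "d a b = k" for a b
    using oppositeI[OF oppositeD(1)[OF Y] that(1,2)] diamY that by simp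
  have gateY: "d x b = Suc (d a b)" if "x \<notin> Y" "E x a" "a \<in> Y" "b \<in> Y" for x a b
  proof -
    have xV: "x \<in> V" using that adj_V by auto
    obtain g where g: "is_gate Y x g" using gate_ex[OF GY(1) xV] by blast
    have gV: "g \<in> V" using is_gate_in[OF g] GY by auto
    have "g \<noteq> x" using is_gate_in[OF g] that by auto
    then have "d x g \<noteq> 0" using dist_eq_0 xV gV by auto
    moreover have "d x g + d g a = 1" using is_gate_d[OF g that(3)] dist_adj[OF that(2)] by simp
    ultimately have "d x g = 1" "d g a = 0" by linarith+
    then have "g = a" using dist_eq_0 gV GY that by blast
    then show ?thesis using is_gate_d[OF g that(4)] \<open>d x g = 1\<close> by simp
  qed
  have antip: "\<exists>b\<in>Y. d a b = k" if "a \<in> Y" for a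
    using opposite_everywhere[OF Y that] oppositeD(3) h' by metis
  define P where "P = (\<lambda>a. \<exists>w\<in>X. w \<notin> Y \<and> E w a \<and> (\<exists>b\<in>Y. d a b = k \<and> opposite X w b))"
  have pY: "p \<notin> Y" using diamY[of p q] oppositeD(3)[OF Y] Suc(2) by auto
  have P0: "P p'"
    unfolding P_def using oppositeD(2)[OF X] pY p'(1) oppositeD(3)[OF Y] h'(1) X by blast
  have Pstep: "P a2" if a: "a1 \<in> Y" "a2 \<in> Y" "E a1 a2" "P a1" for a1 a2
  proof -
    obtain w b where w: "w \<in> X" "w \<notin> Y" "E w a1" "b \<in> Y" "d a1 b = k" "opposite X w b"
      using a(4) unfolding P_def by blast
    have "w \<noteq> a2" using a w by auto
    moreover have "\<not> E w a2" using nbr_closedD[OF GY(4) a(1,2) adj_sym[OF w(3)]] a(3) w(2) adj_irrefl by blast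
    ultimately obtain t where t: "t \<in> X" "t \<noteq> a1" "E t w" "E t a2"
      using thick_gated_square[OF oppositeD(1)[OF X] _ w(1) _ adj_sym[OF w(3)] a(3)] YX a by blast
    have tY: "t \<notin> Y"
      using nbr_closedD[OF GY(4) a(1) _ adj_sym[OF w(3)] adj_sym[OF t(3)]] t w(2) by blast
    have tb: "d t c = Suc (d a2 c)" if "c \<in> Y" for c using gateY[OF tY t(4) a(2) that] .
    have wb: "d w b = Suc k" using gateY[OF w(2,3) a(1) w(4)] w by simp
    show ?thesis
    proof (cases "d a2 b = k")
      case True
      then have "opposite X t b" using opposite_slide[OF w(6) t(1) adj_sym[OF t(3)]] tb[OF w(4)] wb by simp
      then show ?thesis unfolding P_def using t tY w True by blast
    next
      case False
      then have lt: "d a2 b < d a1 b" using diamY[OF a(2) w(4)] w by simp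
      obtain b2 where b2: "b2 \<in> Y" "E b b2" "d a2 b2 = d a1 b"
        using opposite_step[OF oppY[OF a(1) w(4,5)] a(2,3) lt] by blast
      have "opposite X t b2"
        by (rule opposite_slide2[OF w(6) t(1) adj_sym[OF t(3)] _ b2(2)])
          (use YX b2 tb[OF b2(1)] tb[OF w(4)] wb w lt in auto)
      then show ?thesis unfolding P_def using t tY b2 w by metis
    qed
  qed
  \<comment> \<open>The invariant provides some \<open>w\<close> above \<open>a\<close> and some
    antipode \<open>c\<close> of \<open>a\<close>; \<open>opposite_cone_top\<close> exchanges
    \<open>c\<close> for \<open>b\<close>, and \<open>opposite_siblings\<close> exchanges
    \<open>w\<close> for \<open>x\<close>.\<close>
  have top: "opposite X x b" if x: "x \<in> X" "x \<notin> Y" "E x a" and ab: "a \<in> Y" "b \<in> Y" "d a b = k" for x a b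
  proof -
    have "P a" using conn_in_induct[OF GY(5) oppositeD(2)[OF Y] ab(1), of P] P0 Pstep by blast
    then obtain w c where w: "w \<in> X" "w \<notin> Y" "E w a" "c \<in> Y" "d a c = k" "opposite X w c"
      unfolding P_def by blast
    have h: "d w c = Suc (d a c)" "d w b = Suc (d a b)" "d x b = Suc (d a b)"
      using gateY[OF w(2,3) ab(1)] gateY[OF x(2,3) ab(1)] w ab by auto
    have "opposite X w b"
      using opposite_cone_top[OF w(6) oppY[OF ab(1) w(4,5)] oppY[OF ab] w(3) h(1,2)] ab YX by blast
    then show ?thesis
      using opposite_siblings[OF _ adj_sym[OF w(3)] _ x(1) adj_sym[OF x(3)]] h by (simp add: dist_comm)
  qed
  have near: "\<exists>a\<in>Y. x = a \<or> E x a" if "x \<in> X" for x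
  proof (rule conn_in_induct[OF G(5) p'X that])
    show "\<exists>a\<in>Y. p' = a \<or> E p' a" using oppositeD(2)[OF Y] by blast
    fix u v assume uv: "u \<in> X" "v \<in> X" "E u v" "\<exists>a\<in>Y. u = a \<or> E u a"
    then obtain a where a: "a \<in> Y" "u = a \<or> E u a" by blast
    show "\<exists>a\<in>Y. v = a \<or> E v a"
    proof (cases "u \<in> Y")
      case False
      then have ua: "E u a" using a by blast
      have vV: "v \<in> V" using uv adj_V by auto
      obtain b where b: "b \<in> Y" "d a b = k" using antip a by blast
      have ub: "d u b = Suc k" using gateY[OF False ua a(1) b(1)] b by simp
      have vb: "d v b \<le> Suc k" using opposite_max[OF top[OF uv(1) False ua a(1) b] uv(2,3)] ub by simp
      obtain g where g: "is_gate Y v g" using gate_ex[OF GY(1) vV] by blast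
      have gV: "g \<in> V" "a \<in> V" using is_gate_in[OF g] a GY by auto
      have va: "d v a \<le> 2" using adj_dist_le[OF uv(3) gV(2)] dist_adj[OF ua] by (simp add: dist_comm)
      \<comment> \<open>Distance 2 would make \<open>a\<close> the gate of \<open>v\<close> and put
        \<open>v\<close> at distance \<open>k + 2\<close> from \<open>b\<close>, more than
        \<open>opposite_max\<close> allows.\<close>
      have "d v g \<noteq> 2"
      proof
        assume vg: "d v g = 2"
        then have "d g a = 0" using is_gate_d[OF g a(1)] va by simp
        then have "g = a" using dist_eq_0 gV by simp
        then show False using is_gate_d[OF g b(1)] vg b vb by simp
      qed
      moreover have "d v g \<le> 2" using is_gate_d[OF g a(1)] va by simp
      ultimately have "d v g = 0 \<or> d v g = Suc 0" by linarith
      then show ?thesis using dist_eq_0[OF vV gV(1)] dist_eq_1[OF vV gV(1)] is_gate_in[OF g] by blast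
    qed (use uv adj_sym in blast)
  qed
  obtain a where a: "a \<in> Y" "x = a \<or> E x a" using near Suc(4) by blast
  obtain b where b: "b \<in> Y" "y = b \<or> E y b" using near Suc(5) by blast
  have xy: "x \<in> V" "y \<in> V" "a \<in> V" "b \<in> V" using a b GY Suc(4,5) G by auto
  have ab: "d a b \<le> k" using diamY a b by blast
  have xb: "d x b \<le> Suc (d a b)" using a adj_dist_le[of x a b] xy by (auto simp: dist_comm)
  have "d x y \<le> Suc (d x b)" using b adj_dist_le[of y b x] xy by auto
  \<comment> \<open>Distance \<open>k + 2\<close> forces \<open>a\<close> and \<open>b\<close> to be
    antipodal in \<open>Y\<close> and \<open>x\<close> to lie outside \<open>Y\<close>; then
    \<open>x\<close> and \<open>b\<close> are opposite in \<open>X\<close>, and the neighbour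
    \<open>y\<close> of \<open>b\<close> cannot be farther from \<open>x\<close> than
    \<open>b\<close>.\<close>
  show ?case
  proof (rule ccontr)
    assume "\<not> d x y \<le> d p q"
    then have big: "d x y > Suc k" using Suc(2) by simp
    then have "d a b = k" "d x b = Suc k" using ab xb \<open>d x y \<le> Suc (d x b)\<close> by auto
    moreover have ex: "E x a" using a calculation by auto
    moreover have "x \<notin> Y" using diamY[of x b] b calculation by auto
    ultimately have "opposite X x b" using top[OF Suc(4)] a b by blast
    moreover have "E b y" using b big \<open>d x b = Suc k\<close> adj_sym by auto
    ultimately show False
      using opposite_max[OF opposite_commute, of X x b y] Suc(5) big \<open>d x b = Suc k\<close> by (simp add: dist_comm)
  qed
qed

end

section \<open>Boolean-gated sets of finite diameter, gates and cores\<close>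

context conn_graph begin

text \<open>Thickness of a Boolean-gated set is measured in the induced subgraph; convexity makes
  the distance there the restriction of \<open>d\<close>.\<close>

lemma gated_induced_dist:
  assumes X: "gated V E X" and uv: "u \<in> X" "v \<in> X"
  shows "gdist X (induced_adj E X) u v = d u v"
proof (rule gdist_characterization(2)[OF _ _ _ _ _ uv])
  note sub = gated_sub[OF X]
  show "simple_graph X (induced_adj E X)"
    unfolding simple_graph_def induced_adj_def using adj_sym adj_irrefl by blast
  show "d x x = 0" if "x \<in> X" for x using that sub by auto
  show "d x z \<le> Suc (d x y)" if "x \<in> X" "induced_adj E X y z" for x y z
    using that adj_dist_le[of y z x] sub by (auto simp: induced_adj_def)
  show "d x y = d y x" for x y by (rule dist_comm)
  show "(\<exists>z. induced_adj E X y z \<and> Suc (d x z) = d x y) \<or> (\<exists>z. induced_adj E X x z \<and> Suc (d z y) = d x y)"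
    if xy: "x \<in> X" "y \<in> X" "x \<noteq> y" for x y
  proof -
    have V: "x \<in> V" "y \<in> V" using xy sub by auto
    then obtain n where n: "d x y = Suc n" using dist_eq_0 xy(3) by (metis not0_implies_Suc)
    obtain w where w: "E y w" "d x w = n" using dist_pred[OF V n] by blast
    have "w \<in> X"
      using gated_convex[OF X xy(1,2) adj_V(2)[OF w(1)]] w n dist_adj[OF adj_sym[OF w(1)]] by simp
    then show ?thesis using w n xy by (auto simp: induced_adj_def)
  qed
qed

definition gate :: "'a set \<Rightarrow> 'a \<Rightarrow> 'a" where
  "gate X x = (SOME g. is_gate X x g)"

lemma gate_is_gate: "gated V E X \<Longrightarrow> x \<in> V \<Longrightarrow> is_gate X x (gate X x)"
  unfolding gate_def using gate_ex by (metis someI_ex)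

lemma gate_in: "gated V E X \<Longrightarrow> x \<in> V \<Longrightarrow> gate X x \<in> X"
  using gate_is_gate is_gate_in by blast

lemma gate_V: "gated V E X \<Longrightarrow> x \<in> V \<Longrightarrow> gate X x \<in> V"
  using gate_in gated_sub by blast

lemma gate_d: "gated V E X \<Longrightarrow> x \<in> V \<Longrightarrow> y \<in> X \<Longrightarrow> d x y = d x (gate X x) + d (gate X x) y"
  using gate_is_gate is_gate_d by blast

lemma gate_le: "gated V E X \<Longrightarrow> x \<in> V \<Longrightarrow> y \<in> X \<Longrightarrow> d x (gate X x) \<le> d x y"
  using gate_d[of X x y] by linarith

lemma gate_eqI:
  assumes X: "gated V E X" "x \<in> V" "g \<in> X" "d x g \<le> d x (gate X x)"
  shows "gate X x = g"
proof -
  have "d (gate X x) g = 0" using gate_d[OF X(1,2,3)] X(4) by linarith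
  then show ?thesis using dist_eq_0 gate_V[OF X(1,2)] X gated_sub[OF X(1)] by blast
qed

lemma gate_self: "gated V E X \<Longrightarrow> x \<in> X \<Longrightarrow> gate X x = x"
  using gate_eqI[of X x x] gated_sub[of X] dist_self[of x] by auto

lemma gate_nonexp:
  assumes X: "gated V E X" and V: "x \<in> V" "y \<in> V"
  shows "d (gate X x) (gate X y) \<le> d x y"
proof -
  have g: "gate X x \<in> X" "gate X y \<in> X" "gate X x \<in> V" "gate X y \<in> V" using gate_in gate_V X V by auto
  show ?thesis
    using gate_d[OF X V(1) g(2)] gate_d[OF X V(2) g(1)] dist_triangle[OF V g(4)] dist_triangle[OF V(2,1) g(3)]
    by (simp add: dist_comm)
qed

lemma gate_gate:
  assumes X: "gated V E X" and A: "gated V E A" "A \<subseteq> X" and x: "x \<in> V"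
  shows "gate A (gate X x) = gate A x"
proof -
  have g: "gate X x \<in> V" "gate A x \<in> A" "gate A (gate X x) \<in> A" using gate_V gate_in X A x by auto
  have "d x (gate A (gate X x)) \<le> d x (gate A x)"
    using gate_d[OF X x, of "gate A (gate X x)"] gate_d[OF X x, of "gate A x"] gate_le[OF A(1) g(1,2)]
      subsetD[OF A(2) g(2)] subsetD[OF A(2) g(3)] by linarith
  then show ?thesis using gate_eqI[OF A(1) x g(3)] by simp
qed

lemma gate_Int:
  assumes X: "gated V E X" and Y: "gated V E Y" and x: "x \<in> Y" and ne: "X \<inter> Y \<noteq> {}"
  shows "gate X x \<in> Y"
proof -
  obtain z where z: "z \<in> X" "z \<in> Y" using ne by blast
  have xV: "x \<in> V" using x gated_sub[OF Y] by auto
  show ?thesis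
    using gated_convex[OF Y x z(2) gate_V[OF X xV]] gate_d[OF X xV z(1)] by simp
qed

lemma boundary_edge:
  assumes "conn_in Y" "X \<subseteq> Y" "X \<noteq> {}" "X \<noteq> Y"
  shows "\<exists>x\<in>X. \<exists>y\<in>Y. y \<notin> X \<and> E x y"
proof (rule ccontr)
  assume no: "\<not> ?thesis"
  obtain x where x: "x \<in> X" using assms by blast
  have "y \<in> X" if "y \<in> Y" for y
    using conn_in_induct[OF assms(1) _ that, of x "\<lambda>y. y \<in> X"] x assms no by blast
  then show False using assms by blast
qed

section \<open>Gap and mutual projections of two gated sets\<close>

definition gap :: "'a set \<Rightarrow> 'a set \<Rightarrow> nat" where
  "gap X Y = (LEAST n. \<exists>x\<in>X. \<exists>y\<in>Y. d x y = n)"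

lemma gap_le: "x \<in> X \<Longrightarrow> y \<in> Y \<Longrightarrow> gap X Y \<le> d x y"
  unfolding gap_def by (rule Least_le) blast

lemma gap_attained: "X \<noteq> {} \<Longrightarrow> Y \<noteq> {} \<Longrightarrow> \<exists>x\<in>X. \<exists>y\<in>Y. d x y = gap X Y"
  unfolding gap_def by (rule LeastI_ex) blast

lemma gap_commute: "gap X Y = gap Y X"
  unfolding gap_def using dist_comm by metis

text \<open>The projection of \<open>Y\<close> to \<open>X\<close>; \<open>core X Y\<close> and \<open>core Y X\<close> are parallel at distance \<open>gap X Y\<close>.\<close>

definition core :: "'a set \<Rightarrow> 'a set \<Rightarrow> 'a set" where
  "core X Y = {x \<in> X. d x (gate Y x) = gap X Y}"

context
  fixes X Y
  assumes X: "gated V E X" "X \<noteq> {}" and Y: "gated V E Y" "Y \<noteq> {}"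
begin

text \<open>Distances around the quadrilateral of \<open>y\<close>, its gate \<open>x\<close> and a
  closest pair \<open>x0\<close>, \<open>y0\<close> are split at the gates in both sets; adding them
  up shows that \<open>x\<close> and its gate \<open>y1\<close> are no farther apart than the
  closest pair.\<close>

lemma gate_gap:
  assumes y: "y \<in> Y"
  shows "d (gate X y) (gate Y (gate X y)) = gap X Y"
proof -
  obtain x0 y0 where 0: "x0 \<in> X" "y0 \<in> Y" "d x0 y0 = gap X Y" using gap_attained X Y by blast
  have V: "x0 \<in> V" "y0 \<in> V" "y \<in> V" using 0 y gated_sub X Y by auto
  define x where "x = gate X y"
  define y1 where "y1 = gate Y x"
  have x: "x \<in> X" "x \<in> V" using gate_in[OF X(1) V(3)] gate_V[OF X(1) V(3)] by (auto simp: x_def)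
  have y1: "y1 \<in> Y" "y1 \<in> V" using gate_in[OF Y(1) x(2)] gate_V[OF Y(1) x(2)] by (auto simp: y1_def)
  have gx: "gate X y0 = x0"
    using gate_eqI[OF X(1) V(2) 0(1)] gap_le[OF gate_in[OF X(1) V(2)] 0(2)] 0(3) by (simp add: dist_comm)
  have gy: "gate Y x0 = y0"
    using gate_eqI[OF Y(1) V(1) 0(2)] gap_le[OF 0(1) gate_in[OF Y(1) V(1)]] 0(3) by simp
  have "d y x0 = d y x + d x x0" using gate_d[OF X(1) V(3) 0(1)] by (simp add: x_def)
  moreover have "d x0 y = gap X Y + d y0 y" using gate_d[OF Y(1) V(1) y] gy 0(3) by simp
  moreover have "d y0 x = gap X Y + d x0 x" using gate_d[OF X(1) V(2) x(1)] gx 0(3) by (simp add: dist_comm)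
  moreover have "d x y0 = d x y1 + d y1 y0" using gate_d[OF Y(1) x(2) 0(2)] by (simp add: y1_def)
  moreover have "d x y = d x y1 + d y1 y" using gate_d[OF Y(1) x(2) y] by (simp add: y1_def)
  moreover have "d y y0 \<le> d y y1 + d y1 y0" using dist_triangle V y1 by blast
  moreover have "gap X Y \<le> d x y1" using gap_le x y1 by blast
  ultimately have "d x y1 = gap X Y" by (simp add: dist_comm)
  then show ?thesis by (simp add: x_def y1_def)
qed

lemma gate_in_core: "y \<in> Y \<Longrightarrow> gate X y \<in> core X Y"
  using gate_gap gate_in[OF X(1)] gated_sub[OF Y(1)] by (auto simp: core_def)

lemma core_gate_gate:
  assumes "x \<in> core X Y"
  shows "gate X (gate Y x) = x" "gate Y x \<in> Y" "d x (gate Y x) = gap X Y" "x \<in> X" "x \<in> V" "gate Y x \<in> V"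
proof -
  show x: "x \<in> X" "d x (gate Y x) = gap X Y" using assms by (auto simp: core_def)
  then show xV: "x \<in> V" using gated_sub[OF X(1)] by auto
  show y: "gate Y x \<in> Y" "gate Y x \<in> V" using gate_in[OF Y(1) xV] gate_V[OF Y(1) xV] by auto
  show "gate X (gate Y x) = x"
    using gate_eqI[OF X(1) y(2) x(1)] gap_le[OF gate_in[OF X(1) y(2)] y(1)] x by (simp add: dist_comm)
qed

lemma core_isometry:
  assumes x: "x \<in> core X Y" and x': "x' \<in> core X Y"
  shows "d (gate Y x) (gate Y x') = d x x'"
proof -
  note A = core_gate_gate[OF x] and B = core_gate_gate[OF x']
  show ?thesis
    using gate_nonexp[OF Y(1) A(5) B(5)] gate_nonexp[OF X(1) A(6) B(6)] A(1) B(1) by simp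
qed

text \<open>The round trip through \<open>Y\<close> projects \<open>X\<close> onto the core. The
  second equation reduces the distance from \<open>x\<close> to \<open>Y\<close> to the distance
  from \<open>x\<close> to the core, where ranks control it.\<close>

lemma core_gate:
  assumes x: "x \<in> X"
  shows "is_gate (core X Y) x (gate X (gate Y x))" "d x (gate Y x) = gap X Y + d x (gate X (gate Y x))"
proof -
  have xV: "x \<in> V" using x gated_sub X by auto
  define y where "y = gate Y x"
  define z where "z = gate X y"
  have y: "y \<in> Y" "y \<in> V" using gate_in[OF Y(1) xV] gate_V[OF Y(1) xV] by (auto simp: y_def)
  have zc: "z \<in> core X Y" using gate_in_core[OF y(1)] by (simp add: z_def)
  note Z = core_gate_gate[OF zc]
  have gap: "d y z = gap X Y"
  proof -
    have "d y x = d y z + d z x" using gate_d[OF X(1) y(2) x] by (simp add: z_def)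
    moreover have "d x (gate Y z) = d x y + d y (gate Y z)" using gate_d[OF Y(1) xV Z(2)] by (simp add: y_def)
    moreover have "d x (gate Y z) \<le> d x z + d z (gate Y z)" using dist_triangle xV Z by blast
    ultimately have "d y z \<le> gap X Y" using Z(3) by (simp add: dist_comm)
    then show ?thesis using gap_le[OF Z(4) y(1)] by (simp add: dist_comm)
  qed
  have yx: "d y x = gap X Y + d z x" using gate_d[OF X(1) y(2) x] gap by (simp add: z_def)
  then show "d x (gate Y x) = gap X Y + d x (gate X (gate Y x))" by (simp add: y_def z_def dist_comm)
  have gz: "gate Y z = y" using gate_eqI[OF Y(1) Z(5) y(1)] Z(3) gap by (simp add: dist_comm)
  have "d x x' = d x z + d z x'" if x': "x' \<in> core X Y" for x'
  proof -
    note B = core_gate_gate[OF x']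
    have "d (gate Y x') x = gap X Y + d x' x"
      using gate_d[OF X(1) B(6) x] B(1,3) by (simp add: dist_comm)
    moreover have "d x (gate Y x') = d x y + d y (gate Y x')" using gate_d[OF Y(1) xV B(2)] by (simp add: y_def)
    moreover have "d y (gate Y x') = d z x'" using core_isometry[OF zc x'] gz by simp
    ultimately show ?thesis using yx by (simp add: dist_comm)
  qed
  then show "is_gate (core X Y) x (gate X (gate Y x))"
    using zc unfolding is_gate_def y_def z_def by blast
qed

lemma core_nonempty: "core X Y \<noteq> {}"
  using gate_in_core Y(2) by blast

lemma core_subset: "core X Y \<subseteq> X"
  by (auto simp: core_def)

lemma core_gated: "gated V E (core X Y)"
  unfolding gated_iff
proof (intro conjI ballI)
  show "core X Y \<subseteq> V" using core_subset gated_sub X by blast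
  fix v assume v: "v \<in> V"
  define g where "g = gate X v"
  define z where "z = gate X (gate Y g)"
  have g: "g \<in> X" using gate_in[OF X(1) v] by (simp add: g_def)
  have z: "is_gate (core X Y) g z" using core_gate(1)[OF g] by (simp add: z_def)
  have zX: "z \<in> X" using is_gate_in[OF z] core_subset by blast
  have "d v x = d v z + d z x" if x: "x \<in> core X Y" for x
    using gate_d[OF X(1) v zX] gate_d[OF X(1) v, of x] is_gate_d[OF z x] x core_subset
    by (auto simp: g_def)
  then show "\<exists>g. is_gate (core X Y) v g" using is_gate_in[OF z] unfolding is_gate_def by blast
qed

lemma core_dist: "x \<in> X \<Longrightarrow> d x (gate Y x) = gap X Y + d x (gate (core X Y) x)"
proof -
  assume x: "x \<in> X"
  have xV: "x \<in> V" using x gated_sub X by auto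
  have "d x (gate X (gate Y x)) \<le> d x (gate (core X Y) x)"
    using is_gate_d[OF core_gate(1)[OF x] gate_in[OF core_gated xV]] by simp
  then have "gate (core X Y) x = gate X (gate Y x)"
    using gate_eqI[OF core_gated xV is_gate_in[OF core_gate(1)[OF x]]] by simp
  then show ?thesis using core_gate(2)[OF x] by simp
qed

end

end

section \<open>Members of B(G) and their rank\<close>

locale swm_nonempty = swm +
  assumes nonempty: "V \<noteq> {}"
begin

lemma thick_iff:
  assumes X: "gated V E X"
  shows "thick X (induced_adj E X) \<longleftrightarrow> (\<forall>q\<in>X. thick_at X q)"
proof
  let ?E = "induced_adj E X"
  have dd: "gdist X ?E u v = d u v" if "u \<in> X" "v \<in> X" for u v
    using gated_induced_dist[OF X that] .
  have XV: "x \<in> V" if "x \<in> X" for x using gated_sub[OF X] that by auto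
  {
    assume th: "thick X ?E"
    show "\<forall>q\<in>X. thick_at X q"
      unfolding thick_at_def
    proof (intro ballI impI)
      fix q a b assume a: "q \<in> X" "a \<in> X" "b \<in> X" "E q a" "E q b" "a \<noteq> b" "\<not> E a b"
      have ab: "d a b = 2" using dist_2I[OF adj_sym[OF a(4)] a(5)] a by simp
      then have "gdist X ?E a b = 2" using dd[OF a(2,3)] by simp
      then have "\<exists>x1\<in>interval X ?E a b. \<exists>x2\<in>interval X ?E a b. \<exists>x3\<in>interval X ?E a b.
          \<exists>x4\<in>interval X ?E a b. induced_4cycle ?E x1 x2 x3 x4"
        using th[unfolded thick_def, rule_format, OF a(2,3)] by simp
      then obtain x1 x2 x3 x4 where x: "x1 \<in> interval X ?E a b" "x2 \<in> interval X ?E a b"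
        "x3 \<in> interval X ?E a b" "x4 \<in> interval X ?E a b" "induced_4cycle ?E x1 x2 x3 x4"
        by (elim bexE) blast
      have I: "x = a \<or> x = b \<or> (E x a \<and> E x b)" if "x \<in> interval X ?E a b" for x
      proof -
        have xX: "x \<in> X" and s: "d a x + d x b = 2"
          using that dd a ab unfolding interval_def by auto
        then consider "d a x = 0" | "d x b = 0" | "d a x = Suc 0" "d x b = Suc 0" by linarith
        then show ?thesis
          using dist_eq_0[OF XV[OF a(2)] XV[OF xX]] dist_eq_0[OF XV[OF xX] XV[OF a(3)]]
            dist_eq_1[OF XV[OF a(2)] XV[OF xX]] dist_eq_1[OF XV[OF xX] XV[OF a(3)]] adj_sym
          by cases auto
      qed
      \<comment> \<open>The interval consists of \<open>a\<close>, \<open>b\<close> and common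
        neighbours of theirs, so a 4-cycle in it contains a common neighbour other than
        \<open>q\<close>.\<close>
      show "square q a b"
      proof (rule ccontr)
        assume "\<not> square q a b"
        then have "{x1, x2, x3, x4} \<subseteq> {a, b, q}" using I x unfolding square_def by blast
        then have "card {x1, x2, x3, x4} \<le> card {a, b, q}" by (intro card_mono) auto
        moreover have "card {x1, x2, x3, x4} = 4" using x(5) by (auto simp: induced_4cycle_def)
        moreover have "card {a, b, q} \<le> 3" by (simp add: card_insert_if)
        ultimately show False by simp
      qed
    qed
  }
  {
    assume th: "\<forall>q\<in>X. thick_at X q"
    show "thick X ?E"
      unfolding thick_def
    proof (intro ballI impI)
      fix u v assume uv: "u \<in> X" "v \<in> X" "gdist X ?E u v = 2"
      then have duv: "d u v = Suc (Suc 0)" using dd by simp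
      obtain m where m: "E v m" "d u m = Suc 0" using dist_pred[OF XV[OF uv(1)] XV[OF uv(2)] duv] by blast
      have um: "E u m" using dist_eq_1[OF XV[OF uv(1)] adj_V(2)[OF m(1)]] m by simp
      have ne: "u \<noteq> v" "\<not> E u v" using duv XV uv dist_adj by auto
      note cl = gated_nbr_closed[OF X]
      have mX: "m \<in> X" using nbr_closedD[OF cl uv(1,2) um adj_sym[OF m(1)] ne(1)] .
      then obtain r where r: "r \<noteq> m" "E r u" "E r v"
        using thick_atD[of X m u v] th uv um m adj_sym ne unfolding square_def by blast
      have rX: "r \<in> X" using nbr_closedD[OF cl uv(1,2) adj_sym[OF r(2)] r(3) ne(1)] .
      have nmr: "\<not> E m r" using no_K4_minus[of m r u v] um m(1) r ne adj_sym by blast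
      have c4: "induced_4cycle ?E u m v r"
        unfolding induced_4cycle_def induced_adj_def
        using uv mX rX r um m(1) ne nmr adj_sym adj_irrefl by auto
      have dr: "d u r = Suc 0" "d r v = Suc 0" "d m v = Suc 0" using dist_adj r m adj_sym by auto
      have "u \<in> interval X ?E u v" "m \<in> interval X ?E u v" "v \<in> interval X ?E u v" "r \<in> interval X ?E u v"
        using uv mX rX dd XV duv dr m unfolding interval_def by auto
      then show "\<exists>x1\<in>interval X ?E u v. \<exists>x2\<in>interval X ?E u v. \<exists>x3\<in>interval X ?E u v.
          \<exists>x4\<in>interval X ?E u v. induced_4cycle ?E x1 x2 x3 x4"
        using c4 by blast
    qed
  }
qed

abbreviation "\<B> \<equiv> BG V E"

text \<open>A vertex farthest from \<open>p\<close> is opposite to \<open>p\<close>; conversely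
  \<open>opposite_diameter\<close> bounds the diameter of a hull. As \<open>V\<close> is nonempty,
  so is every gated set.\<close>

lemma BG_iff: "X \<in> \<B> \<longleftrightarrow> (\<exists>p q. opposite X p q)"
proof
  assume "X \<in> \<B>"
  then have X: "gated V E X" "thick X (induced_adj E X)" "finite_diameter V E X"
    by (auto simp: BG_def boolean_gated_def)
  obtain v where "v \<in> V" using nonempty by blast
  then obtain p where p: "p \<in> X" using gate_ex[OF X(1)] is_gate_in by blast
  have T: "thick_gated X" using X thick_iff p unfolding thick_gated_def by blast
  obtain D where D: "\<And>x y. x \<in> X \<Longrightarrow> y \<in> X \<Longrightarrow> d x y \<le> D" using X(3) unfolding finite_diameter_def by blast
  obtain q where q: "q \<in> X" "\<And>s. s \<in> X \<Longrightarrow> d s p \<le> d q p"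
    using ex_has_greatest_nat[of "\<lambda>q. q \<in> X" p "\<lambda>q. d q p" "Suc D"] p D by (metis less_Suc_eq_le)
  have "opposite X q p" using oppositeI[OF T q(1) p] q(2) by blast
  then show "\<exists>p q. opposite X p q" by blast
next
  assume "\<exists>p q. opposite X p q"
  then obtain p q where o: "opposite X p q" by blast
  have "finite_diameter V E X" unfolding finite_diameter_def using opposite_diameter[OF o] by blast
  moreover have "thick X (induced_adj E X)"
    using thick_iff oppositeD(1)[OF o] unfolding thick_gated_def by blast
  ultimately show "X \<in> \<B>" using oppositeD(6)[OF o] by (simp add: BG_def boolean_gated_def)
qed

text \<open>The diameter; it is the rank function of the poset.\<close>

definition rank :: "'a set \<Rightarrow> nat" where
  "rank X = (SOME k. \<exists>p q. opposite X p q \<and> d p q = k)"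

lemma rank_opposite: "opposite X p q \<Longrightarrow> rank X = d p q"
proof -
  assume o: "opposite X p q"
  then have "\<exists>p q. opposite X p q \<and> d p q = rank X"
    unfolding rank_def by (intro someI_ex[of "\<lambda>k. \<exists>p q. opposite X p q \<and> d p q = k"]) blast
  then obtain p' q' where o': "opposite X p' q'" "d p' q' = rank X" by blast
  show ?thesis
    using opposite_diameter[OF o oppositeD(2,3)[OF o'(1)]] opposite_diameter[OF o'(1) oppositeD(2,3)[OF o]] o' by simp
qed

lemma BG_D:
  assumes "X \<in> \<B>"
  shows "thick_gated X" "gated V E X" "X \<noteq> {}" "X \<subseteq> V" "nbr_closed X" "conn_in X"
proof -
  obtain p q where "opposite X p q" using assms BG_iff by blast
  then show T: "thick_gated X" by (rule oppositeD)
  show "gated V E X" "X \<noteq> {}" "X \<subseteq> V" "nbr_closed X" "conn_in X" using thick_gatedD[OF T] by auto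
qed

lemma rank_ge: "X \<in> \<B> \<Longrightarrow> x \<in> X \<Longrightarrow> y \<in> X \<Longrightarrow> d x y \<le> rank X"
  using BG_iff opposite_diameter rank_opposite by metis

lemma rank_antipode: "X \<in> \<B> \<Longrightarrow> p \<in> X \<Longrightarrow> \<exists>q\<in>X. d p q = rank X"
  using BG_iff opposite_everywhere rank_opposite oppositeD(3) by metis

lemma opposite_rank: "X \<in> \<B> \<Longrightarrow> p \<in> X \<Longrightarrow> q \<in> X \<Longrightarrow> d p q = rank X \<Longrightarrow> opposite X p q"
  using oppositeI[OF BG_D(1)] rank_ge by metis

lemma BG_subset:
  assumes "X \<in> \<B>" "gated V E A" "A \<noteq> {}" "A \<subseteq> X"
  shows "A \<in> \<B>"
proof -
  have "thick_gated A" using thick_gated_subset[OF BG_D(1)[OF assms(1)] assms(2-4)] .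
  then have "thick A (induced_adj E A)" using thick_iff[OF assms(2)] by (simp add: thick_gated_def)
  moreover have "finite_diameter V E A"
    unfolding finite_diameter_def using rank_ge[OF assms(1)] assms(4) by blast
  ultimately show ?thesis using assms(2) by (simp add: BG_def boolean_gated_def)
qed

lemma BG_Int: "X \<in> \<B> \<Longrightarrow> Y \<in> \<B> \<Longrightarrow> X \<inter> Y \<noteq> {} \<Longrightarrow> X \<inter> Y \<in> \<B>"
  using BG_subset[of X "X \<inter> Y"] gated_Int BG_D(2) by blast

text \<open>Continue from \<open>y\<close> through its gate to an antipode of the gate in
  \<open>X\<close>.\<close>

lemma rank_gate:
  assumes X: "X \<in> \<B>" "Y \<in> \<B>" "X \<subseteq> Y" "y \<in> Y"
  shows "d y (gate X y) + rank X \<le> rank Y"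
proof -
  have yV: "y \<in> V" using X BG_D by blast
  obtain x where x: "x \<in> X" "d (gate X y) x = rank X"
    using rank_antipode[OF X(1) gate_in[OF BG_D(2)[OF X(1)] yV]] by blast
  then show ?thesis using gate_d[OF BG_D(2)[OF X(1)] yV x(1)] rank_ge[OF X(2,4), of x] X by auto
qed

lemma rank_far:
  assumes X: "X \<in> \<B>" "Y \<in> \<B>" "X \<subseteq> Y"
  shows "\<exists>y\<in>Y. d y (gate X y) + rank X = rank Y"
proof -
  obtain x where x: "x \<in> X" using BG_D[OF X(1)] by blast
  obtain y where y: "y \<in> Y" "d x y = rank Y" using rank_antipode[OF X(2)] x X by blast
  have yV: "y \<in> V" using y X BG_D by blast
  have "d y x = d y (gate X y) + d (gate X y) x" using gate_d[OF BG_D(2)[OF X(1)] yV x] .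
  moreover have "d (gate X y) x \<le> rank X" using rank_ge[OF X(1) gate_in[OF BG_D(2)[OF X(1)] yV] x] .
  ultimately show ?thesis using rank_gate[OF X y(1)] y by (intro bexI[of _ y]) (auto simp: dist_comm)
qed

lemma rank_strict:
  assumes X: "X \<in> \<B>" "Y \<in> \<B>" "X \<subset> Y"
  shows "rank X < rank Y"
proof -
  obtain y where y: "y \<in> Y" "y \<notin> X" using X by blast
  have yV: "y \<in> V" using y X BG_D by blast
  have "gate X y \<noteq> y" using gate_in[OF BG_D(2)[OF X(1)] yV] y by auto
  then have "d y (gate X y) \<noteq> 0" using dist_eq_0 yV gate_V[OF BG_D(2)[OF X(1)] yV] by metis
  then show ?thesis using rank_gate[OF X(1,2) _ y(1)] X by auto
qed

lemma rank_mono: "X \<in> \<B> \<Longrightarrow> Y \<in> \<B> \<Longrightarrow> X \<subseteq> Y \<Longrightarrow> rank X \<le> rank Y"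
  using rank_strict by (metis less_imp_le order_refl psubsetI)

lemma rank_eq: "X \<in> \<B> \<Longrightarrow> Y \<in> \<B> \<Longrightarrow> X \<subseteq> Y \<Longrightarrow> rank Y \<le> rank X \<Longrightarrow> X = Y"
  using rank_strict by (metis not_less psubsetI)

lemma outside_gate:
  assumes X: "gated V E X" and x: "x \<in> X" "E x y" "y \<notin> X"
  shows "gate X y = x" "\<And>z. z \<in> X \<Longrightarrow> d y z = Suc (d x z)"
proof -
  have V: "x \<in> V" "y \<in> V" using x adj_V by auto
  have "gate X y \<noteq> y" using gate_in[OF X V(2)] x by auto
  then have "d y (gate X y) \<noteq> 0" using dist_eq_0 V gate_V[OF X V(2)] by metis
  then show g: "gate X y = x" using gate_eqI[OF X V(2) x(1)] dist_adj[OF adj_sym[OF x(2)]] by simp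
  show "d y z = Suc (d x z)" if "z \<in> X" for z
    using gate_d[OF X V(2) that] g dist_adj[OF adj_sym[OF x(2)]] by simp
qed

text \<open>A thick gated set with \<open>a\<close> and \<open>y\<close> contains \<open>x\<close>
  by convexity, and then all of \<open>X\<close> since \<open>a\<close> is opposite to
  \<open>x\<close> in \<open>X\<close>. The rank is \<open>d a y\<close>, one more than
  \<open>d a x\<close>.\<close>

lemma bhull_extend:
  assumes X: "X \<in> \<B>" and x: "x \<in> X" "E x y" "y \<notin> X" and a: "a \<in> X" "d x a = rank X" "boolean a y"
  shows "bhull a y \<in> \<B>" "rank (bhull a y) = Suc (rank X)" "X \<subseteq> bhull a y" "y \<in> bhull a y" "opposite (bhull a y) a y"
proof -
  show o: "opposite (bhull a y) a y" using a by (simp add: opposite_def)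
  then show "bhull a y \<in> \<B>" using BG_iff by blast
  have h: "d y a = Suc (rank X)" using outside_gate(2)[OF BG_D(2)[OF X] x a(1)] a by simp
  then show "rank (bhull a y) = Suc (rank X)" using rank_opposite[OF o] by (simp add: dist_comm)
  show y: "y \<in> bhull a y" using oppositeD(3)[OF o] .
  have "x \<in> bhull a y"
    using gated_convex[OF oppositeD(6,2,3)[OF o], of x] h a(2) dist_adj[OF x(2)] adj_V(1)[OF x(2)] by (simp add: dist_comm)
  then show "X \<subseteq> bhull a y"
    using opposite_least[OF opposite_rank[OF X x(1) a(1,2)] oppositeD(1)[OF o]] oppositeD(2)[OF o] by blast
qed

lemma cover_through:
  assumes X: "X \<in> \<B>" "Y \<in> \<B>" "X \<subseteq> Y" and x: "x \<in> X" "E x y" "y \<notin> X" "y \<in> Y"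
  shows "\<exists>Z\<in>\<B>. X \<subset> Z \<and> y \<in> Z \<and> Z \<subseteq> Y \<and> rank Z = Suc (rank X)"
proof -
  obtain a where a: "a \<in> X" "d x a = rank X" using rank_antipode[OF X(1) x(1)] by blast
  have aY: "a \<in> Y" using a X by auto
  have b: "boolean a y" using thick_gated_boolean[OF BG_D(1)[OF X(2)] aY x(4)] .
  note Z = bhull_extend[OF X(1) x(1-3) a b]
  have "bhull a y \<subseteq> Y" using opposite_least[OF Z(5) BG_D(1)[OF X(2)] aY x(4)] .
  then show ?thesis using Z x(3) by blast
qed

lemma rank_Suc_ex:
  assumes X: "X \<in> \<B>" "Y \<in> \<B>" "X \<subset> Y"
  shows "\<exists>Z\<in>\<B>. X \<subset> Z \<and> Z \<subseteq> Y \<and> rank Z = Suc (rank X)"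
proof -
  obtain x y where "x \<in> X" "y \<in> Y" "y \<notin> X" "E x y"
    using boundary_edge[OF BG_D(6)[OF X(2)] _ BG_D(3)[OF X(1)]] X by blast
  then show ?thesis using cover_through[OF X(1,2), of x y] X by blast
qed

text \<open>Between two nested members \<open>rank_Suc_ex\<close> finds one whose rank exceeds the
  smaller rank by exactly 1; for a covering pair it must be the larger member.\<close>

lemma hasse_iff: "hasse_orient V E X Y \<longleftrightarrow> X \<in> \<B> \<and> Y \<in> \<B> \<and> X \<subset> Y \<and> rank Y = Suc (rank X)"
proof
  assume h: "hasse_orient V E X Y"
  then have XY: "X \<in> \<B>" "Y \<in> \<B>" "X \<subset> Y" by (auto simp: hasse_orient_def)
  obtain Z where "Z \<in> \<B>" "X \<subset> Z" "Z \<subseteq> Y" "rank Z = Suc (rank X)" using rank_Suc_ex[OF XY] by blast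
  moreover have "Z = Y" using h calculation unfolding hasse_orient_def by blast
  ultimately show "X \<in> \<B> \<and> Y \<in> \<B> \<and> X \<subset> Y \<and> rank Y = Suc (rank X)" using XY by simp
next
  assume a: "X \<in> \<B> \<and> Y \<in> \<B> \<and> X \<subset> Y \<and> rank Y = Suc (rank X)"
  have "\<not> (X \<subset> Z \<and> Z \<subset> Y)" if "Z \<in> \<B>" for Z
    using rank_strict[of X Z] rank_strict[of Z Y] a that by (metis Suc_leI not_le)
  then show "hasse_orient V E X Y" using a by (auto simp: hasse_orient_def)
qed

lemma lower_cover:
  assumes X: "X \<in> \<B>" "Y \<in> \<B>" "X \<subset> Y"
  shows "\<exists>Z\<in>\<B>. X \<subseteq> Z \<and> hasse_orient V E Z Y"
  using X
proof (induction "rank Y - rank X" arbitrary: X rule: less_induct)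
  case less
  obtain Z where Z: "Z \<in> \<B>" "X \<subset> Z" "Z \<subseteq> Y" "rank Z = Suc (rank X)" using rank_Suc_ex[OF less(2-4)] by blast
  show ?case
  proof (cases "Z = Y")
    case True
    then have "hasse_orient V E X Y" using Z less hasse_iff by blast
    then show ?thesis using less(2) by blast
  next
    case False
    then have "Z \<subset> Y" using Z by blast
    moreover have "rank Y - rank Z < rank Y - rank X" using Z rank_strict[OF less(2-4)] by simp
    ultimately show ?thesis using less(1)[of Z] Z less(3) by blast
  qed
qed

end

section \<open>The barycentric graph\<close>

context conn_graph begin

text \<open>If the first step \<open>v z\<close> of a geodesic to \<open>w\<close> leads away from
  \<open>u\<close>, induction for \<open>z\<close> and \<open>w\<close> descends at \<open>w\<close>
  or at \<open>z\<close>. In the latter case the geodesic has a local maximum of the distance from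
  \<open>u\<close> at \<open>z\<close>, which the quadrangle condition replaces by a vertex
  below.\<close>

lemma bipartite_descent:
  assumes bip: "\<And>x y p. E x y \<Longrightarrow> p \<in> V \<Longrightarrow> d p x \<noteq> d p y"
    and quad: "\<And>u v w z. u \<in> V \<Longrightarrow> E z v \<Longrightarrow> E z w \<Longrightarrow> v \<noteq> w \<Longrightarrow> d u v = d u w \<Longrightarrow>
      d u z = Suc (d u v) \<Longrightarrow> \<exists>x. E x v \<and> E x w \<and> Suc (d u x) = d u v"
    and V: "u \<in> V" "v \<in> V" "w \<in> V" "v \<noteq> w"
  shows "(\<exists>z. E v z \<and> Suc (d z w) = d v w \<and> Suc (d u z) = d u v) \<or>
         (\<exists>z. E w z \<and> Suc (d v z) = d v w \<and> Suc (d u z) = d u w)"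
  using V
proof (induction "d v w" arbitrary: v)
  case 0
  then show ?case using dist_eq_0 by metis
next
  case (Suc n)
  obtain z where z: "E v z" "d w z = n" using dist_pred[OF Suc(5,4)] Suc(2) by (metis dist_comm)
  have zV: "z \<in> V" using z adj_V by auto
  have hz: "Suc (d z w) = d v w" using z Suc(2) by (simp add: dist_comm)
  have alt: "Suc (d u z) = d u v \<or> d u z = Suc (d u v)"
    using adj_dist_le[OF z(1) Suc(3)] bip[OF z(1) Suc(3)] by linarith
  show ?case
  proof (cases "Suc (d u z) = d u v")
    case True
    then show ?thesis using z hz by blast
  next
    case False
    then have up: "d u z = Suc (d u v)" using alt by blast
    show ?thesis
    proof (cases "z = w")
      case True
      then show ?thesis using z(1) up adj_sym dist_self[OF Suc(4)] hz by (metis dist_comm dist_self zV)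
    next
      case False
      from Suc(1)[OF _ Suc(3) zV Suc(5) False] z(2)
      have "(\<exists>y. E z y \<and> Suc (d y w) = d z w \<and> Suc (d u y) = d u z) \<or>
         (\<exists>y. E w y \<and> Suc (d z y) = d z w \<and> Suc (d u y) = d u w)" by (simp add: dist_comm)
      then show ?thesis
      proof (elim disjE exE conjE)
        fix y assume y: "E z y" "Suc (d y w) = d z w" "Suc (d u y) = d u z"
        have "v \<noteq> y" using y hz by auto
        then obtain x where x: "E x v" "E x y" "Suc (d u x) = d u v"
          using quad[OF Suc(3) adj_sym[OF z(1)] y(1)] up y by auto
        have "Suc (d x w) = d v w"
          using adj_dist_le[OF x(1) Suc(5)] adj_dist_le[OF x(2) Suc(5)] y hz by (simp add: dist_comm)
        then show ?thesis using x adj_sym by blast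
      next
        fix y assume y: "E w y" "Suc (d z y) = d z w" "Suc (d u y) = d u w"
        have yV: "y \<in> V" using y adj_V by auto
        have "Suc (d v y) = d v w"
          using adj_dist_le[OF z(1) yV] adj_dist_le[OF y(1) Suc(4)] y hz by (simp add: dist_comm)
        then show ?thesis using y by blast
      qed
    qed
  qed
qed

text \<open>Induction on the perimeter: \<open>bipartite_descent\<close> moves \<open>v\<close> or
  \<open>w\<close> one step closer to both other vertices, and a median of the smaller triple is a
  median of the given one.\<close>

lemma bipartite_modular:
  assumes bip: "\<And>x y p. E x y \<Longrightarrow> p \<in> V \<Longrightarrow> d p x \<noteq> d p y"
    and quad: "\<And>u v w z. u \<in> V \<Longrightarrow> E z v \<Longrightarrow> E z w \<Longrightarrow> v \<noteq> w \<Longrightarrow> d u v = d u w \<Longrightarrow>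
      d u z = Suc (d u v) \<Longrightarrow> \<exists>x. E x v \<and> E x w \<and> Suc (d u x) = d u v"
  shows "modular_graph V E"
proof -
  have med: "\<exists>m\<in>V. d u m + d m v = d u v \<and> d v m + d m w = d v w \<and> d w m + d m u = d w u"
    if "u \<in> V" "v \<in> V" "w \<in> V" for u v w
    using that
  proof (induction "d u v + d v w + d w u" arbitrary: v w rule: less_induct)
    case less
    show ?case
    proof (cases "v = w")
      case True
      then show ?thesis using less by (intro bexI[of _ v]) (auto simp: dist_comm)
    next
      case False
      have "(\<exists>z. E v z \<and> Suc (d z w) = d v w \<and> Suc (d u z) = d u v) \<or>
         (\<exists>z. E w z \<and> Suc (d v z) = d v w \<and> Suc (d u z) = d u w)"
      proof (rule bipartite_descent[OF _ _ less(2-4) False])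
        show "d p x \<noteq> d p y" if "E x y" "p \<in> V" for x y p using bip that by blast
        show "\<exists>x. E x v \<and> E x w \<and> Suc (d u x) = d u v"
          if "u \<in> V" "E z v" "E z w" "v \<noteq> w" "d u v = d u w" "d u z = Suc (d u v)" for u v w z
          using quad that by blast
      qed
      then show ?thesis
      proof (elim disjE exE conjE)
        fix z assume z: "E v z" "Suc (d z w) = d v w" "Suc (d u z) = d u v"
        have zV: "z \<in> V" using z adj_V by auto
        have "d u z + d z w + d w u < d u v + d v w + d w u" using z by simp
        then obtain m where m: "m \<in> V" "d u m + d m z = d u z" "d z m + d m w = d z w" "d w m + d m u = d w u"
          using less(1)[OF _ less(2) zV less(4)] by blast
        have "d m v \<le> Suc (d m z)" using adj_dist_le[OF z(1) m(1)] by simp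
        then have "d u m + d m v = d u v" "d v m + d m w = d v w"
          using m z dist_triangle[OF less(2) m(1) less(3)] dist_triangle[OF less(3) m(1) less(4)]
          by (simp_all add: dist_comm)
        then show ?thesis using m by blast
      next
        fix z assume z: "E w z" "Suc (d v z) = d v w" "Suc (d u z) = d u w"
        have zV: "z \<in> V" using z adj_V by auto
        have "d u v + d v z + d z u < d u v + d v w + d w u" using z by (simp add: dist_comm)
        then obtain m where m: "m \<in> V" "d u m + d m v = d u v" "d v m + d m z = d v z" "d z m + d m u = d z u"
          using less(1)[OF _ less(2,3) zV] by blast
        have "d m w \<le> Suc (d m z)" using adj_dist_le[OF z(1) m(1)] by simp
        then have "d v m + d m w = d v w" "d w m + d m u = d w u"
          using m z dist_triangle[OF less(3) m(1) less(4)] dist_triangle[OF less(4) m(1) less(2)]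
          by (simp_all add: dist_comm)
        then show ?thesis using m by blast
      qed
    qed
  qed
  have "interval V E u v \<inter> interval V E v w \<inter> interval V E w u \<noteq> {}"
    if "u \<in> V" "v \<in> V" "w \<in> V" for u v w
    using med[OF that] unfolding interval_def by blast
  then show ?thesis unfolding modular_graph_def using connected by blast
qed

end

section \<open>The Hausdorff distance between Boolean-gated sets\<close>

context swm_nonempty begin

lemma core_BG: "X \<in> \<B> \<Longrightarrow> Y \<in> \<B> \<Longrightarrow> core X Y \<in> \<B>"
  using BG_subset core_gated core_nonempty core_subset BG_D(2,3) by meson

lemma rank_core_le: "X \<in> \<B> \<Longrightarrow> Y \<in> \<B> \<Longrightarrow> rank (core X Y) \<le> rank X"
  using rank_mono core_BG core_subset BG_D(2,3) by meson

text \<open>The gate map of \<open>Y\<close> embeds \<open>core X Y\<close> isometrically into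
  \<open>core Y X\<close>, so an antipodal pair of the first bounds the rank of the second.\<close>

lemma rank_core_commute:
  assumes X: "X \<in> \<B>" "Y \<in> \<B>"
  shows "rank (core X Y) = rank (core Y X)"
proof -
  have "rank (core X Y) \<le> rank (core Y X)" if X: "X \<in> \<B>" "Y \<in> \<B>" for X Y
  proof -
    note G = BG_D(2,3)[OF X(1)] BG_D(2,3)[OF X(2)]
    note C = core_BG[OF X] core_BG[OF X(2,1)]
    obtain p where p: "p \<in> core X Y" using BG_D(3)[OF C(1)] by blast
    obtain q where q: "q \<in> core X Y" "d p q = rank (core X Y)" using rank_antipode[OF C(1) p] by blast
    have "gate Y p \<in> core Y X" "gate Y q \<in> core Y X"
      using gate_in_core[OF G(3,4,1,2)] p q core_subset[OF G] by blast+
    then have "d (gate Y p) (gate Y q) \<le> rank (core Y X)" by (rule rank_ge[OF C(2)])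
    then show ?thesis using core_isometry[OF G p q(1)] q(2) by simp
  qed
  then show ?thesis using X by (meson le_antisym)
qed

text \<open>The directed Hausdorff distance from \<open>X\<close> to \<open>Y\<close>, see \<open>ecc_ge\<close> and \<open>ecc_attained\<close>; the
  subtraction does not truncate on \<open>\<B>\<close>.\<close>

definition ecc :: "'a set \<Rightarrow> 'a set \<Rightarrow> nat" where
  "ecc X Y = gap X Y + (rank X - rank (core X Y))"

lemma ecc_ge:
  assumes X: "X \<in> \<B>" "Y \<in> \<B>" "x \<in> X"
  shows "d x (gate Y x) \<le> ecc X Y"
proof -
  note G = BG_D(2,3)[OF X(1)] BG_D(2,3)[OF X(2)]
  show ?thesis
    using core_dist[OF G X(3)] rank_gate[OF core_BG[OF X(1,2)] X(1) core_subset[OF G] X(3)]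
    unfolding ecc_def by simp
qed

lemma ecc_attained:
  assumes X: "X \<in> \<B>" "Y \<in> \<B>"
  shows "\<exists>x\<in>X. d x (gate Y x) = ecc X Y"
proof -
  note G = BG_D(2,3)[OF X(1)] BG_D(2,3)[OF X(2)]
  obtain x where x: "x \<in> X" "d x (gate (core X Y) x) + rank (core X Y) = rank X"
    using rank_far[OF core_BG[OF X] X(1) core_subset[OF G]] by blast
  then show ?thesis using core_dist[OF G x(1)] unfolding ecc_def by (intro bexI[of _ x]) simp_all
qed

definition hdist :: "'a set \<Rightarrow> 'a set \<Rightarrow> nat" where
  "hdist X Y = ecc X Y + ecc Y X"

lemma hdist_commute: "hdist X Y = hdist Y X"
  by (simp add: hdist_def)

lemma hdist_formula:
  "X \<in> \<B> \<Longrightarrow> Y \<in> \<B> \<Longrightarrow> hdist X Y + 2 * rank (core X Y) = 2 * gap X Y + rank X + rank Y"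
  using rank_core_commute[of X Y] rank_core_le[of X Y] rank_core_le[of Y X] gap_commute[of Y X]
  by (simp add: hdist_def ecc_def)

lemma ecc_triangle:
  assumes X: "X \<in> \<B>" "Y \<in> \<B>" "W \<in> \<B>"
  shows "ecc X W \<le> ecc X Y + ecc Y W"
proof -
  obtain x where x: "x \<in> X" "d x (gate W x) = ecc X W" using ecc_attained[OF X(1,3)] by blast
  have xV: "x \<in> V" using x X BG_D by blast
  note y = gate_in[OF BG_D(2)[OF X(2)] xV] gate_V[OF BG_D(2)[OF X(2)] xV]
  note w = gate_in[OF BG_D(2)[OF X(3)] y(2)] gate_V[OF BG_D(2)[OF X(3)] y(2)]
  have "d x (gate W x) \<le> d x (gate W (gate Y x))" using gate_le[OF BG_D(2)[OF X(3)] xV w(1)] .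
  also have "\<dots> \<le> d x (gate Y x) + d (gate Y x) (gate W (gate Y x))" using dist_triangle[OF xV y(2) w(2)] .
  also have "\<dots> \<le> ecc X Y + ecc Y W" using ecc_ge[OF X(1,2) x(1)] ecc_ge[OF X(2,3) y(1)] by simp
  finally show ?thesis using x by simp
qed

lemma ecc_subset: "X \<in> \<B> \<Longrightarrow> Y \<in> \<B> \<Longrightarrow> X \<subseteq> Y \<Longrightarrow> ecc X Y = 0"
proof -
  assume a: "X \<in> \<B>" "Y \<in> \<B>" "X \<subseteq> Y"
  obtain x where x: "x \<in> X" "d x (gate Y x) = ecc X Y" using ecc_attained[OF a(1,2)] by blast
  then show ?thesis using gate_self[OF BG_D(2)[OF a(2)]] dist_self BG_D(4)[OF a(1)] a(3) by (metis subsetD)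
qed

lemma ecc_superset: "X \<in> \<B> \<Longrightarrow> Y \<in> \<B> \<Longrightarrow> X \<subseteq> Y \<Longrightarrow> ecc Y X + rank X \<le> rank Y"
  using ecc_attained[of Y X] rank_gate[of X Y] by metis

lemma hasseD:
  assumes "hasse_orient V E X Y"
  shows "X \<in> \<B>" "Y \<in> \<B>" "X \<subset> Y" "rank Y = Suc (rank X)" "X \<subseteq> Y"
  using assms hasse_iff by auto

lemma adj_BG: "bary_adj V E X Y \<Longrightarrow> X \<in> \<B> \<and> Y \<in> \<B>"
  unfolding bary_adj_def using hasseD by blast

lemma hdist_adj:
  assumes "bary_adj V E Y Z"
  shows "hdist Y Z \<le> 1"
proof -
  have "hdist X Z \<le> 1" if h: "hasse_orient V E X Z" for X Z
    using ecc_subset[OF hasseD(1,2,5)[OF h]] ecc_superset[OF hasseD(1,2,5)[OF h]] hasseD(4)[OF h]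
    by (simp add: hdist_def)
  then show ?thesis using assms hdist_commute unfolding bary_adj_def by metis
qed

lemma hdist_lip:
  assumes X: "X \<in> \<B>" and YZ: "bary_adj V E Y Z"
  shows "hdist X Z \<le> Suc (hdist X Y)"
proof -
  have B: "Y \<in> \<B>" "Z \<in> \<B>" using adj_BG YZ by auto
  show ?thesis
    using ecc_triangle[OF X B] ecc_triangle[OF B(2,1) X] hdist_adj[OF YZ] unfolding hdist_def by simp
qed

text \<open>By \<open>hdist_formula\<close> the distance has the parity of the sum of the ranks, and
  the ranks of adjacent sets differ by 1.\<close>

lemma hdist_parity:
  assumes X: "X \<in> \<B>" and YZ: "bary_adj V E Y Z"
  shows "hdist X Y \<noteq> hdist X Z"
proof
  assume eq: "hdist X Y = hdist X Z"
  have arith: "n + 2 * a = 2 * b + r + y \<Longrightarrow> n + 2 * a' = 2 * b' + r + z \<Longrightarrow>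
      y \<noteq> Suc z \<and> z \<noteq> Suc y" for n a b r y a' b' z :: nat
    by presburger
  have B: "Y \<in> \<B>" "Z \<in> \<B>" using adj_BG YZ by auto
  have "rank Y = Suc (rank Z) \<or> rank Z = Suc (rank Y)"
    using YZ hasseD(4) unfolding bary_adj_def by blast
  then show False
    using arith[OF hdist_formula[OF X B(1)] hdist_formula[OF X B(2), folded eq]] by blast
qed

text \<open>As long as the core is kept, so are the closest pairs in it, and only the rank term of
  \<open>hdist_formula\<close> changes.\<close>

lemma core_restrict:
  assumes B: "A \<in> \<B>" "Z \<in> \<B>" "U \<in> \<B>" and A: "core Z U \<subseteq> A" "A \<subseteq> Z"
  shows "gap A U = gap Z U" "core A U = core Z U" "hdist A U + rank Z = hdist Z U + rank A"
proof -
  note G = BG_D(2,3)[OF B(1)] BG_D(2,3)[OF B(2)] BG_D(2,3)[OF B(3)]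
  obtain z where z: "z \<in> core Z U" using core_nonempty[OF G(3-6)] by blast
  note Z = core_gate_gate[OF G(3-6) z]
  have "gap A U \<le> gap Z U" using gap_le[of z A "gate U z" U] z A Z by auto
  moreover obtain a u where "a \<in> A" "u \<in> U" "d a u = gap A U" using gap_attained[OF G(2,6)] by blast
  then have "gap Z U \<le> gap A U" using gap_le[of a Z u U] A by auto
  ultimately show g: "gap A U = gap Z U" by simp
  then show c: "core A U = core Z U" using A unfolding core_def by auto
  show "hdist A U + rank Z = hdist Z U + rank A"
    using hdist_formula[OF B(1,3)] hdist_formula[OF B(2,3)] g c by simp
qed

text \<open>The smaller rank saves 1, while a larger gap costs at least 2, and then the core cannot
  gain rank, because the gate map of \<open>A\<close> sends part of \<open>core Z U\<close> onto
  \<open>core A U\<close>. So the gap stays, and comparing ranks shows that the cores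
  coincide.\<close>

lemma core_lower:
  assumes h: "hasse_orient V E A Z" and U: "U \<in> \<B>" and lt: "hdist A U < hdist Z U"
  shows "core Z U \<subseteq> A"
proof -
  note H = hasseD[OF h]
  note G = BG_D(2,3)[OF H(1)] BG_D(2,3)[OF H(2)] BG_D(2,3)[OF U]
  have F: "hdist A U + 2 * rank (core A U) = 2 * gap A U + rank A + rank U"
    "hdist Z U + 2 * rank (core Z U) = 2 * gap Z U + rank Z + rank U"
    using hdist_formula H U by auto
  obtain a u where au: "a \<in> A" "u \<in> U" "d a u = gap A U" using gap_attained[OF G(2,6)] by blast
  have ge: "gap Z U \<le> gap A U" using gap_le[of a Z u U] au H by auto
  have C: "core A U \<in> \<B>" "core Z U \<in> \<B>" using core_BG H U by auto
  show ?thesis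
  proof (cases "gap A U = gap Z U")
    case True
    then have "core A U \<subseteq> core Z U" using H(5) unfolding core_def by auto
    moreover have "rank (core Z U) \<le> rank (core A U)" using F lt True H(4) by simp
    ultimately have "core A U = core Z U" using rank_eq C by blast
    then show ?thesis using core_subset[OF G(1,2,5,6)] by simp
  next
    case False
    have "rank (core A U) \<le> rank (core Z U)"
    proof -
      obtain p where p: "p \<in> core A U" using BG_D(3)[OF C(1)] by blast
      obtain q where q: "q \<in> core A U" "d p q = rank (core A U)" using rank_antipode[OF C(1) p] by blast
      have "\<exists>p'\<in>core Z U. p = gate A p'" if "p \<in> core A U" for p
      proof -
        note P = core_gate_gate[OF G(1,2,5,6) that]
        have "gate Z (gate U p) \<in> core Z U" using gate_in_core[OF G(3-6) P(2)] .
        moreover have "gate A (gate Z (gate U p)) = p" using gate_gate[OF G(3) G(1) H(5) P(6)] P(1) by simp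
        ultimately show ?thesis by metis
      qed
      then obtain p' q' where "p' \<in> core Z U" "p = gate A p'" "q' \<in> core Z U" "q = gate A q'" using p q by meson
      moreover have "p' \<in> V" "q' \<in> V" using calculation BG_D(4)[OF C(2)] by blast+
      ultimately show ?thesis using gate_nonexp[OF G(1), of p' q'] rank_ge[OF C(2), of p' q'] q by auto
    qed
    then show ?thesis using F lt H(4) ge False by simp
  qed
qed

text \<open>\<open>Y\<close> is pushed one step towards its projection. A neighbour \<open>v\<close>
  of \<open>z\<close> on a geodesic to \<open>X\<close> is transported by quadrangles along
  \<open>Y\<close> to a vertex \<open>s\<close> next to the antipode \<open>a\<close> of
  \<open>z\<close>; \<open>s\<close> is a new direction at \<open>a\<close>, so
  \<open>(a, v)\<close> is Boolean. In \<open>hdist_formula\<close> the gap counts twice and drops,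
  the rank counts once and grows by 1.\<close>

lemma parallel_extend:
  assumes B: "X \<in> \<B>" "Y \<in> \<B>" and c: "core Y X = Y" and g: "gap Y X > 0"
  shows "\<exists>Z. hasse_orient V E Y Z \<and> hdist Z X < hdist Y X"
proof -
  note G = BG_D(2,3)[OF B(1)] BG_D(2,3)[OF B(2)]
  note GYX = G(3,4,1,2)
  obtain m where m: "gap Y X = Suc m" using g by (metis gr0_implies_Suc)
  obtain z where z: "z \<in> Y" using G by blast
  have cY: "y \<in> core Y X" if "y \<in> Y" for y using c that by simp
  note N = core_gate_gate[OF GYX cY]
  have far: "Suc m \<le> d y x" if "y \<in> Y" "x \<in> X" for x y using gap_le[OF that] m by simp
  have "d (gate X z) z = Suc m" using N(3)[OF z] m by (simp add: dist_comm)
  then obtain v where v: "E z v" "d (gate X z) v = m" using dist_pred[OF N(6,5)[OF z]] by blast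
  have vV: "v \<in> V" using v adj_V by auto
  have chain: "\<exists>w. E b w \<and> d (gate X b) w = m \<and> d v w \<le> d z b" if "b \<in> Y" for b
    using that
  proof (induction "d z b" arbitrary: b)
    case 0
    then have "z = b" using dist_eq_0[OF N(5)[OF z] N(5)[OF 0(2)]] by simp
    then show ?case using v vV by (intro exI[of _ v]) simp
  next
    case (Suc n)
    have V: "z \<in> V" "b \<in> V" using N(5) z Suc by auto
    obtain e where e: "E b e" "d z e = n" using dist_pred[OF V] Suc(2) by metis
    have eY: "e \<in> Y"
      using gated_convex[OF G(3) z Suc(3), of e] e Suc(2) adj_V dist_adj[OF adj_sym[OF e(1)]] by auto
    obtain w where w: "E e w" "d (gate X e) w = m" "d v w \<le> n" using Suc(1)[of e] e eY by auto
    have wV: "w \<in> V" using w adj_V by auto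
    let ?u = "gate X b"
    have uV: "?u \<in> V" using N(6)[OF Suc(3)] .
    have uu: "E (gate X e) ?u"
      using core_isometry[OF GYX cY[OF eY] cY[OF Suc(3)]] dist_adj[OF adj_sym[OF e(1)]]
        dist_eq_1[OF N(6)[OF eY] uV] by simp
    have be: "d ?u b = Suc m" using N(3)[OF Suc(3)] m by (simp add: dist_comm)
    have eu: "d ?u e = Suc (Suc m)"
      using gate_d[OF G(1) N(5)[OF eY] N(2)[OF Suc(3)]] N(3)[OF eY] m dist_adj[OF uu] by (simp add: dist_comm)
    have wu: "d ?u w = Suc m"
      using adj_dist_le[OF uu wV] adj_dist_le[OF w(1) uV] w eu by (simp add: dist_comm)
    have "b \<noteq> w" using far[OF Suc(3) N(2)[OF eY]] w by (auto simp: dist_comm)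
    then obtain x where x: "E x b" "E x w" "Suc (d ?u x) = Suc m"
      using quadrangle_cond[OF adj_sym[OF e(1)] w(1) _ uV] be eu wu by auto
    have "d v x \<le> Suc n" using adj_dist_le[OF x(2) vV] w by simp
    then show ?case using x adj_sym Suc(2) by (intro exI[of _ x]) auto
  qed
  obtain a where a: "a \<in> Y" "d z a = rank Y" using rank_antipode[OF B(2) z] by blast
  obtain s where s: "E a s" "d (gate X a) s = m" "d v s \<le> rank Y" using chain[OF a(1)] a by auto
  have vY: "v \<notin> Y" using far[of v "gate X z"] N(2)[OF z] v by (auto simp: dist_comm)
  have sY: "s \<notin> Y" using far[of s "gate X a"] N(2)[OF a(1)] s by (auto simp: dist_comm)
  have va: "d v a = Suc (rank Y)" using outside_gate(2)[OF G(3) z v(1) vY a(1)] a by simp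
  have sz: "d s z = Suc (rank Y)"
    using outside_gate(2)[OF G(3) a(1) s(1) sY z] a by (simp add: dist_comm)
  have "d s v = rank Y" using adj_dist_le[OF s(1) vV] s va by (simp add: dist_comm)
  then have "s \<in> dirs a v" using s va by (auto simp: dirs_def dist_comm)
  moreover have "s \<notin> dirs a z" using sz a by (auto simp: dirs_def dist_comm)
  moreover have "boolean a z" using thick_gated_boolean[OF BG_D(1)[OF B(2)] a(1) z] .
  ultimately have bav: "boolean a v"
    using boolean.step[of a z v] v(1) va a by (auto simp: dist_comm)
  define Z where "Z = bhull a v"
  note Z = bhull_extend[OF B(2) z v(1) vY a bav, folded Z_def]
  have h: "hasse_orient V E Y Z" using hasse_iff Z B vY by blast
  have "gap Z X \<le> m" using gap_le[OF Z(4) N(2)[OF z]] v by (simp add: dist_comm)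
  moreover have "rank Y \<le> rank (core Z X)"
  proof -
    note GZ = BG_D(2,3)[OF Z(1)]
    \<comment> \<open>Projecting the core of \<open>Z\<close> back to \<open>Y\<close> recovers
      every vertex of \<open>Y\<close>, so this core has at least the rank of
      \<open>Y\<close>.\<close>
    have gg: "gate Y (gate Z (gate X y)) = y" if "y \<in> Y" for y
      using gate_gate[OF GZ(1) G(3) Z(3) N(6)[OF that]] N(1)[OF that] by simp
    have "rank Y = d z a" using a by simp
    also have "\<dots> \<le> d (gate Z (gate X z)) (gate Z (gate X a))"
      using gate_nonexp[OF G(3), of "gate Z (gate X z)" "gate Z (gate X a)"] gg z a gate_V[OF GZ(1)] N(6) by auto
    also have "\<dots> \<le> rank (core Z X)"
      by (rule rank_ge[OF core_BG[OF Z(1) B(1)]]) (use gate_in_core[OF GZ G(1,2)] N(2) z a in auto)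
    finally show ?thesis .
  qed
  ultimately have "hdist Z X < hdist Y X"
    using hdist_formula[OF Z(1) B(1)] hdist_formula[OF B(2,1)] c m Z(2) by simp
  then show ?thesis using h by blast
qed

text \<open>A set larger than its core is lowered towards the core. If both sets are their own
  cores, they are parallel, the gap is positive because they differ, and
  \<open>parallel_extend\<close> applies.\<close>

lemma hdist_descent:
  assumes B: "X \<in> \<B>" "Y \<in> \<B>" "X \<noteq> Y"
  shows "(\<exists>Z. bary_adj V E Y Z \<and> Suc (hdist X Z) = hdist X Y) \<or> (\<exists>Z. bary_adj V E X Z \<and> Suc (hdist Z Y) = hdist X Y)"
proof -
  note G = BG_D(2,3)[OF B(1)] BG_D(2,3)[OF B(2)]
  have low: "\<exists>Z. bary_adj V E Y Z \<and> Suc (hdist Z X) = hdist Y X"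
    if B: "X \<in> \<B>" "Y \<in> \<B>" and ne: "core Y X \<noteq> Y" for X Y
  proof -
    have "core Y X \<subset> Y" using ne core_subset BG_D B by (metis psubsetI)
    then obtain Z where Z: "Z \<in> \<B>" "core Y X \<subseteq> Z" "hasse_orient V E Z Y"
      using lower_cover[OF core_BG[OF B(2,1)] B(2)] by blast
    have "hdist Z X + rank Y = hdist Y X + rank Z" using core_restrict(3)[OF Z(1) B(2,1) Z(2)] hasseD[OF Z(3)] by simp
    then show ?thesis using Z hasseD(4)[OF Z(3)] by (intro exI[of _ Z]) (simp add: bary_adj_def)
  qed
  consider "core Y X \<noteq> Y" | "core X Y \<noteq> X" | "core Y X = Y" "core X Y = X" by blast
  then show ?thesis
  proof cases
    case 1
    then show ?thesis using low[OF B(1,2)] hdist_commute by metis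
  next
    case 2
    then show ?thesis using low[OF B(2,1)] by metis
  next
    case 3
    have "gap Y X > 0"
    proof (rule ccontr)
      assume "\<not> gap Y X > 0"
      then have z: "gap Y X = 0" "gap X Y = 0" using gap_commute by auto
      have "y \<in> X" if "y \<in> Y" for y
        using core_gate_gate[OF G(3,4,1,2), of y] 3 that z dist_eq_0 by metis
      moreover have "x \<in> Y" if "x \<in> X" for x
        using core_gate_gate[OF G, of x] 3 that z dist_eq_0 by metis
      ultimately show False using B(3) by blast
    qed
    then obtain Z where Z: "hasse_orient V E Y Z" "hdist Z X < hdist Y X" using parallel_extend[OF B(1,2) 3(1)] by blast
    have a: "bary_adj V E Y Z" "bary_adj V E Z Y" using Z by (auto simp: bary_adj_def)
    then show ?thesis using hdist_lip[OF B(1) a(2)] Z(2) hdist_commute by (metis Suc_leI le_antisym)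
  qed
qed

section \<open>The quadrangle condition for the Hausdorff distance\<close>

lemma quad_lower:
  assumes h: "hasse_orient V E A Z" "hasse_orient V E B Z" "A \<noteq> B" and U: "U \<in> \<B>"
    and lt: "hdist A U < hdist Z U" "hdist B U < hdist Z U"
  shows "\<exists>X. hasse_orient V E X A \<and> hasse_orient V E X B \<and> hdist X U + 2 = hdist Z U"
proof -
  note HA = hasseD[OF h(1)] and HB = hasseD[OF h(2)]
  have c: "core Z U \<subseteq> A \<inter> B" using core_lower[OF h(1) U lt(1)] core_lower[OF h(2) U lt(2)] by blast
  have ne: "A \<inter> B \<noteq> {}" using c BG_D(3)[OF core_BG[OF HA(2) U]] by blast
  have X: "A \<inter> B \<in> \<B>" using BG_Int[OF HA(1) HB(1) ne] .
  have "A \<inter> B \<noteq> A" "A \<inter> B \<noteq> B" using rank_eq[OF HA(1) HB(1)] rank_eq[OF HB(1) HA(1)] HA(4) HB(4) h(3) by auto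
  then have s: "A \<inter> B \<subset> A" "A \<inter> B \<subset> B" by auto
  obtain a where a: "a \<in> A" "d a (gate (A \<inter> B) a) + rank (A \<inter> B) = rank A"
    using rank_far[OF X HA(1)] by blast
  have aV: "a \<in> V" using a BG_D(4)[OF HA(1)] by auto
  \<comment> \<open>Since \<open>B\<close> has rank one less than \<open>Z\<close>, the gate of
    \<open>a\<close> in \<open>B\<close> is within distance 1; it also lies in \<open>A\<close>, so
    the intersection has rank at least that of \<open>A\<close> minus 1.\<close>
  have "gate B a \<in> A \<inter> B"
    using gate_Int[OF BG_D(2)[OF HB(1)] BG_D(2)[OF HA(1)] a(1)] ne gate_in[OF BG_D(2)[OF HB(1)] aV] by blast
  then have "d a (gate (A \<inter> B) a) \<le> d a (gate B a)" using gate_le[OF BG_D(2)[OF X] aV] by blast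
  moreover have "d a (gate B a) \<le> 1" using rank_gate[OF HB(1,2,5), of a] a(1) HA(5) HB(4) by auto
  ultimately have r: "rank A = Suc (rank (A \<inter> B))" using a rank_strict[OF X HA(1) s(1)] by simp
  have "hdist (A \<inter> B) U + rank Z = hdist Z U + rank (A \<inter> B)"
    using core_restrict(3)[OF X HA(2) U c] HA(5) by blast
  then show ?thesis
    using r s X HA HB hasse_iff by (intro exI[of _ "A \<inter> B"]) auto
qed

text \<open>\<open>X\<close> is generated by \<open>A\<close> and a vertex of
  \<open>core B U\<close> outside \<open>Z\<close>; by \<open>core_restrict\<close> it remains to
  show that \<open>X\<close> contains all of \<open>core B U\<close>.\<close>

lemma quad_chain:
  assumes h: "hasse_orient V E A Z" "hasse_orient V E Z B" and U: "U \<in> \<B>"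
    and lt: "hdist A U < hdist Z U" "hdist Z U = Suc (hdist B U)"
  shows "\<exists>X. hasse_orient V E A X \<and> hasse_orient V E X B \<and> Suc (hdist X U) = hdist B U"
proof -
  note HA = hasseD[OF h(1)] and HB = hasseD[OF h(2)]
  note GA = BG_D(2,3)[OF HA(1)] and GZ = BG_D(2,3)[OF HA(2)] and GB = BG_D(2,3)[OF HB(2)] and GU = BG_D(2,3)[OF U]
  have cA: "core Z U \<subseteq> A" using core_lower[OF h(1) U lt(1)] .
  note CZ = core_BG[OF HA(2) U] and CB = core_BG[OF HB(2) U]
  \<comment> \<open>With \<open>le\<close> below, either the gap stays and the core gains exactly
    one rank, or the gap drops and the core gains none.\<close>
  have F: "gap B U + rank (core Z U) + 1 = gap Z U + rank (core B U)"
    using hdist_formula[OF HA(2) U] hdist_formula[OF HB(2) U] lt HB(4) by simp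
  obtain z u where zu: "z \<in> Z" "u \<in> U" "d z u = gap Z U" using gap_attained[OF GZ(2) GU(2)] by blast
  have le: "gap B U \<le> gap Z U" using gap_le[of z B u U] zu HB by auto
  have near: "d b (gate Z b) \<le> 1" if "b \<in> B" for b using rank_gate[OF HB(1,2,5) that] HB(4) by simp
  have step: "\<exists>X. hasse_orient V E A X \<and> hasse_orient V E X B \<and> w \<in> X \<and> rank X = Suc (rank A)"
    if w: "w \<in> core B U" "w \<notin> Z" and a: "a \<in> A" "E a w" for a w
  proof -
    have wB: "w \<in> B" using w core_subset[OF GB GU] by blast
    have wA: "w \<notin> A" using w HA by auto
    obtain X where X: "X \<in> \<B>" "A \<subset> X" "w \<in> X" "X \<subseteq> B" "rank X = Suc (rank A)"
      using cover_through[OF HA(1) HB(2) _ a wA wB] HA(5) HB(5) by blast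
    then have "X \<noteq> B" using HA(4) HB(4) by auto
    then show ?thesis using X hasse_iff HA HB by (intro exI[of _ X]) auto
  qed
  have fin: "Suc (hdist X U) = hdist B U" if X: "hasse_orient V E X B" "core B U \<subseteq> X" for X
    using core_restrict(3)[OF hasseD(1,2)[OF X(1)] U X(2) hasseD(5)[OF X(1)]] hasseD(4)[OF X(1)] by simp
  show ?thesis
  proof (cases "gap B U = gap Z U")
    case True
    then have sub: "core Z U \<subseteq> core B U" using HB(5) unfolding core_def by auto
    have r: "rank (core B U) = Suc (rank (core Z U))" using F True by simp
    then have "core Z U \<noteq> core B U" by auto
    then obtain a w where w: "a \<in> core Z U" "w \<in> core B U" "w \<notin> core Z U" "E a w"
      using boundary_edge[OF BG_D(6)[OF CB] sub BG_D(3)[OF CZ]] by blast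
    have "w \<notin> Z" using w(2,3) True unfolding core_def by auto
    then obtain X where X: "hasse_orient V E A X" "hasse_orient V E X B" "w \<in> X"
      using step[OF w(2) _ _ w(4)] w(1) cA by blast
    have CX: "core B U \<inter> X \<in> \<B>" using BG_Int[OF CB hasseD(2)[OF X(1)]] w X by blast
    have "core Z U \<subseteq> core B U \<inter> X" using sub cA hasseD(5)[OF X(1)] by blast
    then have "core Z U \<subset> core B U \<inter> X" using w X by blast
    then have "rank (core Z U) < rank (core B U \<inter> X)" using rank_strict[OF CZ CX] by blast
    then have "core B U \<inter> X = core B U" using rank_eq[OF CX CB] r by simp
    then show ?thesis using X fin by blast
  next
    case False
    obtain b where b: "b \<in> core B U" using BG_D(3)[OF CB] by blast
    define u where "u = gate U b"
    note Bb = core_gate_gate[OF GB GU b, folded u_def]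
    have gb: "gate Z b = gate Z u" using gate_gate[OF GB(1) GZ(1) HB(5) Bb(6)] Bb(1) by simp
    have gA: "gate Z b \<in> A" using gate_in_core[OF GZ GU Bb(2)] gb cA by auto
    have bZ: "b \<notin> Z" using gap_le[of b Z u U] Bb False le by auto
    have gZ: "gate Z b \<in> Z" "gate Z b \<in> V" using gate_in[OF GZ(1) Bb(5)] gate_V[OF GZ(1) Bb(5)] by auto
    have "d b (gate Z b) \<noteq> 0" using dist_eq_0[OF Bb(5) gZ(2)] bZ gZ by metis
    then have "d (gate Z b) b = Suc 0" using near[OF Bb(4)] by (simp add: dist_comm)
    then have Eb: "E (gate Z b) b" using dist_eq_1[OF gZ(2) Bb(5)] by simp
    obtain X where X: "hasse_orient V E A X" "hasse_orient V E X B" "b \<in> X"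
      using step[OF b bZ gA Eb] by blast
    note HX = hasseD[OF X(1)]
    note GX = BG_D(2,3)[OF HX(2)]
    have CX: "core B U \<inter> X \<in> \<B>" using BG_Int[OF CB HX(2)] b X by blast
    \<comment> \<open>As the gap drops, \<open>core B U\<close> has at most the rank of
      \<open>core Z U\<close>, and the nonexpansive gate map of \<open>A\<close> covers
      \<open>core Z U\<close> already from \<open>core B U \<inter> X\<close>.\<close>
    have "rank (core B U) \<le> rank (core B U \<inter> X)"
    proof -
      have "rank (core Z U) \<le> rank (core B U \<inter> X)"
      proof -
        obtain p where p: "p \<in> core Z U" using BG_D(3)[OF CZ] by blast
        obtain q where q: "q \<in> core Z U" "d p q = rank (core Z U)" using rank_antipode[OF CZ p] by blast
        have *: "\<exists>p'\<in>core B U \<inter> X. gate A p' = p" if p: "p \<in> core Z U" for p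
        proof -
          note P = core_gate_gate[OF GZ GU p]
          have pA: "p \<in> A" using p cA by blast
          have gA: "gate A (gate U p) = p"
            using gate_gate[OF GZ(1) GA(1) HA(5) P(6)] P(1) gate_self[OF GA(1) pA] by simp
          have gc: "gate B (gate U p) \<in> core B U" using gate_in_core[OF GB GU P(2)] .
          have "gate X (gate B (gate U p)) \<in> core B U \<inter> X"
            using gate_Int[OF GX(1) BG_D(2)[OF CB] gc] b X gate_in[OF GX(1) gate_V[OF GB(1) P(6)]] by blast
          moreover have "gate A (gate X (gate B (gate U p))) = p"
            using gate_gate[OF GB(1) GX(1) hasseD(5)[OF X(2)] P(6)] gate_gate[OF GX(1) GA(1) HX(5) P(6)] gA by simp
          ultimately show ?thesis by blast
        qed
        obtain p' q' where pq: "p' \<in> core B U \<inter> X" "gate A p' = p" "q' \<in> core B U \<inter> X" "gate A q' = q"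
          using *[OF p] *[OF q(1)] by blast
        have "p' \<in> V" "q' \<in> V" using pq BG_D(4)[OF CX] by auto
        then show ?thesis
          using gate_nonexp[OF GA(1), of p' q'] rank_ge[OF CX pq(1,3)] pq q by simp
      qed
      moreover have "gap B U < gap Z U" using False le by simp
      ultimately show ?thesis using F by simp
    qed
    then have "core B U \<inter> X = core B U" using rank_eq[OF CX CB] by blast
    then show ?thesis using X fin by blast
  qed
qed

text \<open>The join of \<open>A\<close> and \<open>B\<close> must be constructed. A vertex
  \<open>t\<close> of \<open>U\<close> farthest from \<open>Z\<close> is closer to \<open>A\<close>
  and to \<open>B\<close>, so its gate \<open>z\<close> has neighbours \<open>v\<close> in
  \<open>A\<close> and \<open>w\<close> in \<open>B\<close> towards \<open>t\<close>, with a common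
  neighbour \<open>c\<close> beyond. \<open>B\<close> has a vertex \<open>s\<close> outside
  \<open>Z\<close> next to an antipode \<open>a\<close> of \<open>z\<close>; \<open>c\<close> is a
  direction at \<open>v\<close> towards \<open>s\<close> but not towards \<open>a\<close>, so
  \<open>(v, s)\<close> is Boolean, and its hull is the join.\<close>

lemma quad_upper:
  assumes h: "hasse_orient V E Z A" "hasse_orient V E Z B" "A \<noteq> B" and U: "U \<in> \<B>"
    and lt: "hdist Z U = Suc (hdist A U)" "hdist Z U = Suc (hdist B U)"
  shows "\<exists>X. hasse_orient V E A X \<and> hasse_orient V E B X \<and> Suc (hdist X U) = hdist A U"
proof -
  note HA = hasseD[OF h(1)] and HB = hasseD[OF h(2)]
  note GA = BG_D(2,3)[OF HA(2)] and GZ = BG_D(2,3)[OF HA(1)] and GB = BG_D(2,3)[OF HB(2)] and GU = BG_D(2,3)[OF U]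
  note clA = BG_D(5)[OF HA(2)] and clB = BG_D(5)[OF HB(2)]
  have AB: "A \<inter> B = Z"
  proof -
    have I: "A \<inter> B \<in> \<B>" using BG_Int[OF HA(2) HB(2)] HA(5) HB(5) GZ by blast
    have "A \<inter> B \<noteq> A" using rank_eq[OF HA(2) HB(2)] HA(4) HB(4) h(3) by auto
    then have "rank (A \<inter> B) < rank A" using rank_strict[OF I HA(2)] by blast
    then show ?thesis using rank_eq[OF HA(1) I] HA(4,5) HB(5) by auto
  qed
  obtain t where t: "t \<in> U" "d t (gate Z t) = ecc U Z" using ecc_attained[OF U HA(1)] by blast
  have tV: "t \<in> V" using t BG_D(4)[OF U] by auto
  define z where "z = gate Z t"
  have z: "z \<in> Z" "z \<in> V" using gate_in[OF GZ(1) tV] gate_V[OF GZ(1) tV] by (auto simp: z_def)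
  have toward: "\<exists>v\<in>A. v \<notin> Z \<and> E z v \<and> d t z = Suc (d t v)"
    if H: "hasse_orient V E Z A" and lt: "hdist Z U = Suc (hdist A U)" for A
  proof -
    note HA = hasseD[OF H]
    have GA: "gated V E A" using BG_D(2)[OF HA(2)] .
    \<comment> \<open>Enlarging \<open>Z\<close> cannot lower its directed distance to
      \<open>U\<close>, so the drop of \<open>hdist\<close> comes from the opposite
      direction.\<close>
    have "ecc Z U \<le> ecc A U"
      using ecc_triangle[OF HA(1,2) U] ecc_subset[OF HA(1,2,5)] by simp
    then have "ecc U A < ecc U Z" using lt by (simp add: hdist_def)
    then have lt: "d t (gate A t) < d t z" using ecc_ge[OF U HA(2) t(1)] t by (simp add: z_def)
    define g where "g = gate A t"
    have g: "g \<in> A" "g \<in> V" using gate_in[OF GA tV] gate_V[OF GA tV] by (auto simp: g_def)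
    have zA: "z \<in> A" using z HA by auto
    have tz: "d t z = d t g + d g z" using gate_d[OF GA tV zA] by (simp add: g_def)
    then obtain n where n: "d g z = Suc n" using lt by (metis g_def add_0_right less_irrefl not0_implies_Suc)
    obtain v where v: "E z v" "d g v = n" using dist_pred[OF g(2) z(2) n] by blast
    have vV: "v \<in> V" using v adj_V by auto
    have vA: "v \<in> A" using gated_convex[OF GA g(1) zA vV] v n dist_adj[OF adj_sym[OF v(1)]] by simp
    have "d t v \<le> d t g + n" using dist_triangle[OF tV g(2) vV] v by simp
    then have tv: "d t z = Suc (d t v)" using adj_dist_le[OF v(1) tV] tz n by simp
    have "v \<notin> Z" using gate_le[OF GZ(1) tV, of v] tv by (auto simp: z_def)
    then show ?thesis using vA v tv by blast
  qed
  obtain v where v: "v \<in> A" "v \<notin> Z" "E z v" "d t z = Suc (d t v)" using toward[OF h(1) lt(1)] by blast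
  obtain w where w: "w \<in> B" "w \<notin> Z" "E z w" "d t z = Suc (d t w)" using toward[OF h(2) lt(2)] by blast
  have vw: "v \<noteq> w" "v \<notin> B" "w \<notin> A" using v w AB by auto
  obtain c where c: "E c v" "E c w" "Suc (d t c) = d t v"
    using quadrangle_cond[OF v(3) w(3) vw(1) tV] v w by auto
  have cz: "c \<noteq> z" using c v by auto
  have zA: "z \<in> A" and zB: "z \<in> B" using z HA HB by auto
  have cA: "c \<notin> A" using nbr_closedD[OF clA _ zA c(2) adj_sym[OF w(3)] cz] vw by blast
  have cV: "c \<in> V" using c adj_V by auto
  obtain a where a: "a \<in> Z" "d z a = rank Z" using rank_antipode[OF HA(1) z(1)] by blast
  have aA: "a \<in> A" and aB: "a \<in> B" using a HA HB by auto
  have wa: "d w a = Suc (rank Z)" using outside_gate(2)[OF GZ(1) z(1) w(3,2) a(1)] a by simp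
  have va: "d v a = Suc (rank Z)" using outside_gate(2)[OF GZ(1) z(1) v(3,2) a(1)] a by simp
  have "boolean a w" using thick_gated_boolean[OF BG_D(1)[OF HB(2)] aB w(1)] .
  then have "\<not> dirs a w \<subseteq> dirs a z"
    using boolean_lower[OF _ w(3)] wa a by (simp add: dist_comm)
  then obtain s where s: "s \<in> dirs a w" "s \<notin> dirs a z" by blast
  have as: "E a s" "d s w = rank Z" using s wa by (auto simp: dirs_def dist_comm)
  have sV: "s \<in> V" using as adj_V by auto
  have sB: "s \<in> B" using gated_dirs[OF GB(1) aB w(1)] s by blast
  have "d s z = Suc (d a z)"
    using dirs_new[OF w(3) _ _ s] wa a z BG_D(4)[OF HA(1)] by (auto simp: dist_comm)
  then have sZ: "s \<notin> Z" using rank_ge[OF HA(1) _ z(1), of s] a by (auto simp: dist_comm)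
  then have sA: "s \<notin> A" using sB AB by auto
  have sv: "d v s = Suc (Suc (rank Z))"
    using outside_gate(2)[OF GA(1) aA as(1) sA v(1)] va by (simp add: dist_comm)
  have ca: "d c a = Suc (d v a)" using outside_gate(2)[OF GA(1) v(1) adj_sym[OF c(1)] cA aA] by simp
  have "d c s \<le> Suc (rank Z)" using adj_dist_le[OF c(2) sV] as by (simp add: dist_comm)
  then have "Suc (d c s) = d v s" using adj_dist_le[OF c(1) sV] sv by (simp add: dist_comm)
  then have "c \<in> dirs v s" "c \<notin> dirs v a" using c adj_sym ca by (auto simp: dirs_def)
  moreover have "boolean v a" using thick_gated_boolean[OF BG_D(1)[OF HA(2)] v(1) aA] .
  ultimately have bvs: "boolean v s" using boolean.step[of v a s] as sv va by auto
  define X where "X = bhull v s"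
  have va': "d a v = rank A" using va HA(4) by (simp add: dist_comm)
  note X = bhull_extend[OF HA(2) aA as(1) sA v(1) va' bvs, folded X_def]
  have XB: "X \<inter> B \<in> \<B>" using BG_Int[OF X(1) HB(2)] X(3) aA aB by blast
  have "Z \<subset> X \<inter> B" using X(3,4) HA(5) HB(5) sB sZ by blast
  then have "rank Z < rank (X \<inter> B)" using rank_strict[OF HA(1) XB] by blast
  then have "X \<inter> B = B" using rank_eq[OF XB HB(2)] HB(4) by simp
  then have BX: "B \<subseteq> X" by blast
  have hA: "hasse_orient V E A X" using hasse_iff X HA(2) sA by blast
  have hB: "hasse_orient V E B X"
    unfolding hasse_iff using BX X HB HA(4) vw(2) v(1) by auto
  \<comment> \<open>Otherwise projecting to \<open>B\<close> puts the core of \<open>B\<close> into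
    \<open>Z\<close>, and then \<open>hdist Z U\<close> is smaller than
    \<open>hdist B U\<close>.\<close>
  have "\<not> core X U \<subseteq> A"
  proof
    assume c: "core X U \<subseteq> A"
    have "core B U \<subseteq> Z"
    proof
      fix b assume "b \<in> core B U"
      note b = core_gate_gate[OF GB GU this]
      have "gate X (gate U b) \<in> A" using gate_in_core[OF BG_D(2,3)[OF X(1)] GU b(2)] c by blast
      moreover have "gate B (gate X (gate U b)) = b"
        using gate_gate[OF BG_D(2)[OF X(1)] GB(1) BX b(6)] b(1) by simp
      ultimately have "b \<in> A" using gate_Int[OF GB(1) GA(1), of "gate X (gate U b)"] zA zB by auto
      then show "b \<in> Z" using AB b(4) by blast
    qed
    then have "hdist Z U + rank B = hdist B U + rank Z" using core_restrict(3)[OF HB(1,2) U _ HB(5)] by blast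
    then show False using lt HB(4) by simp
  qed
  then have "\<not> hdist A U < hdist X U" using core_lower[OF hA U] by blast
  moreover have a: "bary_adj V E A X" "bary_adj V E X A" using hA by (auto simp: bary_adj_def)
  ultimately have "Suc (hdist X U) = hdist A U"
    using hdist_parity[OF U a(1)] hdist_lip[OF U a(2)] hdist_commute by (metis Suc_leI le_antisym not_less nat_less_le)
  then show ?thesis using hA hB by blast
qed

section \<open>Barycentric distance, modularity, orientation and embedding\<close>

lemma bary_simple: "simple_graph \<B> (bary_adj V E)"
  unfolding simple_graph_def bary_adj_def hasse_orient_def by blast

lemma hdist_self: "X \<in> \<B> \<Longrightarrow> hdist X X = 0"
  using ecc_subset[of X X] by (simp add: hdist_def)

lemma bary_dist:
  assumes "X \<in> \<B>" "Y \<in> \<B>"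
  shows "walk_of_len \<B> (bary_adj V E) (hdist X Y) X Y" "gdist \<B> (bary_adj V E) X Y = hdist X Y"
  using gdist_characterization[of \<B> "bary_adj V E" hdist X Y, OF bary_simple hdist_self hdist_lip hdist_commute hdist_descent assms]
  by auto

lemma bary_connected: "connected_graph \<B> (bary_adj V E)"
  unfolding connected_graph_def using bary_simple bary_dist by blast

theorem bary_modular: "modular_graph \<B> (bary_adj V E)"
proof -
  interpret B: conn_graph \<B> "bary_adj V E" by unfold_locales (rule bary_connected)
  show ?thesis
  proof (rule B.bipartite_modular)
    show "gdist \<B> (bary_adj V E) P X \<noteq> gdist \<B> (bary_adj V E) P Y"
      if "bary_adj V E X Y" "P \<in> \<B>" for X Y P
      using hdist_parity[OF that(2,1)] bary_dist(2) that adj_BG[OF that(1)] by simp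
    fix U A B Z
    assume U: "U \<in> \<B>" and adj: "bary_adj V E Z A" "bary_adj V E Z B" and ne: "A \<noteq> B"
      and h: "gdist \<B> (bary_adj V E) U A = gdist \<B> (bary_adj V E) U B"
        "gdist \<B> (bary_adj V E) U Z = Suc (gdist \<B> (bary_adj V E) U A)"
    have M: "A \<in> \<B>" "B \<in> \<B>" "Z \<in> \<B>" using adj adj_BG by auto
    have hD: "hdist A U = hdist B U" "hdist Z U = Suc (hdist A U)" "hdist Z U = Suc (hdist B U)"
      using h bary_dist(2)[OF U] M hdist_commute by metis+
    have lt: "hdist A U < hdist Z U" "hdist B U < hdist Z U" using hD by auto
    have "\<exists>X. bary_adj V E X A \<and> bary_adj V E X B \<and> Suc (hdist X U) = hdist A U"
    proof -
      consider "hasse_orient V E A Z" "hasse_orient V E B Z" | "hasse_orient V E Z A" "hasse_orient V E Z B"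
        | "hasse_orient V E A Z" "hasse_orient V E Z B" | "hasse_orient V E B Z" "hasse_orient V E Z A"
        using adj unfolding bary_adj_def by blast
      then show ?thesis
      proof cases
        case 1
        obtain X where "hasse_orient V E X A" "hasse_orient V E X B" "hdist X U + 2 = hdist Z U"
          using quad_lower[OF 1 ne U lt] by blast
        then show ?thesis using hD unfolding bary_adj_def by (intro exI[of _ X]) simp
      next
        case 2
        show ?thesis using quad_upper[OF 2 ne U hD(2,3)] unfolding bary_adj_def by blast
      next
        case 3
        obtain X where "hasse_orient V E A X" "hasse_orient V E X B" "Suc (hdist X U) = hdist B U"
          using quad_chain[OF 3 U lt(1) hD(3)] by blast
        then show ?thesis using hD unfolding bary_adj_def by (intro exI[of _ X]) simp
      next
        case 4
        obtain X where "hasse_orient V E B X" "hasse_orient V E X A" "Suc (hdist X U) = hdist A U"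
          using quad_chain[OF 4 U lt(2) hD(2)] by blast
        then show ?thesis unfolding bary_adj_def by (intro exI[of _ X]) simp
      qed
    qed
    then obtain X where X: "bary_adj V E X A" "bary_adj V E X B" "Suc (hdist X U) = hdist A U" by blast
    have "gdist \<B> (bary_adj V E) U X = hdist X U" "gdist \<B> (bary_adj V E) U A = hdist A U"
      using bary_dist(2)[OF U] adj_BG[OF X(1)] M hdist_commute by metis+
    then show "\<exists>X. bary_adj V E X A \<and> bary_adj V E X B \<and>
        Suc (gdist \<B> (bary_adj V E) U X) = gdist \<B> (bary_adj V E) U A"
      using X by metis
  qed
qed

text \<open>If two opposite sides disagree, the ranks force two opposite corners to lie below both
  others; each of them is then the intersection of the upper two, so they coincide.\<close>

lemma hasse_square:
  assumes c: "induced_4cycle (bary_adj V E) x1 x2 x3 x4" and h: "hasse_orient V E x1 x2"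
  shows "hasse_orient V E x4 x3"
proof (rule ccontr)
  assume n: "\<not> hasse_orient V E x4 x3"
  have dis: "x1 \<noteq> x3" "x2 \<noteq> x4" and adj: "bary_adj V E x2 x3" "bary_adj V E x3 x4" "bary_adj V E x4 x1"
    using c by (auto simp: induced_4cycle_def)
  have h34: "hasse_orient V E x3 x4" using n adj by (auto simp: bary_adj_def)
  note H = hasseD[OF h] and H' = hasseD[OF h34]
  have r: "rank x3 = Suc (rank x2) \<or> rank x2 = Suc (rank x3)" "rank x4 = Suc (rank x1) \<or> rank x1 = Suc (rank x4)"
    using adj hasseD(4) unfolding bary_adj_def by blast+
  then have "rank x3 = rank x1 \<and> rank x2 = rank x4" using H(4) H'(4) by (elim disjE) linarith+
  then have rr: "rank x3 = rank x1" "rank x2 = rank x4" by blast+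
  have "hasse_orient V E x3 x2" using adj(1) hasseD(4) rr H(4) unfolding bary_adj_def by fastforce
  moreover have "hasse_orient V E x1 x4" using adj(3) hasseD(4) rr H'(4) unfolding bary_adj_def by fastforce
  ultimately have sub: "x1 \<subseteq> x2 \<inter> x4" "x3 \<subseteq> x2 \<inter> x4" using hasseD(5) h h34 by blast+
  have I: "x2 \<inter> x4 \<in> \<B>" using BG_Int[OF H(2) H'(2)] sub BG_D(3)[OF H(1)] by blast
  have "x2 \<inter> x4 \<noteq> x2" using rank_eq[OF H(2) H'(2)] rr dis by auto
  then have "rank (x2 \<inter> x4) < rank x2" using rank_strict[OF I H(2)] by blast
  then have "x1 = x2 \<inter> x4" "x3 = x2 \<inter> x4" using rank_eq[OF H(1) I sub(1)] rank_eq[OF H'(1) I sub(2)] H(4) rr by auto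
  then show False using dis by simp
qed

theorem hasse_admissible: "admissible_orientation \<B> (bary_adj V E) (hasse_orient V E)"
proof -
  have rot: "induced_4cycle (bary_adj V E) x2 x3 x4 x1" "induced_4cycle (bary_adj V E) x4 x3 x2 x1"
    if "induced_4cycle (bary_adj V E) x1 x2 x3 x4" for x1 x2 x3 x4
    using that unfolding induced_4cycle_def bary_adj_def by auto
  have one: "hasse_orient V E x1 x2 \<longleftrightarrow> hasse_orient V E x4 x3"
    if "induced_4cycle (bary_adj V E) x1 x2 x3 x4" for x1 x2 x3 x4
    using hasse_square[OF that] hasse_square[OF rot(2)[OF that]] by blast
  have asym: "\<not> (hasse_orient V E X Y \<and> hasse_orient V E Y X)" for X Y
    unfolding hasse_orient_def by blast
  show ?thesis
    unfolding admissible_orientation_def orientation_def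
  proof (intro conjI ballI allI impI)
    fix x1 x2 x3 x4 assume c: "induced_4cycle (bary_adj V E) x1 x2 x3 x4"
    note c2 = rot(1)[OF c]
    note c3 = rot(1)[OF c2]
    note c4 = rot(1)[OF c3]
    show "hasse_orient V E x1 x2 \<longleftrightarrow> hasse_orient V E x4 x3" using one[OF c] .
    show "hasse_orient V E x2 x3 \<longleftrightarrow> hasse_orient V E x1 x4" using one[OF c2] .
    show "hasse_orient V E x3 x4 \<longleftrightarrow> hasse_orient V E x2 x1" using one[OF c3] .
    show "hasse_orient V E x4 x1 \<longleftrightarrow> hasse_orient V E x3 x2" using one[OF c4] .
  qed (use asym in \<open>auto simp: bary_adj_def\<close>)
qed

lemma singleton_BG:
  assumes p: "p \<in> V"
  shows "{p} \<in> \<B>"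
proof -
  have "is_gate {p} x p" if "x \<in> V" for x using p by (simp add: is_gate_def)
  then have "gated V E {p}" using p gated_iff by blast
  then have T: "thick_gated {p}" by (simp add: thick_gated_def thick_at_def)
  have "opposite {p} p p" by (rule oppositeI[OF T]) (use adj_irrefl in auto)
  then show ?thesis using BG_iff by blast
qed

theorem singleton_dist:
  assumes "p \<in> V" "q \<in> V"
  shows "gdist \<B> (bary_adj V E) {p} {q} = 2 * d p q"
proof -
  have e: "ecc {p} {q} = d p q" if pq: "p \<in> V" "q \<in> V" for p q
  proof -
    have "gate {q} p = q" using gate_in[OF BG_D(2)[OF singleton_BG[OF pq(2)]] pq(1)] by simp
    then show ?thesis using ecc_attained[OF singleton_BG[OF pq(1)] singleton_BG[OF pq(2)]] by simp
  qed
  show ?thesis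
    using bary_dist(2)[OF singleton_BG[OF assms(1)] singleton_BG[OF assms(2)]] e assms
    by (simp add: hdist_def dist_comm)
qed

end

text \<open>For the empty graph the empty set is gated, so \<open>G\<^sup>*\<close> has one vertex.\<close>

lemma BG_empty: "BG {} E = {{}}"
  unfolding BG_def boolean_gated_def gated_def thick_def finite_diameter_def by auto

lemma bary_adj_empty: "\<not> bary_adj {} E X Y"
  unfolding bary_adj_def hasse_orient_def BG_empty by blast

theorem theorem6p10:
  fixes V :: "'a set" and E :: "'a \<Rightarrow> 'a \<Rightarrow> bool"
  assumes "swm_graph V E"
  shows "modular_graph (BG V E) (bary_adj V E)
       \<and> orientable (BG V E) (bary_adj V E)
       \<and> admissible_orientation (BG V E) (bary_adj V E) (hasse_orient V E)
       \<and> (\<forall>p\<in>V. \<forall>q\<in>V.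
            (1/2 :: real) * real (gdist (BG V E) (bary_adj V E) {p} {q}) = real (gdist V E p q))"
proof (cases "V = {}")
  case True
  have w: "walk_of_len {{}} (bary_adj {} E) 0 {} {}" by (rule walk_0) simp
  have "simple_graph {{}} (bary_adj {} E)" unfolding simple_graph_def using bary_adj_empty by blast
  then have con: "connected_graph {{}} (bary_adj {} E)" unfolding connected_graph_def using w by blast
  have "gdist {{}} (bary_adj {} E) {} {} = 0" using gdist_le[OF w] by simp
  then have "{} \<in> interval {{}} (bary_adj {} E) {} {}" by (simp add: interval_def)
  then have m: "modular_graph {{}} (bary_adj {} E)" using con by (auto simp: modular_graph_def)
  have a: "admissible_orientation {{}} (bary_adj {} E) (hasse_orient {} E)"
    unfolding admissible_orientation_def orientation_def
    using bary_adj_empty by (auto simp: induced_4cycle_def bary_adj_def)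
  show ?thesis using m a unfolding orientable_def True BG_empty by blast
next
  case False
  have "connected_graph V E" using assms by (simp add: swm_graph_def weakly_modular_def)
  then interpret swm_nonempty V E
    using assms False by unfold_locales
  show ?thesis
  proof (intro conjI ballI)
    show "orientable (BG V E) (bary_adj V E)"
      unfolding orientable_def using bary_modular hasse_admissible by blast
    show "1 / 2 * real (gdist (BG V E) (bary_adj V E) {p} {q}) = real (gdist V E p q)"
      if "p \<in> V" "q \<in> V" for p q
      using singleton_dist[OF that] by simp
  qed (rule bary_modular hasse_admissible)+
qed

end
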